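(* Let $\mathbf{x}_1,\dots,\mathbf{x}_n$ be i.i.d. $N_p(\mathbf{0},\boldsymbol{\Sigma})$ with $\boldsymbol{\Sigma}=(r^{|i-j|})_{1\le i,j\le p}$, $r=r_n\in[0,1)$, $p=p_n\to\infty$, and $\log p=o(n^{1/7})$. Suppose $r_n\to1$ and $1-r_n\ge C/\log p$ for all large $n$, for some constant $C>0$ not depending on $n$. Then, with $$c_n=\frac{\sqrt{2n\log p}}{1-r^2},\qquad d_n=\frac{r\sqrt{2n\log p}}{1-r^2}+2\log p-\tfrac12\big[\log\log p+\log(4\pi)\big],$$ $c_n\mathcal{L}_n-d_n$ converges weakly to the distribution with cdf $\exp(-e^{-x})$.
   Context: Write $\mathbf{x}_k=(x_{k1},\dots,x_{kp})^T$. For $1\le i<j\le p$ define $$\hat\rho_{i,j}=\frac{\sum_{k=1}^n x_{ki}x_{kj}}{\sqrt{\sum_{k=1}^n x_{ki}^2\sum_{k=1}^n x_{kj}^2}},\qquad \mathcal{L}_n=\max_{1\le i<j\le p}\hat\rho_{i,j}.$$ Limits are as $n\to\infty$. *)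

theory Defs
  imports "HOL-Probability.Probability" "HOL-Library.Landau_Symbols"
begin

text \<open>Centered Gaussian random vector (components indexed by 0..p-1) with covariance
  matrix S, defined in the Cramer--Wold way: every linear combination of the components
  is centered normal with variance a^T S a (a point mass at 0 if that variance is 0).\<close>
definition centered_gaussian_vec ::
  "'a measure \<Rightarrow> nat \<Rightarrow> (nat \<Rightarrow> nat \<Rightarrow> real) \<Rightarrow> ('a \<Rightarrow> nat \<Rightarrow> real) \<Rightarrow> bool" where
  "centered_gaussian_vec M p S Y \<longleftrightarrow>
     (\<forall>i<p. (\<lambda>\<omega>. Y \<omega> i) \<in> borel_measurable M) \<and>
     (\<forall>a :: nat \<Rightarrow> real.
        (let v = (\<Sum>i<p. \<Sum>j<p. a i * a j * S i j) in
          if v > 0 then distributed M lborel (\<lambda>\<omega>. \<Sum>i<p. a i * Y \<omega> i)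
                          (\<lambda>x. ennreal (normal_density 0 (sqrt v) x))
          else (AE \<omega> in M. (\<Sum>i<p. a i * Y \<omega> i) = 0)))"

definition ar_cov :: "real \<Rightarrow> nat \<Rightarrow> nat \<Rightarrow> real" where
  "ar_cov r i j = r ^ (if i \<le> j then j - i else i - j)"

text \<open>Sample correlation (without centering) between coordinates i and j of the
  n observations x_0,...,x_{n-1}; x k i is the i-th coordinate of the k-th observation.\<close>
definition sample_corr :: "nat \<Rightarrow> (nat \<Rightarrow> nat \<Rightarrow> real) \<Rightarrow> nat \<Rightarrow> nat \<Rightarrow> real" where
  "sample_corr n x i j =
     (\<Sum>k<n. x k i * x k j) / sqrt ((\<Sum>k<n. (x k i)\<^sup>2) * (\<Sum>k<n. (x k j)\<^sup>2))"

definition max_corr :: "nat \<Rightarrow> nat \<Rightarrow> (nat \<Rightarrow> nat \<Rightarrow> real) \<Rightarrow> real" where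
  "max_corr n p x = Max ((\<lambda>(i, j). sample_corr n x i j) ` {(i, j). i < j \<and> j < p})"

end

theory Submission
  imports Defs "HOL-Real_Asymp.Real_Asymp"
begin

text \<open>Write \<open>L = ln p\<close>. For two columns with true correlation \<open>R\<close> the normalized sum \<open>u\<close> and difference \<open>v\<close> are
  independent standard normal vectors, and \<open>W = (\<Sum> u\<^sup>2 - \<Sum> v\<^sup>2) / (2 \<surd>n)\<close> is the linearization of
  \<open>\<surd>n (\<rho> - R) / (1 - R\<^sup>2)\<close>, \<open>\<rho>\<close> being the sample correlation. With \<open>a = (u - v) / \<surd>2\<close> and \<open>b = (u + v) / \<surd>2\<close> one has
  \<open>W = \<Sum> a b / \<surd>n\<close>, so that \<open>Z = \<Sum> a b / |a|\<close> is exactly standard normal, and no moderate deviation theorem is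
  needed for a single adjacent pair.

  Off an event of probability \<open>O(1 / p\<^sup>2)\<close> all chi-square sums involved are within a factor \<open>1 \<plusminus> 8 \<surd>(L / n)\<close> of \<open>n\<close>.
  Then the sample correlations of nonadjacent columns stay below \<open>r\<close>, because \<open>r - r\<^sup>2\<close> is at least of order
  \<open>1 / L\<close>; for adjacent columns, exceedances of a level by the sample correlation, by \<open>W\<close> and by \<open>Z\<close> are the same up
  to a shift of the level by \<open>O(1 / L)\<close>, which does not change the limit of \<open>p\<close> times the normal tail.

  The values of \<open>W\<close> for two distinct adjacent pairs have correlation at most \<open>5/8\<close>, so a Chernoff bound makes joint
  exceedances negligible. The columns are cut into blocks of length about \<open>L\<^sup>3\<close>. Subtracting from the columns of
  a block their projection on the column where the block starts makes the blocks independent; beyond the first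
  \<open>L\<^sup>2\<close> columns of the block this hardly changes \<open>W\<close>, since \<open>1 - r\<close> is at least of order \<open>1 / L\<close>. Bonferroni's
  inequalities inside each block and the product over the blocks give the limit.\<close>

text \<open>As \<open>r\<close> tends to 1, the normalized sums of two adjacent pairs at a fixed
  distance become almost equal, so their statistics \<open>W\<close> do not decorrelate: the
  correlation tends to 1/2. Only the normalized differences keep them apart. For the extremes it is
  enough that the correlation stays away from 1: the bound 5/8 is (1 + 1/4) / 2, with 1 for the
  squared correlation of the sums and 1/4 for that of the differences, and it makes a joint
  exceedance cost about p^(-16/13), which leaves room for powers of \<open>L\<close>.

  The admissible shift of the level is set by the tail. The level is about the square root of 2 L,
  and so is the slope of the logarithm of the normal tail there; a shift of order 1 / L therefore
  changes the tail by a factor tending to 1. Since the fluctuations of the sample correlation carry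
  the vanishing factor 1 - r^2, the errors of the comparison are kept proportional to it. The block
  lengths L^3 and L^2 are chosen so that the discarded positions are a fraction of about 1 / L of
  all, while a correlation over L^2 columns is exponentially small in \<open>L\<close>.\<close>

subsection \<open>Independence from factorizing characteristic functions\<close>

text \<open>The weight \<open>h + 2\<close> is positive; tilting by it does not change the characteristic function of \<open>X\<close>.\<close>

lemma (in prob_space) real_weight_factorizes:
  fixes X h :: "'a \<Rightarrow> real"
  assumes X [measurable]: "X \<in> borel_measurable M" and h [measurable]: "h \<in> borel_measurable M"
    and bnd: "\<And>w. \<bar>h w\<bar> \<le> 1"
    and eq: "\<And>t. (CLINT w|M. complex_of_real (h w) * iexp (t * X w))
                = complex_of_real (expectation h) * (CLINT w|M. iexp (t * X w))"
    and S [measurable]: "S \<in> sets borel"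
  shows "expectation (\<lambda>w. h w * indicator S (X w)) = expectation h * expectation (\<lambda>w. indicator S (X w))"
proof -
  let ?phi = "\<lambda>t. CLINT w|M. iexp (t * X w)"
  have ih: "integrable M h"
    by (rule integrable_const_bound[where B=1]) (use bnd in auto)
  define G where "G = expectation h + 2"
  have "\<bar>expectation h\<bar> \<le> expectation (\<lambda>w. \<bar>h w\<bar>)" by (rule integral_abs_bound)
  also have "\<dots> \<le> 1" using bnd ih by (intro integral_le_const) auto
  finally have G1: "G \<ge> 1" unfolding G_def by linarith
  define g where "g w = (h w + 2) / G" for w
  have g_nn: "g w \<ge> 0" for w using bnd[of w] G1 unfolding g_def by (intro divide_nonneg_pos) auto
  have g_m [measurable]: "g \<in> borel_measurable M" unfolding g_def by measurable
  have ig: "integrable M g" unfolding g_def using ih by auto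
  have eg: "expectation g = 1" unfolding g_def using ih G1 by (simp add: G_def prob_space)
  define N where "N = density M (\<lambda>w. ennreal (g w))"
  have mN [measurable_cong, simp]: "sets N = sets M" "space N = space M" by (auto simp: N_def)
  interpret N: prob_space N
  proof
    have "emeasure N (space N) = (\<integral>\<^sup>+ w. ennreal (g w) \<partial>M)"
      unfolding N_def by (simp add: emeasure_density cong: nn_integral_cong)
    also have "\<dots> = 1" using ig g_nn eg by (subst nn_integral_eq_integral) auto
    finally show "emeasure N (space N) = 1" .
  qed
  have [measurable]: "X \<in> borel_measurable N" using X by (simp cong: measurable_cong_sets)
  have "char (distr N borel X) t = char (distr M borel X) t" for t
  proof -
    have "char (distr N borel X) t = (CLINT w|N. iexp (t * X w))"
      unfolding char_def by (subst integral_distr) auto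
    also have "\<dots> = (CLINT w|M. g w *\<^sub>R iexp (t * X w))"
      unfolding N_def by (subst integral_density) (use g_nn in auto)
    also have "\<dots> = (CLINT w|M. (complex_of_real (h w) * iexp (t * X w) + 2 * iexp (t * X w)) / G)"
      by (intro Bochner_Integration.integral_cong) (auto simp: g_def scaleR_conv_of_real field_simps)
    also have "\<dots> = ((CLINT w|M. complex_of_real (h w) * iexp (t * X w)) + 2 * ?phi t) / G"
    proof -
      have i1: "integrable M (\<lambda>w. complex_of_real (h w) * iexp (t * X w))"
        by (rule integrable_const_bound[where B=1]) (use bnd in \<open>auto simp: norm_mult\<close>)
      have i2: "integrable M (\<lambda>w. iexp (t * X w))"
        by (rule integrable_const_bound[where B=1]) auto
      show ?thesis using i1 i2 by simp
    qed
    also have "\<dots> = ?phi t"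
    proof -
      have "(complex_of_real (expectation h) * E + 2 * E) / G = E" for E :: complex
      proof -
        have "complex_of_real (expectation h) * E + 2 * E = complex_of_real G * E"
          by (simp add: G_def distrib_right)
        then show ?thesis using G1 by simp
      qed
      then show ?thesis unfolding eq .
    qed
    also have "\<dots> = char (distr M borel X) t"
      unfolding char_def by (subst integral_distr) auto
    finally show ?thesis .
  qed
  then have "distr N borel X = distr M borel X"
    by (intro Levy_uniqueness ext real_distribution_distr N.real_distribution_distr) auto
  then have "integral\<^sup>L (distr N borel X) (indicator S :: _ \<Rightarrow> real) = integral\<^sup>L (distr M borel X) (indicator S)"
    by simp
  then have e: "(\<integral>w. indicator S (X w) \<partial>N) = expectation (\<lambda>w. indicator S (X w) :: real)"
    by (subst (asm) (1 2) integral_distr) auto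
  have i3: "integrable M (\<lambda>w. indicator S (X w) :: real)"
    by (rule integrable_const_bound[where B=1]) auto
  have i4: "integrable M (\<lambda>w. h w * indicator S (X w))"
    by (rule integrable_const_bound[where B=1]) (use bnd in \<open>auto simp: indicator_def\<close>)
  have "(\<integral>w. indicator S (X w) \<partial>N) = expectation (\<lambda>w. g w * indicator S (X w))"
    unfolding N_def by (subst integral_density) (use g_nn in auto)
  also have "\<dots> = expectation (\<lambda>w. (h w * indicator S (X w) + 2 * indicator S (X w)) / G)"
    by (intro Bochner_Integration.integral_cong) (auto simp: g_def field_simps)
  also have "\<dots> = (expectation (\<lambda>w. h w * indicator S (X w)) + 2 * expectation (\<lambda>w. indicator S (X w))) / G"
    using i3 i4 by simp
  finally have "expectation (\<lambda>w. h w * indicator S (X w)) + 2 * expectation (\<lambda>w. indicator S (X w))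
     = G * expectation (\<lambda>w. indicator S (X w))"
    using e G1 by (simp add: field_simps)
  then show ?thesis by (simp add: G_def algebra_simps)
qed

text \<open>Conjugating the hypothesis at \<open>-t\<close> shows that \<open>cnj (h w)\<close>
  factorizes as well. Hence so do the real and imaginary parts of \<open>h\<close>, and these are
  real weights bounded by 1.\<close>

lemma (in prob_space) complex_weight_factorizes:
  fixes X :: "'a \<Rightarrow> real" and h :: "'a \<Rightarrow> complex"
  assumes X [measurable]: "X \<in> borel_measurable M" and h [measurable]: "h \<in> borel_measurable M"
    and bnd: "\<And>w. norm (h w) \<le> 1"
    and eq: "\<And>t. (CLINT w|M. h w * iexp (t * X w)) = (CLINT w|M. h w) * (CLINT w|M. iexp (t * X w))"
    and S [measurable]: "S \<in> sets borel"
  shows "(CLINT w|M. h w * indicator S (X w)) = (CLINT w|M. h w) * complex_of_real (prob {w \<in> space M. X w \<in> S})"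
proof -
  let ?phi = "\<lambda>t. CLINT w|M. iexp (t * X w)"
  have ih: "integrable M h" by (rule integrable_const_bound[where B=1]) (use bnd in auto)
  have cm [measurable]: "(\<lambda>w. cnj (h w)) \<in> borel_measurable M"
    using h by (simp add: borel_measurable_complex_iff)
  have ie: "integrable M (\<lambda>w. iexp (t * X w))" for t
    by (rule integrable_const_bound[where B=1]) auto
  have i1: "integrable M (\<lambda>w. h w * iexp (t * X w))" for t
    by (rule integrable_const_bound[where B=1]) (use bnd in \<open>auto simp: norm_mult\<close>)
  have i2: "integrable M (\<lambda>w. cnj (h w) * iexp (t * X w))" for t
    by (rule integrable_const_bound[where B=1]) (use bnd in \<open>auto simp: norm_mult\<close>)
  have eqc: "(CLINT w|M. cnj (h w) * iexp (t * X w)) = cnj (CLINT w|M. h w) * ?phi t" for t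
  proof -
    have c: "iexp (t * X w) = cnj (iexp ((-t) * X w))" for w
      by (simp add: exp_cnj)
    have "(CLINT w|M. cnj (h w) * iexp (t * X w)) = (CLINT w|M. cnj (h w * iexp ((-t) * X w)))"
      by (intro Bochner_Integration.integral_cong refl) (simp only: c complex_cnj_mult)
    also have "\<dots> = cnj (CLINT w|M. h w * iexp ((-t) * X w))" by (rule Bochner_Integration.integral_cnj)
    also have "\<dots> = cnj (CLINT w|M. h w) * cnj (?phi (-t))"
      by (simp only: eq complex_cnj_mult)
    also have "cnj (?phi (-t)) = (CLINT w|M. cnj (iexp ((-t) * X w)))"
      by (rule Bochner_Integration.integral_cnj[symmetric])
    also have "\<dots> = ?phi t" by (simp only: c)
    finally show ?thesis .
  qed
  have R: "expectation (\<lambda>w. Re (h w) * indicator S (X w)) = expectation (\<lambda>w. Re (h w)) * expectation (\<lambda>w. indicator S (X w))"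
  proof (rule real_weight_factorizes)
    show "\<bar>Re (h w)\<bar> \<le> 1" for w using abs_Re_le_cmod[of "h w"] bnd[of w] by linarith
    fix t
    have "(CLINT w|M. complex_of_real (Re (h w)) * iexp (t * X w))
      = (CLINT w|M. (h w * iexp (t * X w) + cnj (h w) * iexp (t * X w)) / 2)"
      by (intro Bochner_Integration.integral_cong refl) (simp add: complex_eq_iff field_simps)
    also have "\<dots> = (CLINT w|M. h w) * ?phi t / 2 + cnj (CLINT w|M. h w) * ?phi t / 2"
      using i1[of t] i2[of t] eq[of t] eqc[of t] by (simp add: add_divide_distrib)
    also have "\<dots> = complex_of_real (Re (CLINT w|M. h w)) * ?phi t"
      by (simp add: complex_eq_iff field_simps)
    finally show "(CLINT w|M. complex_of_real (Re (h w)) * iexp (t * X w)) = complex_of_real (expectation (\<lambda>w. Re (h w))) * ?phi t"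
      using ih by simp
  qed auto
  have I: "expectation (\<lambda>w. Im (h w) * indicator S (X w)) = expectation (\<lambda>w. Im (h w)) * expectation (\<lambda>w. indicator S (X w))"
  proof (rule real_weight_factorizes)
    show "\<bar>Im (h w)\<bar> \<le> 1" for w using abs_Im_le_cmod[of "h w"] bnd[of w] by linarith
    fix t
    have "(CLINT w|M. complex_of_real (Im (h w)) * iexp (t * X w))
      = (CLINT w|M. (h w * iexp (t * X w) - cnj (h w) * iexp (t * X w)) / (2 * \<i>))"
      by (intro Bochner_Integration.integral_cong refl) (simp add: complex_eq_iff Re_divide Im_divide field_simps)
    also have "\<dots> = ((CLINT w|M. h w) * ?phi t - cnj (CLINT w|M. h w) * ?phi t) / (2 * \<i>)"
      using i1[of t] i2[of t] eq[of t] eqc[of t] by simp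
    also have "\<dots> = complex_of_real (Im (CLINT w|M. h w)) * ?phi t"
      by (simp add: complex_eq_iff Re_divide Im_divide field_simps)
    finally show "(CLINT w|M. complex_of_real (Im (h w)) * iexp (t * X w)) = complex_of_real (expectation (\<lambda>w. Im (h w))) * ?phi t"
      using ih by simp
  qed auto
  have ii: "integrable M (\<lambda>w. h w * indicator S (X w))"
    by (rule integrable_const_bound[where B=1]) (use bnd in \<open>auto simp: norm_mult indicator_def\<close>)
  have P: "expectation (\<lambda>w. indicator S (X w)) = prob {w \<in> space M. X w \<in> S}"
  proof -
    have "expectation (\<lambda>w. indicator S (X w) :: real) = expectation (indicator {w \<in> space M. X w \<in> S})"
      by (intro Bochner_Integration.integral_cong) (auto simp: indicator_def)
    then show ?thesis by simp
  qed
  have i': "Re (indicator S (X w)) = indicator S (X w)"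
     "Im (indicator S (X w)) = 0" for w
    by (auto simp: indicator_def)
  show ?thesis
    using R I ih ii P by (simp add: complex_eq_iff integral_Re[symmetric] integral_Im[symmetric] i' del: integral_Re integral_Im)
qed

text \<open>Kac's criterion. It is the natural route to independence here because
  \<open>centered_gaussian_vec\<close> gives the laws of linear combinations, hence characteristic
  functions, but no joint density. The exponentials are exchanged for indicators one index at a
  time.\<close>

lemma (in prob_space) indep_vars_if_char_factorizes:
  fixes F :: "'i \<Rightarrow> 'a \<Rightarrow> real"
  assumes fin: "finite I" and F [measurable]: "\<And>i. i \<in> I \<Longrightarrow> F i \<in> borel_measurable M"
    and eq: "\<And>t. (CLINT w|M. iexp (\<Sum>i\<in>I. t i * F i w)) = (\<Prod>i\<in>I. CLINT w|M. iexp (t i * F i w))"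
  shows "indep_vars (\<lambda>_. borel) F I"
proof -
  let ?pr = "\<lambda>S A. \<Prod>i\<in>A. complex_of_real (prob {w \<in> space M. F i w \<in> S i})"
    and ?ch = "\<lambda>t A. \<Prod>i\<in>A. CLINT w|M. iexp (t i * F i w)"
  have step: "(CLINT w|M. (\<Prod>i\<in>A. indicator (S i) (F i w)) * iexp (\<Sum>i\<in>I - A. t i * F i w))
      = ?pr S A * ?ch t (I - A)"
    if A: "A \<subseteq> I" and S: "\<And>i. i \<in> A \<Longrightarrow> S i \<in> sets borel" for A S t
  proof -
    have "finite A" using A fin finite_subset by blast
    then show ?thesis using A S
    proof (induction A arbitrary: t rule: finite_induct)
      case empty
      then show ?case using eq by simp
    next
      case (insert c A)
      have c: "c \<in> I" "c \<notin> A" using insert by auto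
      have fIA: "finite (I - A)" using fin by auto
      have spl: "I - A = insert c (I - insert c A)" "c \<notin> I - insert c A" using c by auto
      have IH: "(CLINT w|M. (\<Prod>i\<in>A. indicator (S i) (F i w)) * iexp (\<Sum>i\<in>I - A. s i * F i w))
        = ?pr S A * ?ch s (I - A)" for s
        using insert by auto
      have [measurable]: "F c \<in> borel_measurable M" "S c \<in> sets borel" using c insert by auto
      have [measurable]: "\<And>i. i \<in> A \<Longrightarrow> F i \<in> borel_measurable M" "\<And>i. i \<in> A \<Longrightarrow> S i \<in> sets borel"
         "\<And>i. i \<in> I - insert c A \<Longrightarrow> F i \<in> borel_measurable M"
        using insert by auto
      define h where "h w = (\<Prod>i\<in>A. indicator (S i) (F i w)) * iexp (\<Sum>i\<in>I - insert c A. t i * F i w)" for w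
      have hm [measurable]: "h \<in> borel_measurable M" unfolding h_def by measurable
      have hb: "norm (h w) \<le> 1" for w
        unfolding h_def by (auto simp: norm_mult prod_norm[symmetric] indicator_def intro!: prod_le_1)
      have he: "h w * iexp (s * F c w) = (\<Prod>i\<in>A. indicator (S i) (F i w)) * iexp (\<Sum>i\<in>I - A. (t(c := s)) i * F i w)" for w s
      proof -
        have "(\<Sum>i\<in>I - A. (t(c := s)) i * F i w) = s * F c w + (\<Sum>i\<in>I - insert c A. t i * F i w)"
          using fin by (subst spl(1), subst sum.insert) (auto intro!: sum.cong)
        then show ?thesis unfolding h_def by (simp add: distrib_left exp_add ac_simps)
      qed
      have hint: "(CLINT w|M. h w * iexp (s * F c w))
        = ?pr S A * ?ch t (I - insert c A) * (CLINT w|M. iexp (s * F c w))" for s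
      proof -
        have "(\<Prod>i\<in>I - A. CLINT w|M. iexp ((t(c := s)) i * F i w)) = (CLINT w|M. iexp (s * F c w)) * ?ch t (I - insert c A)"
          using fin by (subst spl(1), subst prod.insert) (auto intro!: prod.cong)
        then show ?thesis unfolding he IH by simp
      qed
      \<comment> \<open>Frequency 0 at \<open>c\<close> turns the last factor in \<open>hint\<close>
        into 1. So the prefactor there is the integral of \<open>h\<close>, and \<open>h\<close> is
        an admissible weight for \<open>F c\<close>.\<close>
      have h0: "(CLINT w|M. h w) = ?pr S A * ?ch t (I - insert c A)"
        using hint[of 0] by (simp add: prob_space)
      have "(CLINT w|M. h w * indicator (S c) (F c w)) = (CLINT w|M. h w) * complex_of_real (prob {w \<in> space M. F c w \<in> S c})"
        by (rule complex_weight_factorizes) (use hb in \<open>auto simp only: hint h0 mult.assoc intro: hm\<close>, measurable)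
      moreover have "(\<Prod>i\<in>insert c A. indicator (S i) (F i w)) * iexp (\<Sum>i\<in>I - insert c A. t i * F i w) = h w * indicator (S c) (F c w)" for w
        using insert(1,2) unfolding h_def by (simp add: ac_simps)
      ultimately show ?case using insert(1,2) by (simp only: h0 prod.insert not_False_eq_True ac_simps)
    qed
  qed
  show ?thesis unfolding indep_vars_def2
  proof safe
    show "F i \<in> borel_measurable M" if "i \<in> I" for i using F that .
    show "indep_sets (\<lambda>i. {F i -` A \<inter> space M |A. A \<in> sets borel}) I"
    proof (rule indep_setsI)
      show "{F i -` A \<inter> space M |A. A \<in> sets borel} \<subseteq> events" if "i \<in> I" for i
        using F[OF that] by (auto intro: measurable_sets)
      fix A J assume J: "J \<noteq> {}" "J \<subseteq> I" "finite J" and A: "\<forall>j\<in>J. A j \<in> {F j -` A \<inter> space M |A. A \<in> sets borel}"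
      then obtain S where S: "\<And>j. j \<in> J \<Longrightarrow> S j \<in> sets borel" "\<And>j. j \<in> J \<Longrightarrow> A j = F j -` S j \<inter> space M"
        by (simp add: Bex_def) metis
      have [measurable]: "A j \<in> events" if "j \<in> J" for j using S that F J(2) by (auto intro: measurable_sets)
      have E: "A j = {w \<in> space M. F j w \<in> S j}" if "j \<in> J" for j using S(2)[OF that] by auto
      have "complex_of_real (prob (\<Inter>j\<in>J. A j)) = complex_of_real (expectation (indicator (\<Inter>j\<in>J. A j)))"
      proof -
        have "(\<Inter>j\<in>J. A j) \<in> events" using J by (intro sets.finite_INT) auto
        then show ?thesis by simp
      qed
      also have "\<dots> = (CLINT w|M. complex_of_real (indicator (\<Inter>j\<in>J. A j) w))" by simp
      also have "\<dots> = (CLINT w|M. (\<Prod>i\<in>J. indicator (S i) (F i w)) * iexp (\<Sum>i\<in>I - J. 0 * F i w))"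
      proof (intro Bochner_Integration.integral_cong refl)
        fix w assume "w \<in> space M"
        then have "(\<Prod>i\<in>J. indicator (S i) (F i w) :: complex) = (\<Prod>i\<in>J. indicator (A i) w)"
          using E by (intro prod.cong) (auto simp: indicator_def)
        also have "\<dots> = complex_of_real (indicator (\<Inter>j\<in>J. A j) w)"
          using J by (auto simp: indicator_def)
        finally show "complex_of_real (indicator (\<Inter>j\<in>J. A j) w) = (\<Prod>i\<in>J. indicator (S i) (F i w)) * iexp (\<Sum>i\<in>I - J. 0 * F i w)"
          by simp
      qed
      also have "\<dots> = (\<Prod>j\<in>J. complex_of_real (prob {w \<in> space M. F j w \<in> S j}))"
        using step[of J S "\<lambda>_. 0"] J S by (simp add: prob_space)
      also have "\<dots> = complex_of_real (\<Prod>j\<in>J. prob (A j))" using E by simp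
      finally show "prob (\<Inter>j\<in>J. A j) = (\<Prod>j\<in>J. prob (A j))" using of_real_eq_iff by blast
    qed
  qed
qed

subsection \<open>Chi-square concentration\<close>

text \<open>The factor \<open>s\<close> stays on both sides of the event so that a positive
  \<open>s\<close> gives the upper tail and a negative \<open>s\<close> the lower one.\<close>

lemma (in prob_space) exponential_markov:
  assumes [measurable]: "T \<in> borel_measurable M"
    and le: "(\<integral>\<^sup>+w. ennreal (exp (s * T w)) \<partial>M) \<le> ennreal C" and C: "C \<ge> 0"
  shows "prob {w \<in> space M. s * T w \<ge> s * a} \<le> exp (- s * a) * C"
proof -
  have "emeasure M {w \<in> space M. s * T w \<ge> s * a} = (\<integral>\<^sup>+w. indicator {w \<in> space M. s * T w \<ge> s * a} w \<partial>M)"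
    by simp
  also have "\<dots> \<le> (\<integral>\<^sup>+w. ennreal (exp (- s * a)) * ennreal (exp (s * T w)) \<partial>M)"
    by (intro nn_integral_mono) (auto simp: indicator_def ennreal_mult[symmetric] exp_add[symmetric])
  also have "\<dots> = ennreal (exp (- s * a)) * (\<integral>\<^sup>+w. ennreal (exp (s * T w)) \<partial>M)"
    by (subst nn_integral_cmult) auto
  also have "\<dots> \<le> ennreal (exp (- s * a)) * ennreal C" by (intro mult_left_mono le) auto
  finally have "emeasure M {w \<in> space M. s * T w \<ge> s * a} \<le> ennreal (exp (- s * a) * C)"
    using C by (simp add: ennreal_mult)
  then show ?thesis using C by (simp add: emeasure_eq_measure)
qed

text \<open>Up to the factor \<open>\<sigma>\<close>, the weighted density is again a centered
  normal density, now of variance \<open>1 / (1 - 2 * s)\<close>.\<close>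

lemma nn_integral_exp_square_std_normal:
  fixes s :: real assumes s: "s < 1/2"
  shows "(\<integral>\<^sup>+x. ennreal (std_normal_density x) * ennreal (exp (s * x\<^sup>2)) \<partial>lborel) = ennreal (1 / sqrt (1 - 2 * s))"
proof -
  define \<sigma> where "\<sigma> = 1 / sqrt (1 - 2 * s)"
  have sp: "\<sigma> > 0" "\<sigma>\<^sup>2 = 1 / (1 - 2 * s)" using s by (auto simp: \<sigma>_def power_divide)
  have e: "std_normal_density x * exp (s * x\<^sup>2) = \<sigma> * normal_density 0 \<sigma> x" for x
  proof -
    have "sqrt (2 * pi * \<sigma>\<^sup>2) = sqrt (2 * pi) * \<sigma>" unfolding real_sqrt_mult using sp(1) by simp
    moreover have "- x\<^sup>2 / 2 + s * x\<^sup>2 = - x\<^sup>2 / (2 * \<sigma>\<^sup>2)" using sp(2) by (simp add: field_simps)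
    then have "exp (- x\<^sup>2 / 2) * exp (s * x\<^sup>2) = exp (- x\<^sup>2 / (2 * \<sigma>\<^sup>2))" by (simp only: exp_add[symmetric])
    ultimately show ?thesis using sp unfolding normal_density_def by (simp add: field_simps)
  qed
  have "(\<integral>\<^sup>+x. ennreal (std_normal_density x) * ennreal (exp (s * x\<^sup>2)) \<partial>lborel) = (\<integral>\<^sup>+x. ennreal \<sigma> * ennreal (normal_density 0 \<sigma> x) \<partial>lborel)"
    using sp by (intro nn_integral_cong) (simp add: ennreal_mult[symmetric] e)
  also have "\<dots> = ennreal \<sigma> * (\<integral>\<^sup>+x. ennreal (normal_density 0 \<sigma> x) \<partial>lborel)"
    by (rule nn_integral_cmult) simp
  also have "(\<integral>\<^sup>+x. ennreal (normal_density 0 \<sigma> x) \<partial>lborel) = 1"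
    using sp by (subst nn_integral_eq_integral) auto
  finally show ?thesis by (simp add: \<sigma>_def)
qed

lemma (in prob_space) nn_integral_exp_square_normal_rv:
  fixes s :: real assumes Y: "distributed M lborel Y std_normal_density" and s: "s < 1/2"
  shows "(\<integral>\<^sup>+w. ennreal (exp (s * (Y w)\<^sup>2)) \<partial>M) = ennreal (1 / sqrt (1 - 2 * s))"
  using distributed_nn_integral[OF Y, of "\<lambda>x. ennreal (exp (s * x\<^sup>2))"] nn_integral_exp_square_std_normal[OF s]
  by simp

lemma (in prob_space) chi_square_mgf_bound:
  fixes s :: real
  assumes ind: "indep_vars (\<lambda>_. borel) Y {..<n::nat}"
    and Y: "\<And>k. k < n \<Longrightarrow> distributed M lborel (Y k) std_normal_density" and s: "\<bar>s\<bar> \<le> 1/4"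
  shows "(\<integral>\<^sup>+w. ennreal (exp (s * (\<Sum>k<n. (Y k w)\<^sup>2))) \<partial>M) \<le> ennreal (exp (real n * (s + 4 * s\<^sup>2)))"
proof -
  \<comment> \<open>The second-order bound for the logarithm is taken at \<open>- 2 * s\<close>,
    which the assumption keeps within 1/2 of 0; halving its error
    \<open>2 * (- 2 * s)\<^sup>2\<close> gives the coefficient 4.\<close>
  have l: "1 / sqrt (1 - 2 * s) \<le> exp (s + 4 * s\<^sup>2)"
  proof -
    have "\<bar>ln (1 + (- 2 * s)) - (- 2 * s)\<bar> \<le> 2 * (- 2 * s)\<^sup>2"
      using s by (intro abs_ln_one_plus_x_minus_x_bound) auto
    then have "- (1/2) * ln (1 - 2 * s) \<le> s + 4 * s\<^sup>2" by (simp add: power2_eq_square algebra_simps)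
    then have "exp (- (1/2) * ln (1 - 2 * s)) \<le> exp (s + 4 * s\<^sup>2)" by simp
    moreover have "exp (- (1/2) * ln (1 - 2 * s)) = 1 / sqrt (1 - 2 * s)"
      using s by (simp add: exp_minus ln_sqrt[symmetric] inverse_eq_divide)
    ultimately show ?thesis by linarith
  qed
  have "(\<integral>\<^sup>+w. ennreal (exp (s * (\<Sum>k<n. (Y k w)\<^sup>2))) \<partial>M) = (\<integral>\<^sup>+w. (\<Prod>k<n. ennreal (exp (s * (Y k w)\<^sup>2))) \<partial>M)"
    by (intro nn_integral_cong) (simp add: sum_distrib_left exp_sum prod_ennreal)
  also have "\<dots> = (\<Prod>k<n. \<integral>\<^sup>+w. ennreal (exp (s * (Y k w)\<^sup>2)) \<partial>M)"
    by (intro indep_vars_nn_integral indep_vars_compose2[OF ind]) auto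
  also have "\<dots> = (\<Prod>k<n. ennreal (1 / sqrt (1 - 2 * s)))"
    using s by (intro prod.cong refl nn_integral_exp_square_normal_rv Y) auto
  also have "\<dots> \<le> (\<Prod>k<n. ennreal (exp (s + 4 * s\<^sup>2)))"
    using l by (simp add: power_mono ennreal_leI)
  also have "\<dots> = ennreal (exp (real n * (s + 4 * s\<^sup>2)))"
    by (simp add: ennreal_power exp_of_nat_mult[symmetric])
  finally show ?thesis .
qed

lemma (in prob_space) chi_square_concentration:
  fixes \<epsilon> :: real
  assumes ind: "indep_vars (\<lambda>_. borel) Y {..<n::nat}"
    and Y: "\<And>k. k < n \<Longrightarrow> distributed M lborel (Y k) std_normal_density" and e: "0 < \<epsilon>" "\<epsilon> \<le> 2"
  shows "prob {w \<in> space M. \<bar>(\<Sum>k<n. (Y k w)\<^sup>2) - real n\<bar> > \<epsilon> * real n} \<le> 2 * exp (- (real n * \<epsilon>\<^sup>2 / 16))"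
proof -
  have Ym [measurable]: "Y k \<in> borel_measurable M" if "k < n" for k
    using ind that by (auto simp: indep_vars_def2)
  define T where "T w = (\<Sum>k<n. (Y k w)\<^sup>2)" for w
  have [measurable]: "T \<in> borel_measurable M" unfolding T_def by measurable
  have b: "prob {w \<in> space M. s * T w \<ge> s * a} \<le> exp (- s * a) * exp (real n * (s + 4 * s\<^sup>2))" if "\<bar>s\<bar> \<le> 1/4" for s a
    using chi_square_mgf_bound[OF ind Y that] by (intro exponential_markov) (auto simp: T_def)
  \<comment> \<open>Per observation the exponent is \<open>- s * \<epsilon> + 4 * s\<^sup>2\<close>,
    smallest at \<open>s = \<epsilon> / 8\<close>; the assumption \<open>\<epsilon> \<le> 2\<close>
    keeps this \<open>s\<close> within 1/4. The lower tail uses the opposite sign.\<close>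
  have up: "prob {w \<in> space M. T w \<ge> real n * (1 + \<epsilon>)} \<le> exp (- (real n * \<epsilon>\<^sup>2 / 16))"
  proof -
    have "{w \<in> space M. (\<epsilon>/8) * T w \<ge> (\<epsilon>/8) * (real n * (1 + \<epsilon>))} = {w \<in> space M. T w \<ge> real n * (1 + \<epsilon>)}"
      using e by (auto simp: mult_le_cancel_left)
    moreover have "- (\<epsilon>/8) * (real n * (1 + \<epsilon>)) + real n * (\<epsilon>/8 + 4 * (\<epsilon>/8)\<^sup>2) = - (real n * \<epsilon>\<^sup>2 / 16)"
      by (simp add: field_simps power2_eq_square)
    ultimately show ?thesis using b[of "\<epsilon>/8" "real n * (1 + \<epsilon>)"] e by (simp only: exp_add[symmetric]; simp)
  qed
  have lo: "prob {w \<in> space M. T w \<le> real n * (1 - \<epsilon>)} \<le> exp (- (real n * \<epsilon>\<^sup>2 / 16))"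
  proof -
    have "{w \<in> space M. (- \<epsilon>/8) * T w \<ge> (- \<epsilon>/8) * (real n * (1 - \<epsilon>))} = {w \<in> space M. T w \<le> real n * (1 - \<epsilon>)}"
      using e by (auto simp: mult_le_cancel_left)
    moreover have "- (- \<epsilon>/8) * (real n * (1 - \<epsilon>)) + real n * (- \<epsilon>/8 + 4 * (- \<epsilon>/8)\<^sup>2) = - (real n * \<epsilon>\<^sup>2 / 16)"
      by (simp add: field_simps power2_eq_square)
    ultimately show ?thesis using b[of "- \<epsilon>/8" "real n * (1 - \<epsilon>)"] e by (simp only: exp_add[symmetric]; simp)
  qed
  have "prob {w \<in> space M. \<bar>T w - real n\<bar> > \<epsilon> * real n} \<le> prob ({w \<in> space M. T w \<ge> real n * (1 + \<epsilon>)} \<union> {w \<in> space M. T w \<le> real n * (1 - \<epsilon>)})"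
    by (intro finite_measure_mono) (auto simp: algebra_simps)
  also have "\<dots> \<le> prob {w \<in> space M. T w \<ge> real n * (1 + \<epsilon>)} + prob {w \<in> space M. T w \<le> real n * (1 - \<epsilon>)}"
    by (intro measure_Un_le) auto
  finally show ?thesis using up lo by (simp add: T_def)
qed

subsection \<open>Linear forms of the sample\<close>

locale ar_sample = prob_space M for M :: "'a measure" +
  fixes n p :: nat and r :: real and X :: "nat \<Rightarrow> 'a \<Rightarrow> nat \<Rightarrow> real"
  assumes gauss: "\<And>k. k < n \<Longrightarrow> centered_gaussian_vec M p (ar_cov r) (X k)"
    and indep: "indep_vars (\<lambda>_. PiM {..<p} (\<lambda>_. borel)) (\<lambda>k w. restrict (X k w) {..<p}) {..<n}"
    and r_range: "0 \<le> r" "r < 1"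
begin

definition lin :: "(nat \<Rightarrow> real) \<Rightarrow> nat \<Rightarrow> 'a \<Rightarrow> real" where
  "lin c k w = (\<Sum>i<p. c i * X k w i)"

text \<open>The covariance of \<open>lin c k\<close> and \<open>lin d k\<close> in any row
  \<open>k < n\<close>. Orthonormality with respect to it becomes independence of the linear
  forms.\<close>

definition bil :: "(nat \<Rightarrow> real) \<Rightarrow> (nat \<Rightarrow> real) \<Rightarrow> real" where
  "bil c d = (\<Sum>i<p. \<Sum>j<p. c i * d j * ar_cov r i j)"

lemma X_measurable [measurable]: "k < n \<Longrightarrow> i < p \<Longrightarrow> (\<lambda>w. X k w i) \<in> borel_measurable M"
  using gauss[of k] by (auto simp: centered_gaussian_vec_def)

lemma lin_measurable [measurable]: "k < n \<Longrightarrow> lin c k \<in> borel_measurable M"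
  unfolding lin_def by measurable

lemma indep_functions_of_rows:
  assumes "\<And>k. k < n \<Longrightarrow> g k \<in> measurable (PiM {..<p} (\<lambda>_. borel)) N"
  shows "indep_vars (\<lambda>_. N) (\<lambda>k w. g k (restrict (X k w) {..<p})) {..<n}"
  using indep_vars_compose2[OF indep, where Y=g and N="\<lambda>_. N"] assms by auto

lemma bil_sum_left: "bil (\<lambda>i. \<Sum>c\<in>C. t c * \<alpha> c i) d = (\<Sum>c\<in>C. t c * bil (\<alpha> c) d)"
proof -
  have "bil (\<lambda>i. \<Sum>c\<in>C. t c * \<alpha> c i) d = (\<Sum>i<p. \<Sum>j<p. \<Sum>c\<in>C. t c * (\<alpha> c i * d j * ar_cov r i j))"
    unfolding bil_def by (simp add: sum_distrib_right mult.assoc)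
  also have "\<dots> = (\<Sum>i<p. \<Sum>c\<in>C. \<Sum>j<p. t c * (\<alpha> c i * d j * ar_cov r i j))"
    by (intro sum.cong refl) (rule sum.swap)
  also have "\<dots> = (\<Sum>c\<in>C. \<Sum>i<p. \<Sum>j<p. t c * (\<alpha> c i * d j * ar_cov r i j))" by (rule sum.swap)
  finally show ?thesis unfolding bil_def by (simp add: sum_distrib_left)
qed

lemma ar_cov_commute: "ar_cov r i j = ar_cov r j i"
  unfolding ar_cov_def by (cases i j rule: linorder_cases) auto

lemma bil_commute: "bil c d = bil d c"
  unfolding bil_def by (subst sum.swap) (simp add: ar_cov_commute mult.commute)

lemma bil_sum_right: "bil d (\<lambda>i. \<Sum>c\<in>C. t c * \<alpha> c i) = (\<Sum>c\<in>C. t c * bil d (\<alpha> c))"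
  using bil_sum_left[where C=C and t=t and \<alpha>=\<alpha> and d=d] by (simp add: bil_commute)

text \<open>Positive semidefiniteness of \<open>ar_cov r\<close> is not proved separately, so the
  sign of the variance is a hypothesis; in each application \<open>bil c c\<close> is an explicit
  sum of squares.\<close>

lemma char_lin:
  assumes "k < n" and v: "bil c c \<ge> 0"
  shows "(CLINT w|M. iexp (lin c k w)) = exp (- bil c c / 2)"
proof (cases "bil c c > 0")
  case True
  define \<sigma> where "\<sigma> = sqrt (bil c c)"
  have sp: "\<sigma> > 0" "\<sigma>\<^sup>2 = bil c c" using True by (auto simp: \<sigma>_def)
  have "distributed M lborel (lin c k) (normal_density 0 \<sigma>)"
    using gauss[OF \<open>k < n\<close>] True unfolding centered_gaussian_vec_def Let_def
    by (auto simp: lin_def[abs_def] bil_def \<sigma>_def dest!: spec[of _ c])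
  then have "distributed M lborel (\<lambda>w. (lin c k w - 0) / \<sigma>) std_normal_density"
    using normal_standard_normal_convert[OF sp(1)] by blast
  then have D: "distr M lborel (\<lambda>w. lin c k w / \<sigma>) = std_normal_distribution"
    by (simp add: distributed_def)
  have [measurable]: "lin c k \<in> borel_measurable M" using \<open>k < n\<close> by simp
  have "char std_normal_distribution \<sigma> = (CLINT w|M. iexp (\<sigma> * (lin c k w / \<sigma>)))"
    unfolding char_def D[symmetric] by (subst integral_distr) auto
  then show ?thesis using sp by (simp add: char_std_normal_distribution)
next
  case False
  then have z: "bil c c = 0" using v by simp
  have [measurable]: "lin c k \<in> borel_measurable M" using \<open>k < n\<close> by simp
  have "AE w in M. lin c k w = 0"
    using gauss[OF \<open>k < n\<close>] False unfolding centered_gaussian_vec_def Let_def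
    by (auto simp: lin_def[abs_def] bil_def dest!: spec[of _ c])
  then have "(CLINT w|M. iexp (lin c k w)) = (CLINT w|M. 1)"
    by (intro integral_cong_AE) auto
  then show ?thesis using z by (simp add: prob_space)
qed

lemma lin_std_normal:
  assumes "k < n" "bil c c = 1"
  shows "distributed M lborel (lin c k) std_normal_density"
  using gauss[OF \<open>k < n\<close>] assms unfolding centered_gaussian_vec_def Let_def
    by (auto simp: lin_def[abs_def] bil_def dest!: spec[of _ c])

lemma indep_lin: "indep_vars (\<lambda>_. borel) (lin c) {..<n}"
proof -
  have "indep_vars (\<lambda>_. borel) (\<lambda>k w. (\<lambda>x. \<Sum>i<p. c i * x i) (restrict (X k w) {..<p})) {..<n}"
    by (rule indep_functions_of_rows) measurable
  then show ?thesis by (simp add: lin_def[abs_def])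
qed

lemma lin_chi_square_concentration:
  assumes "bil c c = 1" "0 < \<epsilon>" "\<epsilon> \<le> 2"
  shows "prob {w \<in> space M. \<bar>(\<Sum>k<n. (lin c k w)\<^sup>2) - real n\<bar> > \<epsilon> * real n} \<le> 2 * exp (- (real n * \<epsilon>\<^sup>2 / 16))"
  by (rule chi_square_concentration[OF indep_lin]) (use assms lin_std_normal in auto)

text \<open>A linear combination of all these forms splits over the independent rows. Within a row
  it is a single linear form whose variance is, by orthonormality, the sum of the squared weights,
  so its characteristic function is a product over \<open>C\<close>.\<close>

lemma indep_orthonormal_lins:
  assumes C: "finite C" and on: "\<And>c d. c \<in> C \<Longrightarrow> d \<in> C \<Longrightarrow> bil (\<alpha> c) (\<alpha> d) = (if c = d then 1 else 0)"
  shows "indep_vars (\<lambda>_. borel) (\<lambda>(k, c). lin (\<alpha> c) k) ({..<n} \<times> C)"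
proof (rule indep_vars_if_char_factorizes)
  show "finite ({..<n} \<times> C)" using C by simp
  show "(case i of (k, c) \<Rightarrow> lin (\<alpha> c) k) \<in> borel_measurable M" if "i \<in> {..<n} \<times> C" for i
    using that by auto
  fix t :: "nat \<times> 'b \<Rightarrow> real"
  define \<beta> where "\<beta> k = (\<lambda>i. \<Sum>c\<in>C. t (k, c) * \<alpha> c i)" for k
  have lb: "lin (\<beta> k) k w = (\<Sum>c\<in>C. t (k, c) * lin (\<alpha> c) k w)" for k w
    unfolding lin_def \<beta>_def by (simp add: sum_distrib_left sum_distrib_right mult.assoc sum.swap[of _ C])
  have bb: "bil (\<beta> k) (\<beta> k) = (\<Sum>c\<in>C. (t (k, c))\<^sup>2)" for k
  proof -
    have "bil (\<beta> k) (\<beta> k) = (\<Sum>c\<in>C. \<Sum>d\<in>C. t (k, c) * (t (k, d) * bil (\<alpha> c) (\<alpha> d)))"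
      unfolding \<beta>_def by (simp only: bil_sum_left bil_sum_right sum_distrib_left)
    also have "\<dots> = (\<Sum>c\<in>C. \<Sum>d\<in>C. if c = d then (t (k, c))\<^sup>2 else 0)"
      by (intro sum.cong refl) (auto simp: on power2_eq_square)
    finally show ?thesis using C by simp
  qed
  have b1: "bil (\<lambda>i. s * \<alpha> c i) (\<lambda>i. s * \<alpha> c i) = s\<^sup>2" if "c \<in> C" for s c
    using bil_sum_left[where C="{c}" and t="\<lambda>_. s" and \<alpha>=\<alpha>] bil_sum_right[where C="{c}" and t="\<lambda>_. s" and \<alpha>=\<alpha>] on[OF that that] by (simp add: power2_eq_square)
  have l1: "lin (\<lambda>i. s * \<alpha> c i) k w = s * lin (\<alpha> c) k w" for s c k w
    unfolding lin_def by (simp add: sum_distrib_left mult.assoc)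
  have ce: "(CLINT w|M. iexp (s * lin (\<alpha> c) k w)) = exp (- s\<^sup>2 / 2)" if "k < n" "c \<in> C" for s c k
    using char_lin[OF \<open>k < n\<close>, of "\<lambda>i. s * \<alpha> c i"] by (simp only: b1[OF \<open>c \<in> C\<close>] l1) simp
  have indb: "indep_vars (\<lambda>_. borel) (\<lambda>k w. iexp (lin (\<beta> k) k w)) {..<n}"
  proof -
    have "indep_vars (\<lambda>_. borel) (\<lambda>k w. (\<lambda>x. iexp (\<Sum>i<p. \<beta> k i * x i)) (restrict (X k w) {..<p})) {..<n}"
      by (rule indep_functions_of_rows) measurable
    then show ?thesis by (simp add: lin_def[abs_def])
  qed
  have "(CLINT w|M. iexp (\<Sum>i\<in>{..<n} \<times> C. t i * (case i of (k, c) \<Rightarrow> lin (\<alpha> c) k) w))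
      = (CLINT w|M. \<Prod>k<n. iexp (lin (\<beta> k) k w))"
  proof (intro Bochner_Integration.integral_cong refl)
    fix w
    have "(\<Sum>i\<in>{..<n} \<times> C. t i * (case i of (k, c) \<Rightarrow> lin (\<alpha> c) k) w) = (\<Sum>k<n. lin (\<beta> k) k w)"
      unfolding lb by (subst sum.cartesian_product) (auto intro!: sum.cong)
    then show "iexp (\<Sum>i\<in>{..<n} \<times> C. t i * (case i of (k, c) \<Rightarrow> lin (\<alpha> c) k) w) = (\<Prod>k<n. iexp (lin (\<beta> k) k w))"
      by (simp only: of_real_sum sum_distrib_left exp_sum[OF finite_lessThan])
  qed
  also have "\<dots> = (\<Prod>k<n. CLINT w|M. iexp (lin (\<beta> k) k w))"
    by (intro indep_vars_lebesgue_integral indb) (auto intro!: integrable_const_bound[where B=1])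
  also have "\<dots> = (\<Prod>k<n. \<Prod>c\<in>C. CLINT w|M. iexp (t (k, c) * lin (\<alpha> c) k w))"
  proof (intro prod.cong refl)
    fix k assume "k \<in> {..<n}" then have k: "k < n" by simp
    have "(CLINT w|M. iexp (lin (\<beta> k) k w)) = complex_of_real (exp (\<Sum>c\<in>C. - (t (k, c))\<^sup>2 / 2))"
      using char_lin[OF k, of "\<beta> k"] by (simp add: bb sum_nonneg sum_divide_distrib sum_negf)
    also have "\<dots> = (\<Prod>c\<in>C. complex_of_real (exp (- (t (k, c))\<^sup>2 / 2)))"
      by (simp only: exp_sum[OF C] of_real_prod)
    finally show "(CLINT w|M. iexp (lin (\<beta> k) k w)) = (\<Prod>c\<in>C. CLINT w|M. iexp (t (k, c) * lin (\<alpha> c) k w))"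
      using ce[OF k] by (simp cong: prod.cong)
  qed
  finally show "(CLINT w|M. iexp (\<Sum>i\<in>{..<n} \<times> C. t i * (case i of (k, c) \<Rightarrow> lin (\<alpha> c) k) w))
    = (\<Prod>i\<in>{..<n} \<times> C. CLINT w|M. iexp (t i * (case i of (k, c) \<Rightarrow> lin (\<alpha> c) k) w))"
    by (simp add: prod.cartesian_product case_prod_beta)
qed

end

subsection \<open>Sample moments of a single pair\<close>

text \<open>The left-hand side is the harmonic mean of \<open>a\<close> and \<open>b\<close>. In
  this form it bounds the gap between arithmetic and geometric mean by the square of the
  difference.\<close>

lemma sqrt_mult_ge_mean_defect:
  fixes a b :: real assumes "a > 0" "b > 0"
  shows "(a + b) / 2 - (a - b)\<^sup>2 / (2 * (a + b)) \<le> sqrt (a * b)"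
proof -
  have "(a + b) / 2 - (a - b)\<^sup>2 / (2 * (a + b)) = 2 * a * b / (a + b)"
    using assms by (simp add: field_simps power2_eq_square)
  also have "\<dots> \<le> sqrt (a * b)"
  proof -
    have "2 * sqrt (a * b) \<le> a + b" using arith_geo_mean_sqrt[of a b] assms by simp
    then have "2 * sqrt (a * b) * sqrt (a * b) \<le> (a + b) * sqrt (a * b)"
      using assms by (intro mult_right_mono) auto
    then have "2 * a * b \<le> sqrt (a * b) * (a + b)" using assms by (simp add: mult.commute mult.left_commute)
    then show ?thesis using assms by (simp add: divide_le_eq)
  qed
  finally show ?thesis .
qed

text \<open>For a pair of columns with correlation \<open>R\<close>, \<open>s11\<close>, \<open>s12\<close>, \<open>s22\<close> are the entries of the Gram matrix; \<open>U\<close>, \<open>V\<close>,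
  \<open>H\<close> are \<open>\<Sum> u\<^sup>2\<close>, \<open>\<Sum> v\<^sup>2\<close>, \<open>\<Sum> u v\<close> for the normalized sum \<open>u\<close> and difference \<open>v\<close> of the two columns.\<close>

locale pair_stats =
  fixes s11 s12 s22 R N :: real
  assumes R: "0 \<le> R" "R < 1" and N: "N > 0"
begin

definition "U = (s11 + 2 * s12 + s22) / (2 * (1 + R))"
definition "V = (s11 - 2 * s12 + s22) / (2 * (1 - R))"
definition "H = (s11 - s22) / (2 * sqrt (1 - R\<^sup>2))"
definition "W = (s12 - R / 2 * (s11 + s22)) / ((1 - R\<^sup>2) * sqrt N)"
definition "near e x \<longleftrightarrow> \<bar>x - N\<bar> \<le> e * N"

lemma R2: "R\<^sup>2 < 1"
  using R by (simp add: abs_square_less_1)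

lemma s12_UV: "s12 = ((1 + R) * U - (1 - R) * V) / 2"
  and sum_UV: "s11 + s22 = (1 + R) * U + (1 - R) * V"
proof -
  have h: "c * (x / (2 * c)) = x / 2" if "c \<noteq> 0" for c x :: real using that by simp
  have "(1 + R) * U = (s11 + 2 * s12 + s22) / 2" "(1 - R) * V = (s11 - 2 * s12 + s22) / 2"
    using h[of "1 + R"] h[of "1 - R"] R unfolding U_def V_def by simp_all
  then show "s12 = ((1 + R) * U - (1 - R) * V) / 2" "s11 + s22 = (1 + R) * U + (1 - R) * V"
    by simp_all
qed

lemma W_UV: "W = (U - V) / (2 * sqrt N)"
proof -
  have "s12 - R / 2 * (s11 + s22) = (1 - R\<^sup>2) * (U - V) / 2"
  proof -
    have "s12 - R / 2 * (s11 + s22) = ((1 + R) * U - (1 - R) * V) / 2 - R / 2 * ((1 + R) * U + (1 - R) * V)"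
      by (simp only: s12_UV[symmetric] sum_UV[symmetric])
    also have "\<dots> = (1 - R\<^sup>2) * (U - V) / 2" by (simp add: power2_eq_square field_simps)
    finally show ?thesis .
  qed
  then show ?thesis unfolding W_def using R2 by (simp only:) simp
qed

text \<open>\<open>s12\<close> and the mean of \<open>s11\<close> and \<open>s22\<close> are
  combinations of \<open>U\<close> and \<open>V\<close> with weights \<open>(1 + R) / 2\<close> and
  \<open>(1 - R) / 2\<close>, up to sign. The absolute weights add up to 1, so the error
  \<open>e * N\<close> is not amplified.\<close>

lemma s12_bounds:
  assumes "near e U" "near e V"
  shows "\<bar>s12 - N * R\<bar> \<le> e * N" "\<bar>(s11 + s22) / 2 - N\<bar> \<le> e * N"
proof -
  have u: "(1 + R) * (N - e * N) \<le> (1 + R) * U" "(1 + R) * U \<le> (1 + R) * (N + e * N)"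
    using assms R unfolding near_def by (auto intro!: mult_left_mono simp: abs_le_iff)
  have v: "(1 - R) * (N - e * N) \<le> (1 - R) * V" "(1 - R) * V \<le> (1 - R) * (N + e * N)"
    using assms R unfolding near_def by (auto intro!: mult_left_mono simp: abs_le_iff)
  have x: "(1 + R) * (N - e * N) = N + N * R - e * N - R * (e * N)" "(1 + R) * (N + e * N) = N + N * R + e * N + R * (e * N)"
    "(1 - R) * (N - e * N) = N - N * R - e * N + R * (e * N)" "(1 - R) * (N + e * N) = N - N * R + e * N - R * (e * N)"
    by (simp_all add: algebra_simps)
  have g1: "\<bar>s - K\<bar> \<le> E"
    if "s = (a - b) / 2" "L + K - E - F \<le> a" "a \<le> L + K + E + F" "L - K - E + F \<le> b" "b \<le> L - K + E - F" for s a b L K E F :: real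
    proof -
    have "2 * s = a - b" using that(1) by simp
    then show ?thesis using that(2-) by linarith
  qed
  have g2: "\<bar>s / 2 - L\<bar> \<le> E"
    if "s = a + b" "L + K - E - F \<le> a" "a \<le> L + K + E + F" "L - K - E + F \<le> b" "b \<le> L - K + E - F" for s a b L K E F :: real
    using that by arith
  show "\<bar>s12 - N * R\<bar> \<le> e * N" by (rule g1[OF s12_UV u[unfolded x] v[unfolded x]])
  show "\<bar>(s11 + s22) / 2 - N\<bar> \<le> e * N" by (rule g2[OF sum_UV u[unfolded x] v[unfolded x]])
qed

lemma corr_le:
  assumes "near e U" "near e V" "near e s11" "near e s22" "0 < e" "e \<le> 1/2" "R + e \<le> \<rho> * (1 - e)"
  shows "s12 / sqrt (s11 * s22) \<le> \<rho>"
proof -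
  have pos: "\<rho> > 0"
  proof -
    have "0 < \<rho> * (1 - e)" using assms R by linarith
    then show ?thesis using assms by (simp add: zero_less_mult_iff)
  qed
  have l: "N * (1 - e) \<le> s11" "N * (1 - e) \<le> s22" using assms unfolding near_def by (auto simp: abs_le_iff algebra_simps)
  have p: "N * (1 - e) > 0" using N assms by simp
  have "(N * (1 - e)) * (N * (1 - e)) \<le> s11 * s22" using l p by (intro mult_mono) auto
  then have "N * (1 - e) \<le> sqrt (s11 * s22)" using p by (intro real_le_rsqrt) (simp add: power2_eq_square)
  then have "\<rho> * (N * (1 - e)) \<le> \<rho> * sqrt (s11 * s22)" using pos by (intro mult_left_mono) auto
  moreover have "s12 \<le> N * R + e * N" using s12_bounds(1)[OF assms(1,2)] by (simp add: abs_le_iff)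
  moreover have "N * (R + e) \<le> N * (\<rho> * (1 - e))" using assms N by (intro mult_left_mono) auto
  ultimately have "s12 \<le> \<rho> * sqrt (s11 * s22)" by (simp add: algebra_simps)
  moreover have "sqrt (s11 * s22) > 0" using l p by auto
  ultimately show ?thesis by (simp add: divide_le_eq)
qed

text \<open>With the arithmetic in place of the geometric mean of \<open>s11\<close> and
  \<open>s22\<close>, the correlation exceeds \<open>t\<close> exactly when the last factor is
  positive. Both comparisons below thus reduce to the gap between the means and to the ratio of the
  arithmetic mean to \<open>N\<close>.\<close>

lemma margin:
  assumes t: "t = R + (1 - R\<^sup>2) * y / sqrt N"
  shows "s12 - t * ((s11 + s22) / 2) = (1 - R\<^sup>2) * sqrt N * (W - y * ((s11 + s22) / 2 / N))"
proof -
  define q where "q = sqrt N"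
  have q: "q > 0" "N = q * q" using N unfolding q_def by auto
  define K m where "K = 1 - R\<^sup>2" and "m = (s11 + s22) / 2"
  have s: "s12 = K * q * W + R * m" using R2 q unfolding W_def q_def[symmetric] K_def m_def by simp
  have "K * q * (W - y * (m / N)) = K * q * W - K * (q * (y * (m / N)))" by (simp add: right_diff_distrib mult.assoc)
  also have "q * (y * (m / N)) = y / q * m" using q by simp
  finally show ?thesis unfolding t q_def[symmetric] K_def[symmetric] m_def[symmetric] using s
    by (simp add: left_diff_distrib distrib_right)
qed

text \<open>Here the inequality between the means points in the favourable direction, so the only
  cost is the deviation of the arithmetic mean from \<open>N\<close>, that is a shift by
  \<open>y * e\<close>.\<close>

lemma corr_gt_if_W_gt:
  assumes "near e U" "near e V" "near e s11" "near e s22" "0 < e" "e \<le> 1/2" "0 \<le> y" "y * e \<le> \<eta>"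
    and t: "t = R + (1 - R\<^sup>2) * y / sqrt N" and W: "W > y + \<eta>"
  shows "s12 / sqrt (s11 * s22) > t"
proof -
  have l: "N * (1 - e) \<le> s11" "N * (1 - e) \<le> s22" using assms unfolding near_def by (auto simp: abs_le_iff algebra_simps)
  have p: "N * (1 - e) > 0" using N assms by simp
  have sp: "s11 > 0" "s22 > 0" using less_le_trans[OF p l(1)] less_le_trans[OF p l(2)] .
  have t0: "0 \<le> t" using R(1) R2 N \<open>0 \<le> y\<close> unfolding t by simp
  have "(s11 + s22) / 2 / N \<le> 1 + e" using s12_bounds(2)[OF assms(1,2)] N by (simp add: abs_le_iff field_simps)
  then have "y * ((s11 + s22) / 2 / N) \<le> y * (1 + e)" using assms by (intro mult_left_mono) auto
  then have "W - y * ((s11 + s22) / 2 / N) > 0" using W assms by (simp add: algebra_simps)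
  then have "(1 - R\<^sup>2) * sqrt N * (W - y * ((s11 + s22) / 2 / N)) > 0" using R2 N by (intro mult_pos_pos) auto
  then have "s12 - t * ((s11 + s22) / 2) > 0" by (simp only: margin[OF t])
  moreover have "t * sqrt (s11 * s22) \<le> t * ((s11 + s22) / 2)"
    using arith_geo_mean_sqrt[of s11 s22] sp t0 by (intro mult_left_mono) auto
  ultimately have "s12 > t * sqrt (s11 * s22)" by linarith
  then show ?thesis using sp by (simp add: less_divide_eq)
qed

text \<open>Now the geometric mean has to be bounded from below, at a loss of order
  \<open>(s11 - s22)\<^sup>2 / N\<close>. Expressing \<open>s11 - s22\<close> by \<open>H\<close>
  produces a factor \<open>1 - R\<^sup>2\<close>, which cancels the one in \<open>margin\<close>;
  the resulting shift does not depend on how close \<open>R\<close> is to 1. The assumption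
  \<open>y \<le> sqrt N\<close> serves to bound \<open>t\<close> by 2.\<close>

lemma W_gt_if_corr_gt:
  assumes "near e U" "near e V" "near e s11" "near e s22" "0 < e" "e \<le> 1/2" "0 \<le> y" "y \<le> sqrt N" "y * e + 4 * e\<^sup>2 * sqrt N \<le> \<eta>"
    and H: "\<bar>H\<bar> \<le> e * N"
    and t: "t = R + (1 - R\<^sup>2) * y / sqrt N" and corr: "s12 / sqrt (s11 * s22) > t"
  shows "W > y - \<eta>"
proof -
  have l: "N * (1 - e) \<le> s11" "N * (1 - e) \<le> s22" using assms unfolding near_def by (auto simp: abs_le_iff algebra_simps)
  have p: "N * (1 - e) > 0" using N assms by simp
  have sp: "s11 > 0" "s22 > 0" using less_le_trans[OF p l(1)] less_le_trans[OF p l(2)] .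
  have t0: "0 \<le> t" using R(1) R2 N \<open>0 \<le> y\<close> unfolding t by simp
  have "(1 - R\<^sup>2) * (y / sqrt N) \<le> 1 * 1" using R2 N \<open>0 \<le> y\<close> \<open>y \<le> sqrt N\<close> by (intro mult_mono) auto
  then have t2: "t \<le> 2" using R unfolding t by simp
  have s1: "sqrt (1 - R\<^sup>2) > 0" using R2 by simp
  have "s11 - s22 = 2 * sqrt (1 - R\<^sup>2) * H" using s1 unfolding H_def by simp
  then have "(s11 - s22)\<^sup>2 = 4 * (1 - R\<^sup>2) * H\<^sup>2" using R2 by (simp add: power_mult_distrib)
  also have "\<dots> \<le> 4 * (1 - R\<^sup>2) * (e * N)\<^sup>2"
    using H R2 by (intro mult_left_mono) (auto simp: abs_le_square_iff[symmetric])
  finally have d: "(s11 - s22)\<^sup>2 \<le> 4 * (1 - R\<^sup>2) * (e * N)\<^sup>2" .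
  have "N * e \<le> N * (1/2)" using assms N by (intro mult_left_mono) auto
  then have sm: "s11 + s22 \<ge> N" using l by (simp add: algebra_simps)
  have "(s11 - s22)\<^sup>2 / (2 * (s11 + s22)) \<le> 4 * (1 - R\<^sup>2) * (e * N)\<^sup>2 / (2 * N)"
    using d sm N R2 by (intro frac_le) auto
  also have "\<dots> = 2 * (1 - R\<^sup>2) * e\<^sup>2 * N" using N by (simp add: power2_eq_square)
  finally have d2: "(s11 - s22)\<^sup>2 / (2 * (s11 + s22)) \<le> 2 * (1 - R\<^sup>2) * e\<^sup>2 * N" .
  have "s12 > t * sqrt (s11 * s22)" using corr sp by (simp add: less_divide_eq)
  moreover have "t * ((s11 + s22) / 2 - (s11 - s22)\<^sup>2 / (2 * (s11 + s22))) \<le> t * sqrt (s11 * s22)"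
    using sqrt_mult_ge_mean_defect[OF sp] t0 by (intro mult_left_mono)
  moreover have "t * ((s11 - s22)\<^sup>2 / (2 * (s11 + s22))) \<le> 2 * (2 * (1 - R\<^sup>2) * e\<^sup>2 * N)"
    using d2 t0 t2 sp by (intro mult_mono) auto
  ultimately have "s12 - t * ((s11 + s22) / 2) > - (4 * (1 - R\<^sup>2) * e\<^sup>2 * N)"
  proof -
    have "s > - (4 * K * e\<^sup>2 * N) + b" if "s > c" "b - a \<le> c" "a \<le> 2 * (2 * K * e\<^sup>2 * N)" for s a b c K :: real
      using that by simp
    note this[of "t * sqrt (s11 * s22)" s12]
    then show ?thesis
      using \<open>s12 > t * sqrt (s11 * s22)\<close> \<open>t * ((s11 - s22)\<^sup>2 / (2 * (s11 + s22))) \<le> 2 * (2 * (1 - R\<^sup>2) * e\<^sup>2 * N)\<close>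
        \<open>t * ((s11 + s22) / 2 - (s11 - s22)\<^sup>2 / (2 * (s11 + s22))) \<le> t * sqrt (s11 * s22)\<close>
      unfolding right_diff_distrib[of t] by (smt (verit))
  qed
  moreover have "4 * (1 - R\<^sup>2) * e\<^sup>2 * N = (1 - R\<^sup>2) * sqrt N * (4 * e\<^sup>2 * sqrt N)"
  proof -
    have "4 * (1 - R\<^sup>2) * e\<^sup>2 * (sqrt N * sqrt N) = (1 - R\<^sup>2) * sqrt N * (4 * e\<^sup>2 * sqrt N)" by (simp only: ac_simps)
    then show ?thesis using N by simp
  qed
  ultimately have "(1 - R\<^sup>2) * sqrt N * (W - y * ((s11 + s22) / 2 / N)) > (1 - R\<^sup>2) * sqrt N * (- (4 * e\<^sup>2 * sqrt N))"
    unfolding margin[OF t] by (simp only: mult_minus_right)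
  then have "W - y * ((s11 + s22) / 2 / N) > - (4 * e\<^sup>2 * sqrt N)"
    using R2 N by (subst (asm) mult_less_cancel_left_pos) auto
  moreover have "(s11 + s22) / 2 / N \<ge> 1 - e" using s12_bounds(2)[OF assms(1,2)] N by (simp add: abs_le_iff field_simps)
  then have "y * ((s11 + s22) / 2 / N) \<ge> y * (1 - e)" using assms by (intro mult_left_mono) auto
  ultimately show ?thesis using assms by (simp add: algebra_simps)
qed

text \<open>\<open>A\<close> stands for the sum of the squares of \<open>a\<close> from the
  overview, and \<open>sqrt N * W / sqrt A\<close> for the self-normalized statistic
  \<open>Z\<close>.\<close>

lemma W_gt_if_Z_gt:
  assumes "near e A" "0 < e" "e \<le> 1/2" "0 \<le> z" "(z + \<eta>) * e \<le> \<eta>" "0 \<le> \<eta>" "sqrt N * W / sqrt A > z + \<eta>"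
  shows "W > z"
proof -
  have A: "N * (1 - e) \<le> A" using assms unfolding near_def by (auto simp: abs_le_iff algebra_simps)
  have "N * (1 - e) > 0" using N assms by simp
  then have Ap: "A > 0" using A by linarith
  have "(1 - e) \<le> sqrt (A / N)"
  proof (rule real_le_rsqrt)
    have "(1 - e)\<^sup>2 \<le> 1 - e" using assms by (simp add: power2_eq_square mult_left_le)
    also have "\<dots> \<le> A / N" using A N by (simp add: field_simps)
    finally show "(1 - e)\<^sup>2 \<le> A / N" .
  qed
  then have "(z + \<eta>) * (1 - e) \<le> (z + \<eta>) * sqrt (A / N)" using assms by (intro mult_left_mono) auto
  moreover have "W > (z + \<eta>) * sqrt (A / N)"
    using assms(7) Ap N by (simp add: real_sqrt_divide field_simps)
  ultimately show ?thesis using assms by (simp add: algebra_simps)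
qed

lemma Z_gt_if_W_gt:
  assumes "near e A" "0 < e" "e \<le> 1/2" "0 \<le> z" "z * e \<le> \<eta>" "W > z"
  shows "sqrt N * W / sqrt A > z - \<eta>"
proof -
  have A: "N * (1 - e) \<le> A" "A \<le> N * (1 + e)" using assms unfolding near_def by (auto simp: abs_le_iff algebra_simps)
  have "N * (1 - e) > 0" using N assms by simp
  then have Ap: "A > 0" using A by linarith
  have "sqrt (A / N) \<le> 1 + e"
  proof (rule real_le_lsqrt)
    have "A / N \<le> 1 + e" using A N by (simp add: field_simps)
    also have "\<dots> \<le> (1 + e)\<^sup>2" using assms by (simp add: power2_eq_square algebra_simps)
    finally show "A / N \<le> (1 + e)\<^sup>2" .
  qed (use assms in auto)
  then have "(z - z * e) * sqrt (A / N) \<le> (z - z * e) * (1 + e)"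
    using assms by (intro mult_left_mono) (auto intro: mult_left_le)
  also have "\<dots> \<le> z" using assms by (simp add: algebra_simps)
  also have "\<dots> < W" using assms by simp
  finally have "z - z * e < W / sqrt (A / N)" using Ap N by (simp add: field_simps)
  also have "\<dots> = sqrt N * W / sqrt A" by (simp add: real_sqrt_divide)
  finally show ?thesis using assms by linarith
qed

end

lemma (in prob_space) prob_finite_UN_le:
  assumes "finite I" "\<And>i. i \<in> I \<Longrightarrow> A i \<in> events" "\<And>i. i \<in> I \<Longrightarrow> prob (A i) \<le> c"
  shows "prob (\<Union>i\<in>I. A i) \<le> real (card I) * c"
proof -
  have "prob (\<Union>i\<in>I. A i) \<le> (\<Sum>i\<in>I. prob (A i))" using assms by (intro finite_measure_subadditive_finite) auto
  also have "\<dots> \<le> (\<Sum>i\<in>I. c)" using assms by (intro sum_mono) auto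
  finally show ?thesis by simp
qed

section \<open>Gram entries, orthonormal coefficient vectors and the good event\<close>

context ar_sample begin

definition S :: "nat \<Rightarrow> nat \<Rightarrow> 'a \<Rightarrow> real" where
  "S i j w = (\<Sum>k<n. X k w i * X k w j)"

lemma S_measurable [measurable]: "i < p \<Longrightarrow> j < p \<Longrightarrow> S i j \<in> borel_measurable M"
  unfolding S_def by measurable

definition form :: "real \<Rightarrow> nat \<Rightarrow> real \<Rightarrow> nat \<Rightarrow> nat \<Rightarrow> real" where
  "form a i b j = (\<lambda>l. (if l = i then a else 0) + (if l = j then b else 0))"

lemma sum_form: "i < p \<Longrightarrow> j < p \<Longrightarrow> (\<Sum>l<p. form a i b j l * f l) = a * f i + b * f j"
  unfolding form_def by (simp add: distrib_right sum.distrib if_distrib[of "\<lambda>x. x * _"] cong: if_cong)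

lemma lin_form: "i < p \<Longrightarrow> j < p \<Longrightarrow> lin (form a i b j) k w = a * X k w i + b * X k w j"
  unfolding lin_def by (rule sum_form)

lemma bil_form:
  assumes "i < p" "j < p" "k < p" "l < p"
  shows "bil (form a i b j) (form c k d l) = a * c * ar_cov r i k + a * d * ar_cov r i l + b * c * ar_cov r j k + b * d * ar_cov r j l"
proof -
  have "bil (form a i b j) (form c k d l) = (\<Sum>x<p. form a i b j x * (\<Sum>y<p. form c k d l y * ar_cov r x y))"
    unfolding bil_def by (simp add: sum_distrib_left mult.assoc)
  then show ?thesis by (simp only: sum_form[OF assms(1,2)] sum_form[OF assms(3,4)]) (simp add: algebra_simps)
qed

lemma ar_cov_simps: "ar_cov r i i = 1" "i < j \<Longrightarrow> ar_cov r i j = r ^ (j - i)" "i < j \<Longrightarrow> ar_cov r j i = r ^ (j - i)"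
  unfolding ar_cov_def by auto

lemma sum_lin_form_square:
  assumes "i < p" "j < p"
  shows "(\<Sum>k<n. (lin (form a i b j) k w)\<^sup>2) = a\<^sup>2 * S i i w + 2 * a * b * S i j w + b\<^sup>2 * S j j w"
  unfolding lin_form[OF assms] S_def sum_distrib_left sum.distrib[symmetric]
  by (intro sum.cong refl) (simp add: power2_eq_square algebra_simps)

lemma pow_range: "i < j \<Longrightarrow> 0 \<le> r ^ (j - i)" "i < j \<Longrightarrow> r ^ (j - i) < 1"
  using r_range by (auto intro: power_Suc_less_one simp: power_less_one_iff)

text \<open>Coefficients of \<open>u\<close>, \<open>v\<close>, \<open>(u - v) / \<surd>2\<close> and \<open>(u + v) / \<surd>2\<close> for the columns \<open>i\<close> and \<open>j\<close>.\<close>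

definition "cu i j = form (1 / sqrt (2 * (1 + r ^ (j - i)))) i (1 / sqrt (2 * (1 + r ^ (j - i)))) j"
definition "cv i j = form (1 / sqrt (2 * (1 - r ^ (j - i)))) i (- (1 / sqrt (2 * (1 - r ^ (j - i))))) j"
definition "ca i j = form ((1 / sqrt (2 * (1 + r ^ (j - i))) - 1 / sqrt (2 * (1 - r ^ (j - i)))) / sqrt 2) i
    ((1 / sqrt (2 * (1 + r ^ (j - i))) + 1 / sqrt (2 * (1 - r ^ (j - i)))) / sqrt 2) j"
definition "cb i j = form ((1 / sqrt (2 * (1 + r ^ (j - i))) + 1 / sqrt (2 * (1 - r ^ (j - i)))) / sqrt 2) i
    ((1 / sqrt (2 * (1 + r ^ (j - i))) - 1 / sqrt (2 * (1 - r ^ (j - i)))) / sqrt 2) j"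

lemma ca_cu_cv: "i < p \<Longrightarrow> j < p \<Longrightarrow> lin (ca i j) k w = (lin (cu i j) k w - lin (cv i j) k w) / sqrt 2"
  and cb_cu_cv: "i < p \<Longrightarrow> j < p \<Longrightarrow> lin (cb i j) k w = (lin (cu i j) k w + lin (cv i j) k w) / sqrt 2"
  unfolding ca_def cb_def cu_def cv_def by (simp_all add: lin_form algebra_simps add_divide_distrib diff_divide_distrib)

lemma
  assumes "i < j" "j < p"
  shows bil_cu: "bil (cu i j) (cu i j) = 1" and bil_cv: "bil (cv i j) (cv i j) = 1"
    and bil_cu_cv: "bil (cu i j) (cv i j) = 0"
    and bil_ca: "bil (ca i j) (ca i j) = 1" and bil_cb: "bil (cb i j) (cb i j) = 1"
    and bil_ca_cb: "bil (ca i j) (cb i j) = 0"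
proof -
  define R where "R = r ^ (j - i)"
  define x y where "x = 1 / sqrt (2 * (1 + R))" and "y = 1 / sqrt (2 * (1 - R))"
  have R: "0 \<le> R" "R < 1" using pow_range[OF assms(1)] by (auto simp: R_def)
  have h: "1 / sqrt (2 * c) * (1 / sqrt (2 * c)) * c = 1 / 2" if "c > 0" for c :: real using that by simp
  have xy: "x * x * (1 + R) = 1/2" "y * y * (1 - R) = 1/2" using R h[of "1 + R"] h[of "1 - R"] unfolding x_def y_def by simp_all
  have ip: "i < p" using assms by simp
  have bf: "bil (form a i b j) (form c i d j) = a * c + (a * d + b * c) * R + b * d" for a b c d
    unfolding bil_form[OF ip assms(2) ip assms(2)] ar_cov_simps(1) ar_cov_simps(2,3)[OF assms(1)] R_def
    by (simp add: distrib_right)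
  define \<alpha> \<beta> where "\<alpha> = (x - y) / sqrt 2" and "\<beta> = (x + y) / sqrt 2"
  have ab: "\<alpha> * \<alpha> = (x * x - 2 * (x * y) + y * y) / 2" "\<beta> * \<beta> = (x * x + 2 * (x * y) + y * y) / 2" "\<alpha> * \<beta> = (x * x - y * y) / 2" "\<beta> * \<alpha> = (x * x - y * y) / 2"
    unfolding \<alpha>_def \<beta>_def by (simp_all add: algebra_simps)
  note defs = cu_def cv_def ca_def cb_def R_def[symmetric] x_def[symmetric] y_def[symmetric] \<alpha>_def[symmetric] \<beta>_def[symmetric]
  have "x * x + (x * x + x * x) * R + x * x = 2 * (x * x * (1 + R))" by (simp add: algebra_simps)
  then show "bil (cu i j) (cu i j) = 1" unfolding defs bf using xy(1) by simp
  have "y * y + (y * (- y) + (- y) * y) * R + (- y) * (- y) = 2 * (y * y * (1 - R))" by (simp add: algebra_simps)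
  then show "bil (cv i j) (cv i j) = 1" unfolding defs bf using xy(2) by simp
  show "bil (cu i j) (cv i j) = 0" unfolding defs bf by simp
  have "(x * x - 2 * (x * y) + y * y) / 2 + ((x * x - y * y) / 2 + (x * x - y * y) / 2) * R + (x * x + 2 * (x * y) + y * y) / 2
     = x * x * (1 + R) + y * y * (1 - R)" by (simp add: field_simps)
  then have m: "\<alpha> * \<alpha> + (\<alpha> * \<beta> + \<beta> * \<alpha>) * R + \<beta> * \<beta> = 1" unfolding ab using xy by simp
  show "bil (ca i j) (ca i j) = 1" unfolding defs bf by (rule m)
  show "bil (cb i j) (cb i j) = 1" unfolding defs bf using m by (simp add: algebra_simps)
  have "(x * x - y * y) / 2 + ((x * x - 2 * (x * y) + y * y) / 2 + (x * x + 2 * (x * y) + y * y) / 2) * R + (x * x - y * y) / 2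
     = x * x * (1 + R) - y * y * (1 - R)" by (simp add: field_simps)
  then have "\<alpha> * \<beta> + (\<alpha> * \<alpha> + \<beta> * \<beta>) * R + \<beta> * \<alpha> = 0" unfolding ab using xy by simp
  then show "bil (ca i j) (cb i j) = 0" unfolding defs bf .
qed

definition chi :: "(nat \<Rightarrow> real) \<Rightarrow> 'a \<Rightarrow> real" where "chi c w = (\<Sum>k<n. (lin c k w)\<^sup>2)"

lemma chi_measurable [measurable]: "chi c \<in> borel_measurable M"
  unfolding chi_def by measurable

text \<open>The first two forms give the diagonal Gram entries, the next two \<open>U\<close> and
  \<open>V\<close>. The form \<open>ca\<close> gives the squared denominator of \<open>Z\<close>,
  and together with \<open>cb\<close> it controls \<open>H\<close>. All pairs are included because
  nonadjacent correlations and the truncation error need them too.\<close>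

definition good :: "real \<Rightarrow> 'a \<Rightarrow> bool" where
  "good \<epsilon> w \<longleftrightarrow> (\<forall>i j. i < j \<and> j < p \<longrightarrow>
     (\<forall>c\<in>{form 1 i 0 j, form 0 i 1 j, cu i j, cv i j, ca i j, cb i j}. \<bar>chi c w - real n\<bar> \<le> \<epsilon> * real n))"

lemma good_measurable [measurable]: "Measurable.pred M (good \<epsilon>)"
  unfolding good_def by measurable

lemma bil_unit: "i < j \<Longrightarrow> j < p \<Longrightarrow> bil (form 1 i 0 j) (form 1 i 0 j) = 1" "i < j \<Longrightarrow> j < p \<Longrightarrow> bil (form 0 i 1 j) (form 0 i 1 j) = 1"
  by (simp_all add: bil_form ar_cov_simps)

text \<open>All forms involved have variance 1. A union bound over six forms for at most
  \<open>p * p\<close> pairs, with two tails each, accounts for the factor 12.\<close>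

lemma prob_not_good:
  assumes e: "0 < \<epsilon>" "\<epsilon> \<le> 2"
  shows "prob {w \<in> space M. \<not> good \<epsilon> w} \<le> 12 * (real p)\<^sup>2 * exp (- (real n * \<epsilon>\<^sup>2 / 16))"
proof -
  define cs where "cs = (\<lambda>i j. [form 1 i 0 j, form 0 i 1 j, cu i j, cv i j, ca i j, cb i j])"
  define E where "E = (\<lambda>(i, j, q). if i < j then {w \<in> space M. \<bar>chi (cs i j ! q) w - real n\<bar> > \<epsilon> * real n} else {})"
  define J where "J = {..<p} \<times> {..<p} \<times> {..<6::nat}"
  have sub: "{w \<in> space M. \<not> good \<epsilon> w} \<subseteq> (\<Union>x\<in>J. E x)"
  proof
    fix w assume "w \<in> {w \<in> space M. \<not> good \<epsilon> w}"
    then obtain i j c where ws: "w \<in> space M" "i < j" "j < p" "c \<in> set (cs i j)" "\<bar>chi c w - real n\<bar> > \<epsilon> * real n"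
      unfolding good_def cs_def by (auto simp: not_le)
    have "length (cs i j) = 6" by (simp add: cs_def)
    then obtain q where q: "q < 6" "cs i j ! q = c" using ws(4) unfolding in_set_conv_nth by auto
    then have "(i, j, q) \<in> J" "w \<in> E (i, j, q)" using ws by (auto simp: J_def E_def)
    then show "w \<in> (\<Union>x\<in>J. E x)" by blast
  qed
  have "prob {w \<in> space M. \<not> good \<epsilon> w} \<le> prob (\<Union>x\<in>J. E x)"
    by (intro finite_measure_mono sub sets.finite_UN) (auto simp: J_def E_def)
  also have "\<dots> \<le> real (card J) * (2 * exp (- (real n * \<epsilon>\<^sup>2 / 16)))"
  proof (rule prob_finite_UN_le)
    fix x assume "x \<in> J"
    then obtain i j q where x: "x = (i, j, q)" "j < p" "q < 6" by (auto simp: J_def)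
    show "prob (E x) \<le> 2 * exp (- (real n * \<epsilon>\<^sup>2 / 16))"
    proof (cases "i < j")
      case True
      then have "bil c c = 1" if "c \<in> set (cs i j)" for c
        using that x bil_unit bil_cu bil_cv bil_ca bil_cb by (auto simp: cs_def)
      moreover have "cs i j ! q \<in> set (cs i j)" using x(3) by (intro nth_mem) (simp add: cs_def)
      ultimately show ?thesis
        using lin_chi_square_concentration[OF _ e] True by (simp add: E_def x chi_def)
    qed (simp add: E_def x)
  qed (auto simp: J_def E_def)
  also have "\<dots> = 12 * (real p)\<^sup>2 * exp (- (real n * \<epsilon>\<^sup>2 / 16))" by (simp add: J_def power2_eq_square)
  finally show ?thesis .
qed

end

subsection \<open>The self-normalized statistic\<close>

definition normal_tail :: "real \<Rightarrow> real" where
  "normal_tail z = measure std_normal_distribution {z<..}"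

lemma (in prob_space) prob_std_normal_gt:
  assumes "distributed M lborel Y std_normal_density"
  shows "prob {w \<in> space M. Y w > z} = normal_tail z"
proof -
  have [measurable]: "Y \<in> borel_measurable M" using assms by (auto simp: distributed_def)
  have "normal_tail z = measure (distr M lborel Y) {z<..}"
    unfolding normal_tail_def using assms by (simp add: distributed_def)
  also have "\<dots> = prob (Y -` {z<..} \<inter> space M)" by (rule measure_distr) auto
  also have "Y -` {z<..} \<inter> space M = {w \<in> space M. Y w > z}" by auto
  finally show ?thesis by simp
qed

lemma (in prob_space) unit_combination_std_normal:
  fixes F :: "'i \<Rightarrow> 'a \<Rightarrow> real"
  assumes fin: "finite I" and ind: "indep_vars (\<lambda>_. borel) F I"
    and F: "\<And>i. i \<in> I \<Longrightarrow> distributed M lborel (F i) std_normal_density"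
    and c: "(\<Sum>i\<in>I. (c i)\<^sup>2) = 1"
  shows "distributed M lborel (\<lambda>w. \<Sum>i\<in>I. c i * F i w) std_normal_density"
proof -
  have [measurable]: "F i \<in> borel_measurable M" if "i \<in> I" for i using F[OF that] by (auto simp: distributed_def)
  have D: "distr M borel (F i) = std_normal_distribution" if "i \<in> I" for i
    using F[OF that] by (auto simp: distributed_def cong: distr_cong)
  have "char (distr M borel (\<lambda>w. \<Sum>i\<in>I. c i * F i w)) t = char std_normal_distribution t" for t
  proof -
    have "char (distr M borel (\<lambda>w. \<Sum>i\<in>I. c i * F i w)) t = (\<Prod>i\<in>I. char (distr M borel (\<lambda>w. c i * F i w)) t)"
      by (intro char_distr_sum indep_vars_compose2[OF ind]) auto
    also have "\<dots> = (\<Prod>i\<in>I. char std_normal_distribution (t * c i))"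
    proof (intro prod.cong refl)
      fix i assume i: "i \<in> I"
      then have [measurable]: "F i \<in> borel_measurable M" by simp
      show "char (distr M borel (\<lambda>w. c i * F i w)) t = char std_normal_distribution (t * c i)"
        unfolding D[OF i, symmetric] char_def by (subst (1 2) integral_distr) (auto simp: mult.assoc)
    qed
    also have "\<dots> = complex_of_real (\<Prod>i\<in>I. exp (- (t * c i)\<^sup>2 / 2))" by (simp add: char_std_normal_distribution)
    also have "(\<Prod>i\<in>I. exp (- (t * c i)\<^sup>2 / 2)) = exp (\<Sum>i\<in>I. - (t * c i)\<^sup>2 / 2)" using fin by (simp add: exp_sum)
    also have "(\<Sum>i\<in>I. - (t * c i)\<^sup>2 / 2) = - t\<^sup>2 / 2 * (\<Sum>i\<in>I. (c i)\<^sup>2)"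
      by (simp add: sum_distrib_left power_mult_distrib)
    finally show ?thesis using c by (simp add: char_std_normal_distribution)
  qed
  then have "distr M borel (\<lambda>w. \<Sum>i\<in>I. c i * F i w) = std_normal_distribution"
    by (intro Levy_uniqueness ext real_distribution_distr real_dist_normal_dist) auto
  then show ?thesis by (auto simp: distributed_def cong: distr_cong)
qed

text \<open>Given the variables \<open>F (k, True)\<close>, the numerator is centered normal and its variance is the square of the
  denominator.\<close>

lemma (in prob_space) self_normalized_product_tail:
  fixes F :: "nat \<times> bool \<Rightarrow> 'a \<Rightarrow> real"
  assumes n: "n > 0" and ind: "indep_vars (\<lambda>_. borel) F ({..<n} \<times> UNIV)"
    and F: "\<And>i. i \<in> {..<n} \<times> UNIV \<Longrightarrow> distributed M lborel (F i) std_normal_density"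
  shows "prob {w \<in> space M. (\<Sum>k<n. F (k, True) w * F (k, False) w) / sqrt (\<Sum>k<n. (F (k, True) w)\<^sup>2) > z} = normal_tail z"
proof -
  define A B where "A = {..<n} \<times> {True}" and "B = {..<n} \<times> {False}"
  let ?PA = "PiM A (\<lambda>_. borel :: real measure)" and ?PB = "PiM B (\<lambda>_. borel :: real measure)"
  let ?fA = "\<lambda>w. restrict (\<lambda>i. F i w) A" and ?fB = "\<lambda>w. restrict (\<lambda>i. F i w) B"
  have Fm [measurable]: "F (k, b) \<in> borel_measurable M" if "k < n" for k b using F[of "(k, b)"] that by (auto simp: distributed_def)
  have iv: "indep_var ?PA ?fA ?PB ?fB"
    using indep_var_restrict[OF ind, of A B] by (auto simp: A_def B_def)
  have [measurable]: "?fA \<in> measurable M ?PA" "?fB \<in> measurable M ?PB"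
    by (auto intro!: measurable_restrict simp: A_def B_def)
  interpret DA: prob_space "distr M ?PA ?fA" by (rule prob_space_distr) measurable
  interpret DB: prob_space "distr M ?PB ?fB" by (rule prob_space_distr) measurable
  interpret P: pair_sigma_finite "distr M ?PA ?fA" "distr M ?PB ?fB" ..
  have mA [measurable]: "(\<lambda>x. x (k, True)) \<in> borel_measurable ?PA" if "k < n" for k
    using that by (intro measurable_component_singleton) (simp add: A_def)
  have mB [measurable]: "(\<lambda>x. x (k, False)) \<in> borel_measurable ?PB" if "k < n" for k
    using that by (intro measurable_component_singleton) (simp add: B_def)
  define G where "G = {xy \<in> space (?PA \<Otimes>\<^sub>M ?PB). (\<Sum>k<n. fst xy (k, True) * snd xy (k, False)) / sqrt (\<Sum>k<n. (fst xy (k, True))\<^sup>2) > z}"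
  have memG: "(?fA w, ?fB w') \<in> G \<longleftrightarrow> (\<Sum>k<n. F (k, True) w * F (k, False) w') / sqrt (\<Sum>k<n. (F (k, True) w)\<^sup>2) > z"
    if "w \<in> space M" "w' \<in> space M" for w w'
  proof -
    have "?fA w \<in> space ?PA" "?fB w' \<in> space ?PB" using that by (auto simp: space_PiM)
    moreover have "(\<Sum>k<n. ?fA w (k, True) * ?fB w' (k, False)) = (\<Sum>k<n. F (k, True) w * F (k, False) w')"
      "(\<Sum>k<n. (?fA w (k, True))\<^sup>2) = (\<Sum>k<n. (F (k, True) w)\<^sup>2)" by (auto intro!: sum.cong simp: A_def B_def)
    ultimately show ?thesis unfolding G_def space_pair_measure mem_Collect_eq fst_conv snd_conv by simp
  qed
  have G [measurable]: "G \<in> sets (?PA \<Otimes>\<^sub>M ?PB)" unfolding G_def by measurable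
  have "emeasure M {w \<in> space M. (\<Sum>k<n. F (k, True) w * F (k, False) w) / sqrt (\<Sum>k<n. (F (k, True) w)\<^sup>2) > z}
     = emeasure (distr M (?PA \<Otimes>\<^sub>M ?PB) (\<lambda>w. (?fA w, ?fB w))) G"
  proof (subst emeasure_distr)
    show "emeasure M {w \<in> space M. (\<Sum>k<n. F (k, True) w * F (k, False) w) / sqrt (\<Sum>k<n. (F (k, True) w)\<^sup>2) > z}
      = emeasure M ((\<lambda>w. (?fA w, ?fB w)) -` G \<inter> space M)"
      by (rule arg_cong[where f="emeasure M"]) (use memG in blast)
  qed measurable
  also have "distr M (?PA \<Otimes>\<^sub>M ?PB) (\<lambda>w. (?fA w, ?fB w)) = distr M ?PA ?fA \<Otimes>\<^sub>M distr M ?PB ?fB"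
    using iv unfolding indep_var_distribution_eq by simp
  also have "emeasure (distr M ?PA ?fA \<Otimes>\<^sub>M distr M ?PB ?fB) G = (\<integral>\<^sup>+a. emeasure (distr M ?PB ?fB) (Pair a -` G) \<partial>distr M ?PA ?fA)"
    by (rule DB.emeasure_pair_measure_alt) (simp add: sets_pair_measure_cong[OF sets_distr sets_distr])
  also have "\<dots> = (\<integral>\<^sup>+w. emeasure (distr M ?PB ?fB) (Pair (?fA w) -` G) \<partial>M)"
  proof -
    have "G \<in> sets (?PA \<Otimes>\<^sub>M distr M ?PB ?fB)" using G by (simp cong: sets_pair_measure_cong)
    from DB.measurable_emeasure_Pair[OF this] have "(\<lambda>a. emeasure (distr M ?PB ?fB) (Pair a -` G)) \<in> borel_measurable ?PA" .
    then show ?thesis by (intro nn_integral_distr[OF \<open>?fA \<in> measurable M ?PA\<close>]) (simp cong: measurable_cong_sets)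
  qed
  also have "\<dots> = (\<integral>\<^sup>+w. ennreal (normal_tail z) \<partial>M)"
  proof (rule nn_integral_cong_AE)
    \<comment> \<open>One nonzero coordinate already makes the denominator positive; this is where
      \<open>n > 0\<close> enters.\<close>
    have "AE w in M. F (0, True) w \<noteq> 0"
    proof -
      have "AE x in lborel. ennreal (std_normal_density x) \<noteq> 0 \<longrightarrow> x \<noteq> 0"
        using AE_lborel_singleton[of "0::real"] by eventually_elim auto
      then have "AE x in std_normal_distribution. x \<noteq> 0" by (subst AE_density) (auto elim!: eventually_mono)
      moreover have "distr M lborel (F (0, True)) = std_normal_distribution" using F[of "(0, True)"] n by (simp add: distributed_def)
      ultimately have "AE x in distr M lborel (F (0, True)). x \<noteq> 0" by (simp only:)
      then show ?thesis using Fm[OF n] by (subst (asm) AE_distr_iff) auto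
    qed
    then show "AE w in M. emeasure (distr M ?PB ?fB) (Pair (?fA w) -` G) = ennreal (normal_tail z)"
    proof (rule AE_mp, intro AE_I2 impI)
      fix w assume ws: "w \<in> space M" and nz: "F (0, True) w \<noteq> 0"
      define q where "q = sqrt (\<Sum>k<n. (F (k, True) w)\<^sup>2)"
      have "0 < (F (0, True) w)\<^sup>2" using nz by simp
      also have "\<dots> \<le> (\<Sum>k<n. (F (k, True) w)\<^sup>2)" using n by (intro member_le_sum) auto
      finally have q: "q > 0" "q\<^sup>2 = (\<Sum>k<n. (F (k, True) w)\<^sup>2)" unfolding q_def by (auto simp: sum_nonneg)
      define c where "c i = F (fst i, True) w / q" for i :: "nat \<times> bool"
      have sB: "(\<Sum>i\<in>B. f i) = (\<Sum>k<n. f (k, False))" for f :: "_ \<Rightarrow> real"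
        unfolding B_def using sum.cartesian_product[of "\<lambda>k b. f (k, b)" "{False}" "{..<n}"] by simp
      have "(\<Sum>i\<in>B. (c i)\<^sup>2) = 1"
        unfolding sB c_def using q(1) by (simp add: power_divide sum_divide_distrib[symmetric] q(2)[symmetric])
      then have N: "distributed M lborel (\<lambda>w'. \<Sum>i\<in>B. c i * F i w') std_normal_density"
        by (intro unit_combination_std_normal indep_vars_subset[OF ind]) (auto simp: B_def F)
      have "emeasure (distr M ?PB ?fB) (Pair (?fA w) -` G) = emeasure M {w' \<in> space M. (\<Sum>i\<in>B. c i * F i w') > z}"
      proof (subst emeasure_distr)
        show "Pair (?fA w) -` G \<in> sets ?PB" using G by (rule sets_Pair1)
        have "?fB -` (Pair (?fA w) -` G) \<inter> space M = {w' \<in> space M. (\<Sum>i\<in>B. c i * F i w') > z}"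
        proof -
          have "(\<Sum>i\<in>B. c i * F i w') = (\<Sum>k<n. F (k, True) w * F (k, False) w') / q" for w'
            unfolding sB c_def sum_divide_distrib by simp
          then show ?thesis using memG[OF ws, folded q_def] by auto
        qed
        then show "emeasure M (?fB -` (Pair (?fA w) -` G) \<inter> space M) = emeasure M {w' \<in> space M. (\<Sum>i\<in>B. c i * F i w') > z}"
          by simp
      qed measurable
      then show "emeasure (distr M ?PB ?fB) (Pair (?fA w) -` G) = ennreal (normal_tail z)"
        using prob_std_normal_gt[OF N] by (simp add: emeasure_eq_measure)
    qed
  qed
  also have "\<dots> = ennreal (normal_tail z)" by (simp add: emeasure_space_1)
  finally show ?thesis by (simp add: emeasure_eq_measure normal_tail_def)
qed

context ar_sample begin

definition Z :: "nat \<Rightarrow> 'a \<Rightarrow> real" where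
  "Z i w = (\<Sum>k<n. lin (ca i (Suc i)) k w * lin (cb i (Suc i)) k w) / sqrt (chi (ca i (Suc i)) w)"

lemma Z_measurable [measurable]: "Z i \<in> borel_measurable M"
  unfolding Z_def by measurable

lemma prob_Z_gt:
  assumes "n > 0" "Suc i < p"
  shows "prob {w \<in> space M. Z i w > z} = normal_tail z"
proof -
  define \<alpha> where "\<alpha> b = (if b then ca i (Suc i) else cb i (Suc i))" for b
  have on: "bil (\<alpha> c) (\<alpha> d) = (if c = d then 1 else 0)" for c d
    using bil_ca[of i "Suc i"] bil_cb[of i "Suc i"] bil_ca_cb[of i "Suc i"] assms by (auto simp: \<alpha>_def bil_commute)
  have "indep_vars (\<lambda>_. borel) (\<lambda>(k, c). lin (\<alpha> c) k) ({..<n} \<times> UNIV)"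
    by (rule indep_orthonormal_lins) (auto simp: on)
  moreover have "distributed M lborel (lin (\<alpha> b) k) std_normal_density" if "k < n" for k b
    using on that by (intro lin_std_normal) auto
  ultimately show ?thesis using self_normalized_product_tail[OF assms(1), of "\<lambda>(k, c). lin (\<alpha> c) k" z]
    by (auto simp: Z_def chi_def \<alpha>_def[of True] \<alpha>_def[of False])
qed

end

subsection \<open>Joint exceedances\<close>

lemma exp_le_cubic_remainder: "exp (z::real) \<le> 1 + z + z\<^sup>2 / 2 + \<bar>z\<bar> ^ 3 * exp \<bar>z\<bar>"
proof -
  obtain t where t: "\<bar>t\<bar> \<le> \<bar>z\<bar>" "exp z = (\<Sum>m<3. z ^ m / fact m) + exp t / fact 3 * z ^ 3"
    using Maclaurin_exp_le[of z 3] by blast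
  have "exp t / fact 3 * z ^ 3 \<le> exp \<bar>z\<bar> * \<bar>z\<bar> ^ 3"
  proof -
    have "exp t / fact 3 * z ^ 3 \<le> \<bar>exp t / fact 3 * z ^ 3\<bar>" by (rule abs_ge_self)
    also have "\<dots> = exp t / fact 3 * \<bar>z\<bar> ^ 3" by (simp add: abs_mult power_abs)
    also have "\<dots> \<le> exp \<bar>z\<bar> * \<bar>z\<bar> ^ 3"
    proof (rule mult_right_mono)
      have "exp t / fact 3 \<le> exp t / 1" by (rule divide_left_mono) (auto simp: fact_numeral)
      also have "\<dots> \<le> exp \<bar>z\<bar>" using t by simp
      finally show "exp t / fact 3 \<le> exp \<bar>z\<bar>" .
    qed simp
    finally show ?thesis .
  qed
  then show ?thesis using t(2) by (simp add: eval_nat_numeral mult.commute)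
qed

text \<open>The constant is 48 cubed: the inequality \<open>x / 48 \<le> exp (x / 48)\<close> is
  raised to the third power.\<close>

lemma cube_le_exp: "0 \<le> x \<Longrightarrow> x ^ 3 \<le> 110592 * exp (x / 16 :: real)"
proof -
  assume x: "0 \<le> x"
  have "x / 48 \<le> exp (x / 48)" using exp_ge_add_one_self[of "x/48"] by linarith
  then have "(x / 48) ^ 3 \<le> exp (x / 48) ^ 3" using x by (intro power_mono) auto
  also have "exp (x / 48) ^ 3 = exp (x / 16)" by (simp add: exp_of_nat_mult[symmetric])
  finally show ?thesis by (simp add: power_divide)
qed

lemma exp_mean_le: "exp ((a + b) / 2) \<le> (exp a + exp b) / (2::real)"
proof -
  have "0 \<le> (exp (a / 2) - exp (b / 2))\<^sup>2" by simp
  also have "\<dots> = exp (a/2) * exp (a/2) + exp (b/2) * exp (b/2) - 2 * (exp (a / 2) * exp (b / 2))"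
    by (simp add: power2_eq_square algebra_simps)
  also have "\<dots> = exp a + exp b - 2 * exp ((a + b) / 2)" by (simp add: exp_add[symmetric] add_divide_distrib)
  finally show ?thesis by simp
qed

text \<open>The four variables may be dependent, so the moment generating function is expanded
  rather than factorized. The quadratic coefficient \<open>v / 2\<close> has to be sharp because it
  decides the power of \<open>p\<close> in the joint exceedance bound; the cubic term only has to be
  small, and its constant is twice that of \<open>cube_le_exp\<close>.\<close>

lemma (in prob_space) quadratic_form_mgf_bound:
  fixes g1 g2 g3 g4 :: "'a \<Rightarrow> real"
  assumes g: "distributed M lborel g1 std_normal_density" "distributed M lborel g2 std_normal_density"
     "distributed M lborel g3 std_normal_density" "distributed M lborel g4 std_normal_density"
    and Xi: "\<And>w. \<Xi> w = ((g1 w)\<^sup>2 - (g2 w)\<^sup>2 + (g3 w)\<^sup>2 - (g4 w)\<^sup>2) / 2"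
    and V: "integrable M (\<lambda>w. (\<Xi> w)\<^sup>2)" "expectation (\<lambda>w. (\<Xi> w)\<^sup>2) \<le> v" and s: "0 \<le> s" "s \<le> 1/16"
  shows "(\<integral>\<^sup>+w. ennreal (exp (s * \<Xi> w)) \<partial>M) \<le> ennreal (exp (s\<^sup>2 * v / 2 + 221184 * s ^ 3))"
proof -
  have [measurable]: "g1 \<in> borel_measurable M" "g2 \<in> borel_measurable M" "g3 \<in> borel_measurable M" "g4 \<in> borel_measurable M"
    using g by (auto simp: distributed_def)
  have [measurable]: "\<Xi> \<in> borel_measurable M" using Xi by (subst Xi[abs_def]) measurable
  define R where "R w = ((g1 w)\<^sup>2 + (g2 w)\<^sup>2 + (g3 w)\<^sup>2 + (g4 w)\<^sup>2) / 2" for w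
  have [measurable]: "R \<in> borel_measurable M" unfolding R_def by measurable
  have R0: "R w \<ge> 0" and XR: "\<bar>\<Xi> w\<bar> \<le> R w" for w
    unfolding R_def Xi by (auto simp: abs_le_iff)
  have sq: "integrable M (\<lambda>w. (g w)\<^sup>2)" "expectation (\<lambda>w. (g w)\<^sup>2) = 1" if "distributed M lborel g std_normal_density" for g
  proof -
    have "has_bochner_integral lborel (\<lambda>x. std_normal_density x * x\<^sup>2) 1" using std_normal_moment_even[of 1] by simp
    then have i: "integrable lborel (\<lambda>x. std_normal_density x * x\<^sup>2)" "(\<integral>x. std_normal_density x * x\<^sup>2 \<partial>lborel) = 1"
      by (auto simp: has_bochner_integral_iff)
    show "integrable M (\<lambda>w. (g w)\<^sup>2)" using distributed_integrable[OF that, of "\<lambda>x. x\<^sup>2"] i by simp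
    show "expectation (\<lambda>w. (g w)\<^sup>2) = 1" using distributed_integral[OF that, of "\<lambda>x. x\<^sup>2"] i by simp
  qed
  have iX: "integrable M \<Xi>" unfolding Xi[abs_def] using sq(1) g by auto
  have eX: "expectation \<Xi> = 0" unfolding Xi[abs_def] using sq g by simp
  let ?e = "\<lambda>g w. exp ((g w)\<^sup>2 / 4) :: real"
  have eg: "integrable M (\<lambda>w. ?e g w)" "expectation (\<lambda>w. ?e g w) \<le> 2" if "distributed M lborel g std_normal_density" for g
  proof -
    have [measurable]: "g \<in> borel_measurable M" using that by (auto simp: distributed_def)
    have n: "(\<integral>\<^sup>+w. ennreal (?e g w) \<partial>M) = ennreal (1 / sqrt (1/2))"
      using nn_integral_exp_square_normal_rv[OF that, of "1/4"] by simp
    show i: "integrable M (\<lambda>w. ?e g w)" by (rule integrableI_nonneg) (auto simp: n)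
    have "expectation (\<lambda>w. ?e g w) = 1 / sqrt (1/2)"
      using n nn_integral_eq_integral[OF i] by simp
    also have "\<dots> \<le> 2" by (simp add: real_sqrt_divide real_le_lsqrt)
    finally show "expectation (\<lambda>w. ?e g w) \<le> 2" .
  qed
  \<comment> \<open>\<open>R w / 8\<close> is the average of the four squares divided by 4, so
    convexity of the exponential reduces the estimate to the marginal laws.\<close>
  have Rb: "exp (R w / 8) \<le> (?e g1 w + ?e g2 w + ?e g3 w + ?e g4 w) / 4" for w
  proof -
    have "exp (R w / 8) = exp ((((g1 w)\<^sup>2 / 4 + (g2 w)\<^sup>2 / 4) / 2 + ((g3 w)\<^sup>2 / 4 + (g4 w)\<^sup>2 / 4) / 2) / 2)"
      unfolding R_def by (simp add: field_simps)
    also have "\<dots> \<le> (exp (((g1 w)\<^sup>2 / 4 + (g2 w)\<^sup>2 / 4) / 2) + exp (((g3 w)\<^sup>2 / 4 + (g4 w)\<^sup>2 / 4) / 2)) / 2"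
      by (rule exp_mean_le)
    also have "\<dots> \<le> ((?e g1 w + ?e g2 w) / 2 + (?e g3 w + ?e g4 w) / 2) / 2"
      by (intro divide_right_mono add_mono exp_mean_le) auto
    also have "\<dots> = (?e g1 w + ?e g2 w + ?e g3 w + ?e g4 w) / 4"
      by (simp add: field_simps)
    finally show ?thesis .
  qed
  have iR: "integrable M (\<lambda>w. exp (R w / 8))"
    by (rule Bochner_Integration.integrable_bound[where f="\<lambda>w. (?e g1 w + ?e g2 w + ?e g3 w + ?e g4 w) / 4"])
       (use eg(1) g Rb in \<open>auto intro!: AE_I2 order_trans[OF Rb]\<close>)
  have "expectation (\<lambda>w. exp (R w / 8)) \<le> expectation (\<lambda>w. (?e g1 w + ?e g2 w + ?e g3 w + ?e g4 w) / 4)"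
    using eg(1) g iR Rb by (intro integral_mono) auto
  also have "\<dots> \<le> 2" using eg(1)[OF g(1)] eg(1)[OF g(2)] eg(1)[OF g(3)] eg(1)[OF g(4)] eg(2)[OF g(1)] eg(2)[OF g(2)] eg(2)[OF g(3)] eg(2)[OF g(4)] by simp
  finally have eR: "expectation (\<lambda>w. exp (R w / 8)) \<le> 2" .
  \<comment> \<open>One factor \<open>exp (R w / 16)\<close> comes from \<open>s \<le> 1/16\<close>,
    a second one absorbs the cube of \<open>R w\<close>; together they give
    \<open>exp (R w / 8)\<close>.\<close>
  have pt: "exp (s * \<Xi> w) \<le> 1 + s * \<Xi> w + s\<^sup>2 / 2 * (\<Xi> w)\<^sup>2 + s ^ 3 * 110592 * exp (R w / 8)" for w
  proof -
    have "\<bar>s * \<Xi> w\<bar> ^ 3 * exp \<bar>s * \<Xi> w\<bar> \<le> (s ^ 3 * R w ^ 3) * exp (R w / 16)"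
    proof (rule mult_mono)
      show "\<bar>s * \<Xi> w\<bar> ^ 3 \<le> s ^ 3 * R w ^ 3"
        unfolding power_mult_distrib[symmetric] using s XR[of w] by (intro power_mono) (auto simp: abs_mult mult_left_mono)
      have "\<bar>s * \<Xi> w\<bar> \<le> 1/16 * R w" unfolding abs_mult using s XR[of w] by (intro mult_mono) auto
      then show "exp \<bar>s * \<Xi> w\<bar> \<le> exp (R w / 16)" by simp
    qed (use s R0[of w] in auto)
    also have "\<dots> \<le> (s ^ 3 * (110592 * exp (R w / 16))) * exp (R w / 16)"
      using cube_le_exp[OF R0[of w]] s by (intro mult_right_mono mult_left_mono) auto
    also have "\<dots> = s ^ 3 * 110592 * exp (R w / 8)" by (simp add: exp_add[symmetric])
    finally show ?thesis using exp_le_cubic_remainder[of "s * \<Xi> w"] by (simp add: power_mult_distrib)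
  qed
  have "(\<integral>\<^sup>+w. ennreal (exp (s * \<Xi> w)) \<partial>M) \<le> (\<integral>\<^sup>+w. ennreal (1 + s * \<Xi> w + s\<^sup>2 / 2 * (\<Xi> w)\<^sup>2 + s ^ 3 * 110592 * exp (R w / 8)) \<partial>M)"
    by (intro nn_integral_mono ennreal_leI pt)
  also have "\<dots> = ennreal (expectation (\<lambda>w. 1 + s * \<Xi> w + s\<^sup>2 / 2 * (\<Xi> w)\<^sup>2 + s ^ 3 * 110592 * exp (R w / 8)))"
    using iX V(1) iR order_trans[OF exp_ge_zero pt] by (intro nn_integral_eq_integral) auto
  also have "expectation (\<lambda>w. 1 + s * \<Xi> w + s\<^sup>2 / 2 * (\<Xi> w)\<^sup>2 + s ^ 3 * 110592 * exp (R w / 8))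
     = 1 + s\<^sup>2 / 2 * expectation (\<lambda>w. (\<Xi> w)\<^sup>2) + s ^ 3 * 110592 * expectation (\<lambda>w. exp (R w / 8))"
    using iX V(1) iR eX by (simp add: prob_space)
  also have "\<dots> \<le> 1 + (s\<^sup>2 / 2 * v + s ^ 3 * 110592 * 2)"
    using V(2) eR s mult_left_mono[OF V(2), of "s\<^sup>2/2"] mult_left_mono[OF eR, of "s ^ 3 * 110592"] by simp
  also have "\<dots> \<le> exp (s\<^sup>2 * v / 2 + 221184 * s ^ 3)"
    using exp_ge_add_one_self[of "s\<^sup>2 * v / 2 + 221184 * s ^ 3"] by simp
  finally show ?thesis by (simp add: ennreal_leI)
qed

section \<open>Moments of linear forms and the Chernoff bound for two adjacent pairs\<close>

context ar_sample begin

lemma bil_add: "bil (\<lambda>i. c i + e * d i) (\<lambda>i. c i + e * d i) = bil c c + 2 * e * bil c d + e\<^sup>2 * bil d d"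
proof -
  have "bil (\<lambda>i. c i + e * d i) (\<lambda>i. c i + e * d i) = bil c c + e * bil c d + e * bil d c + e\<^sup>2 * bil d d"
    unfolding bil_def by (simp add: sum_distrib_left sum.distrib[symmetric] algebra_simps power2_eq_square)
  then show ?thesis by (simp add: bil_commute)
qed

lemma lin_add: "lin (\<lambda>i. c i + e * d i) k w = lin c k w + e * lin d k w"
  unfolding lin_def by (simp add: sum_distrib_left sum.distrib[symmetric] algebra_simps)

text \<open>\<open>centered_gaussian_vec\<close> reads a nonpositive variance as a point mass at 0,
  hence \<open>max 0\<close>; in this form the sign of \<open>bil c c\<close> need not be known
  beforehand.\<close>

lemma lin_moments:
  assumes k: "k < n"
  shows "integrable M (\<lambda>w. (lin c k w)\<^sup>2)" "expectation (\<lambda>w. (lin c k w)\<^sup>2) = max 0 (bil c c)"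
    "integrable M (\<lambda>w. (lin c k w) ^ 4)" "expectation (\<lambda>w. (lin c k w) ^ 4) = 3 * (max 0 (bil c c))\<^sup>2"
proof -
  have [measurable]: "lin c k \<in> borel_measurable M" using k by simp
  have "integrable M (\<lambda>w. (lin c k w)\<^sup>2) \<and> expectation (\<lambda>w. (lin c k w)\<^sup>2) = max 0 (bil c c)
     \<and> integrable M (\<lambda>w. (lin c k w) ^ 4) \<and> expectation (\<lambda>w. (lin c k w) ^ 4) = 3 * (max 0 (bil c c))\<^sup>2"
  proof (cases "bil c c > 0")
    case True
    define \<sigma> where "\<sigma> = sqrt (bil c c)"
    have sp: "\<sigma> > 0" "\<sigma>\<^sup>2 = bil c c" using True by (auto simp: \<sigma>_def)
    have D: "distributed M lborel (lin c k) (normal_density 0 \<sigma>)"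
      using gauss[OF k] True unfolding centered_gaussian_vec_def Let_def
      by (auto simp: lin_def[abs_def] bil_def \<sigma>_def dest!: spec[of _ c])
    have "has_bochner_integral lborel (\<lambda>x. normal_density 0 \<sigma> x * x\<^sup>2) (bil c c)"
      using normal_moment_even[OF sp(1), of 0 1] sp by (simp add: fact_numeral)
    moreover have "has_bochner_integral lborel (\<lambda>x. normal_density 0 \<sigma> x * x ^ 4) (3 * (bil c c)\<^sup>2)"
      using normal_moment_even[OF sp(1), of 0 2] sp by (simp add: fact_numeral power_divide)
    ultimately show ?thesis
      using distributed_integrable[OF D, of "\<lambda>x. x\<^sup>2"] distributed_integral[OF D, of "\<lambda>x. x\<^sup>2"]
        distributed_integrable[OF D, of "\<lambda>x. x ^ 4"] distributed_integral[OF D, of "\<lambda>x. x ^ 4"] True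
      by (simp add: has_bochner_integral_iff)
  next
    case False
    then have "AE w in M. lin c k w = 0"
      using gauss[OF k] unfolding centered_gaussian_vec_def Let_def
      by (auto simp: lin_def[abs_def] bil_def dest!: spec[of _ c])
    then have "AE w in M. (lin c k w)\<^sup>2 = 0" "AE w in M. (lin c k w) ^ 4 = 0" by auto
    then show ?thesis using False
      integrable_cong_AE[of "\<lambda>w. (lin c k w)\<^sup>2" M "\<lambda>_. 0"] integral_cong_AE[of "\<lambda>w. (lin c k w)\<^sup>2" M "\<lambda>_. 0"]
      integrable_cong_AE[of "\<lambda>w. (lin c k w) ^ 4" M "\<lambda>_. 0"] integral_cong_AE[of "\<lambda>w. (lin c k w) ^ 4" M "\<lambda>_. 0"]
      by (simp add: max_def)
  qed
  then show "integrable M (\<lambda>w. (lin c k w)\<^sup>2)" "expectation (\<lambda>w. (lin c k w)\<^sup>2) = max 0 (bil c c)"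
    "integrable M (\<lambda>w. (lin c k w) ^ 4)" "expectation (\<lambda>w. (lin c k w) ^ 4) = 3 * (max 0 (bil c c))\<^sup>2" by auto
qed

text \<open>Isserlis' formula by polarization: fourth moments of the sum and the difference replace
  the joint law of the two forms. The Cauchy-Schwarz bound comes from second moments: those of the
  sum and the difference add up to 4, and with \<open>max 0\<close> in them this is possible only if
  the covariance lies between -1 and 1.\<close>

lemma lin_product_moment:
  assumes k: "k < n" and c: "bil c c = 1" and d: "bil d d = 1"
  shows "(bil c d)\<^sup>2 \<le> 1" "integrable M (\<lambda>w. (lin c k w)\<^sup>2 * (lin d k w)\<^sup>2)"
    "expectation (\<lambda>w. (lin c k w)\<^sup>2 * (lin d k w)\<^sup>2) = 1 + 2 * (bil c d)\<^sup>2"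
proof -
  define \<rho> where "\<rho> = bil c d"
  define cp cm where "cp = (\<lambda>i. c i + 1 * d i)" and "cm = (\<lambda>i. c i + (-1) * d i)"
  have bp: "bil cp cp = 2 + 2 * \<rho>" "bil cm cm = 2 - 2 * \<rho>"
    unfolding cp_def cm_def bil_add c d by (simp_all add: \<rho>_def)
  have lp: "lin cp k w = lin c k w + lin d k w" "lin cm k w = lin c k w - lin d k w" for w
    unfolding cp_def cm_def lin_add by simp_all
  have i4: "integrable M (\<lambda>w. (lin cp k w) ^ 4)" "integrable M (\<lambda>w. (lin cm k w) ^ 4)" "integrable M (\<lambda>w. (lin c k w) ^ 4)" "integrable M (\<lambda>w. (lin d k w) ^ 4)"
    using lin_moments(3)[OF k] by auto
  have "expectation (\<lambda>w. (lin cp k w)\<^sup>2 + (lin cm k w)\<^sup>2) = expectation (\<lambda>w. 2 * (lin c k w)\<^sup>2 + 2 * (lin d k w)\<^sup>2)"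
    unfolding lp by (intro Bochner_Integration.integral_cong) (auto simp: power2_eq_square algebra_simps)
  also have "\<dots> = 2 * expectation (\<lambda>w. (lin c k w)\<^sup>2) + 2 * expectation (\<lambda>w. (lin d k w)\<^sup>2)"
    using lin_moments(1)[OF k, of c] lin_moments(1)[OF k, of d] by simp
  also have "\<dots> = 4" unfolding lin_moments(2)[OF k] c d by simp
  also have "expectation (\<lambda>w. (lin cp k w)\<^sup>2 + (lin cm k w)\<^sup>2) = expectation (\<lambda>w. (lin cp k w)\<^sup>2) + expectation (\<lambda>w. (lin cm k w)\<^sup>2)"
    using lin_moments(1)[OF k, of cp] lin_moments(1)[OF k, of cm] by simp
  finally have "max 0 (2 + 2 * \<rho>) + max 0 (2 - 2 * \<rho>) = 4"
    unfolding lin_moments(2)[OF k] bp .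
  then have r1: "\<bar>\<rho>\<bar> \<le> 1" by (auto simp: max_def split: if_splits)
  then show "(bil c d)\<^sup>2 \<le> 1" unfolding \<rho>_def[symmetric] by (simp add: abs_square_le_1)
  have e4: "expectation (\<lambda>w. (lin cp k w) ^ 4) = 3 * (2 + 2 * \<rho>)\<^sup>2" "expectation (\<lambda>w. (lin cm k w) ^ 4) = 3 * (2 - 2 * \<rho>)\<^sup>2"
     "expectation (\<lambda>w. (lin c k w) ^ 4) = 3" "expectation (\<lambda>w. (lin d k w) ^ 4) = 3"
    unfolding lin_moments(4)[OF k] bp c d using r1 by (simp_all add: max_def)
  have e: "(lin c k w)\<^sup>2 * (lin d k w)\<^sup>2 = ((lin cp k w) ^ 4 + (lin cm k w) ^ 4 - 2 * (lin c k w) ^ 4 - 2 * (lin d k w) ^ 4) / 12" for w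
    unfolding lp by (simp add: power2_eq_square power4_eq_xxxx algebra_simps)
  show "integrable M (\<lambda>w. (lin c k w)\<^sup>2 * (lin d k w)\<^sup>2)" unfolding e using i4 by auto
  have "expectation (\<lambda>w. (lin c k w)\<^sup>2 * (lin d k w)\<^sup>2) = (3 * (2 + 2 * \<rho>)\<^sup>2 + 3 * (2 - 2 * \<rho>)\<^sup>2 - 2 * 3 - 2 * 3) / 12"
    unfolding e using i4 e4 by simp
  also have "\<dots> = 1 + 2 * \<rho>\<^sup>2" by (simp add: power2_eq_square algebra_simps)
  finally show "expectation (\<lambda>w. (lin c k w)\<^sup>2 * (lin d k w)\<^sup>2) = 1 + 2 * (bil c d)\<^sup>2" unfolding \<rho>_def .
qed

text \<open>With \<open>j = Suc (i + d)\<close> the covariance is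
  \<open>- (r ^ d * (1 - r) / 2)\<close>: normalized increments over distinct steps are never
  strongly correlated, whatever \<open>r\<close> is.\<close>

lemma bil_cv_cv_le:
  assumes "i < j" "Suc j < p"
  shows "(bil (cv i (Suc i)) (cv j (Suc j)))\<^sup>2 \<le> 1/4"
proof -
  obtain d where d: "j = Suc (i + d)" using assms(1) less_iff_Suc_add by auto
  define y where "y = 1 / sqrt (2 * (1 - r))"
  have y: "y * y = 1 / (2 * (1 - r))" using r_range unfolding y_def by simp
  have "bil (cv i (Suc i)) (cv j (Suc j)) = y * y * (r ^ Suc d - r ^ Suc (Suc d) - r ^ d + r ^ Suc d)"
  proof -
    have cv: "cv l (Suc l) = form y l (- y) (Suc l)" for l unfolding cv_def y_def by simp
    show ?thesis using assms unfolding cv d by (simp add: bil_form ar_cov_def Suc_diff_le algebra_simps)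
  qed
  also have "r ^ Suc d - r ^ Suc (Suc d) - r ^ d + r ^ Suc d = - (r ^ d * (1 - r) * (1 - r))" by (simp add: algebra_simps)
  finally have fin: "bil (cv i (Suc i)) (cv j (Suc j)) = y * y * - (r ^ d * (1 - r) * (1 - r))" .
  have "bil (cv i (Suc i)) (cv j (Suc j)) = - (r ^ d * (1 - r) / 2)"
  proof -
    have "1 / (2 * q) * - (a * q * q) = - (a * q / 2)" if "q \<noteq> 0" for a q :: real using that by simp
    note this[of "1 - r" "r ^ d"]
    then show ?thesis using fin r_range unfolding y by simp
  qed
  moreover have "r ^ d * (1 - r) \<le> 1 * 1" using r_range by (intro mult_mono power_le_one) auto
  ultimately show ?thesis using r_range by (simp add: power_divide abs_square_le_1 zero_le_mult_iff)
qed

definition Wst :: "nat \<Rightarrow> 'a \<Rightarrow> real" where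
  "Wst i w = (chi (cu i (Suc i)) w - chi (cv i (Suc i)) w) / (2 * sqrt (real n))"

lemma Wst_measurable [measurable]: "Wst i \<in> borel_measurable M"
  unfolding Wst_def by measurable

text \<open>If both statistics exceed \<open>z\<close>, their sum exceeds \<open>2 * z\<close>, and
  its variance is at most 13/4, compared with 4 for two equal statistics. \<open>\<theta>\<close> is
  the Chernoff parameter for the sum of the two \<open>Wst\<close>, and \<open>s\<close> is the same
  parameter on the scale of single rows.\<close>

lemma pair_exceedance_bound:
  assumes ij: "i < j" "Suc j < p" and n: "n > 0" and th: "0 \<le> \<theta>" "\<theta> \<le> sqrt (real n) / 16"
  shows "prob {w \<in> space M. Wst i w > z \<and> Wst j w > z} \<le> exp (- 2 * \<theta> * z + 13/8 * \<theta>\<^sup>2 + 221184 * \<theta> ^ 3 / sqrt (real n))"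
proof -
  define s where "s = \<theta> / sqrt (real n)"
  have sn: "sqrt (real n) > 0" using n by simp
  have s: "0 \<le> s" "s \<le> 1/16" using th sn by (auto simp: s_def field_simps)
  let ?u = "cu i (Suc i)" and ?v = "cv i (Suc i)" and ?u' = "cu j (Suc j)" and ?v' = "cv j (Suc j)"
  have b: "bil ?u ?u = 1" "bil ?v ?v = 1" "bil ?u' ?u' = 1" "bil ?v' ?v' = 1" "bil ?u ?v = 0" "bil ?u' ?v' = 0"
    using ij bil_cu bil_cv bil_cu_cv by auto
  let ?a = "lin ?u" and ?b = "lin ?v" and ?c = "lin ?u'" and ?d = "lin ?v'"
  define \<Xi> where "\<Xi> k w = ((?a k w)\<^sup>2 - (?b k w)\<^sup>2 + (?c k w)\<^sup>2 - (?d k w)\<^sup>2) / 2" for k w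
  have mgf: "(\<integral>\<^sup>+w. ennreal (exp (s * \<Xi> k w)) \<partial>M) \<le> ennreal (exp (s\<^sup>2 * (13/4) / 2 + 221184 * s ^ 3))" if k: "k < n" for k
  proof (rule quadratic_form_mgf_bound[where ?g1.0="lin ?u k" and ?g2.0="lin ?v k" and ?g3.0="lin ?u' k" and ?g4.0="lin ?v' k"])
    note P = lin_product_moment[OF k]
    have e: "(\<Xi> k w)\<^sup>2 = ((?a k w)^4 + (?b k w)^4 + (?c k w)^4 + (?d k w)^4
       - 2 * ((?a k w)\<^sup>2 * (?b k w)\<^sup>2) - 2 * ((?c k w)\<^sup>2 * (?d k w)\<^sup>2)
       + 2 * ((?a k w)\<^sup>2 * (?c k w)\<^sup>2) - 2 * ((?a k w)\<^sup>2 * (?d k w)\<^sup>2)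
       - 2 * ((?b k w)\<^sup>2 * (?c k w)\<^sup>2) + 2 * ((?b k w)\<^sup>2 * (?d k w)\<^sup>2)) / 4" for w
      unfolding \<Xi>_def by (simp add: power2_eq_square power4_eq_xxxx algebra_simps)
    have I: "integrable M (\<lambda>w. (?a k w)^4)" "integrable M (\<lambda>w. (?b k w)^4)" "integrable M (\<lambda>w. (?c k w)^4)" "integrable M (\<lambda>w. (?d k w)^4)"
      using lin_moments(3)[OF k] by auto
    note J = P(2)[OF b(1,2)] P(2)[OF b(3,4)] P(2)[OF b(1,3)] P(2)[OF b(1,4)] P(2)[OF b(2,3)] P(2)[OF b(2,4)]
    show "integrable M (\<lambda>w. (\<Xi> k w)\<^sup>2)" unfolding e using I J by (intro Bochner_Integration.integrable_divide Bochner_Integration.integrable_add Bochner_Integration.integrable_diff integrable_mult_right) auto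
    have "expectation (\<lambda>w. (\<Xi> k w)\<^sup>2) = (3 + 3 + 3 + 3 - 2 * (1 + 2 * (bil ?u ?v)\<^sup>2) - 2 * (1 + 2 * (bil ?u' ?v')\<^sup>2) + 2 * (1 + 2 * (bil ?u ?u')\<^sup>2)
       - 2 * (1 + 2 * (bil ?u ?v')\<^sup>2) - 2 * (1 + 2 * (bil ?v ?u')\<^sup>2) + 2 * (1 + 2 * (bil ?v ?v')\<^sup>2)) / 4"
      unfolding e using I J
      by (simp add: lin_moments(4)[OF k] P(3)[OF b(1,2)] P(3)[OF b(3,4)] P(3)[OF b(1,3)] P(3)[OF b(1,4)] P(3)[OF b(2,3)] P(3)[OF b(2,4)] b(1-4))
    also have "\<dots> \<le> 13/4"
    proof -
      \<comment> \<open>The expression equals \<open>2 + A + D - B - C\<close>. Here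
        \<open>A\<close> is the squared correlation of the two sums, bounded by Cauchy-Schwarz, and
        \<open>D\<close> that of the two differences.\<close>
      have bnd: "(3 + 3 + 3 + 3 - 2 * (1 + 2 * 0\<^sup>2) - 2 * (1 + 2 * 0\<^sup>2) + 2 * (1 + 2 * A) - 2 * (1 + 2 * B) - 2 * (1 + 2 * C) + 2 * (1 + 2 * D)) / 4 \<le> 13/4"
        if "A \<le> 1" "D \<le> 1/4" "0 \<le> B" "0 \<le> C" for A B C D :: real using that by simp
      show ?thesis unfolding b(5,6) using P(1)[OF b(1,3)] bil_cv_cv_le[OF ij] by (intro bnd) auto
    qed
    finally show "expectation (\<lambda>w. (\<Xi> k w)\<^sup>2) \<le> 13/4" .
  qed (use k b s in \<open>auto simp: \<Xi>_def intro: lin_std_normal\<close>)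
  have ind: "indep_vars (\<lambda>_. borel) (\<lambda>k w. ennreal (exp (s * \<Xi> k w))) {..<n}"
  proof -
    have "indep_vars (\<lambda>_. borel) (\<lambda>k w. (\<lambda>x. ennreal (exp (s * (((\<Sum>l<p. ?u l * x l)\<^sup>2 - (\<Sum>l<p. ?v l * x l)\<^sup>2 + (\<Sum>l<p. ?u' l * x l)\<^sup>2 - (\<Sum>l<p. ?v' l * x l)\<^sup>2) / 2)))) (restrict (X k w) {..<p})) {..<n}"
      by (rule indep_functions_of_rows) measurable
    then show ?thesis by (simp add: \<Xi>_def lin_def)
  qed
  define T where "T w = (\<Sum>k<n. \<Xi> k w)" for w
  have [measurable]: "T \<in> borel_measurable M" unfolding T_def \<Xi>_def by measurable
  have "(\<integral>\<^sup>+w. ennreal (exp (s * T w)) \<partial>M) = (\<integral>\<^sup>+w. (\<Prod>k<n. ennreal (exp (s * \<Xi> k w))) \<partial>M)"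
    by (intro nn_integral_cong) (simp add: T_def sum_distrib_left exp_sum prod_ennreal)
  also have "\<dots> = (\<Prod>k<n. \<integral>\<^sup>+w. ennreal (exp (s * \<Xi> k w)) \<partial>M)"
    by (intro indep_vars_nn_integral ind) auto
  also have "\<dots> \<le> (\<Prod>k<n. ennreal (exp (s\<^sup>2 * (13/4) / 2 + 221184 * s ^ 3)))"
    using mgf by (intro prod_mono_ennreal) auto
  also have "\<dots> = ennreal (exp (real n * (s\<^sup>2 * (13/4) / 2 + 221184 * s ^ 3)))"
    by (simp add: ennreal_power exp_of_nat_mult[symmetric])
  finally have m: "(\<integral>\<^sup>+w. ennreal (exp (s * T w)) \<partial>M) \<le> ennreal (exp (real n * (s\<^sup>2 * (13/4) / 2 + 221184 * s ^ 3)))" .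
  have TW: "T w = sqrt (real n) * (Wst i w + Wst j w)" for w
    unfolding T_def \<Xi>_def Wst_def chi_def using sn
    by (simp add: sum_divide_distrib[symmetric] sum.distrib sum_subtractf field_simps)
  have "prob {w \<in> space M. Wst i w > z \<and> Wst j w > z} \<le> prob {w \<in> space M. s * T w \<ge> s * (2 * z * sqrt (real n))}"
  proof (intro finite_measure_mono subsetI)
    fix w assume ws: "w \<in> {w \<in> space M. Wst i w > z \<and> Wst j w > z}"
    then have "sqrt (real n) * (2 * z) \<le> T w" unfolding TW using sn by (intro mult_left_mono) auto
    then have "s * (2 * z * sqrt (real n)) \<le> s * T w" using s by (intro mult_left_mono) (auto simp: mult.commute)
    then show "w \<in> {w \<in> space M. s * T w \<ge> s * (2 * z * sqrt (real n))}" using ws by simp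
  qed measurable
  also have "\<dots> \<le> exp (- s * (2 * z * sqrt (real n))) * exp (real n * (s\<^sup>2 * (13/4) / 2 + 221184 * s ^ 3))"
    by (intro exponential_markov m) auto
  also have "\<dots> = exp (- s * (2 * z * sqrt (real n)) + real n * (s\<^sup>2 * (13/4) / 2 + 221184 * s ^ 3))" by (rule exp_add[symmetric])
  also have "- s * (2 * z * sqrt (real n)) + real n * (s\<^sup>2 * (13/4) / 2 + 221184 * s ^ 3) = - 2 * \<theta> * z + 13/8 * \<theta>\<^sup>2 + 221184 * \<theta> ^ 3 / sqrt (real n)"
  proof -
    define q where "q = sqrt (real n)"
    have q: "q > 0" "real n = q * q" using sn real_sqrt_mult_self[of "real n"] by (simp_all add: q_def)
    have sq: "s * q = \<theta>" using sn by (simp add: s_def q_def)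
    have 1: "real n * s\<^sup>2 = \<theta>\<^sup>2" unfolding q(2) sq[symmetric] by (simp add: power2_eq_square)
    have 2: "real n * s ^ 3 = \<theta> ^ 3 / q" unfolding q(2) sq[symmetric] using q(1) by (simp add: power3_eq_cube)
    have 3: "s * (2 * z * q) = 2 * \<theta> * z" unfolding sq[symmetric] by simp
    have "- s * (2 * z * q) + real n * (s\<^sup>2 * (13/4) / 2 + 221184 * s ^ 3) = - (s * (2 * z * q)) + 13/8 * (real n * s\<^sup>2) + 221184 * (real n * s ^ 3)"
      by (simp add: distrib_left)
    then show ?thesis unfolding q_def[symmetric] 1 2 3 by simp
  qed
  finally show ?thesis .
qed

subsection \<open>Comparison of the statistics on the good event\<close>

lemma chi_form:
  assumes "i < p" "j < p"
  shows "chi (form a i b j) w = a\<^sup>2 * S i i w + 2 * a * b * S i j w + b\<^sup>2 * S j j w"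
  unfolding chi_def by (rule sum_lin_form_square[OF assms])

lemma chi_units: "i < p \<Longrightarrow> j < p \<Longrightarrow> chi (form 1 i 0 j) w = S i i w" "i < p \<Longrightarrow> j < p \<Longrightarrow> chi (form 0 i 1 j) w = S j j w"
  by (simp_all add: chi_form)

lemma sample_corr_S: "sample_corr n (\<lambda>k. X k w) i j = S i j w / sqrt (S i i w * S j j w)"
  unfolding sample_corr_def S_def by (simp add: power2_eq_square)

lemma pair_statsI: "i < j \<Longrightarrow> n > 0 \<Longrightarrow> pair_stats (r ^ (j - i)) (real n)"
  using pow_range by (intro pair_stats.intro) auto

text \<open>The third identity reflects that
  \<open>(u + v)\<^sup>2 / 2 - (u - v)\<^sup>2 / 2 = 2 * u * v\<close>; it lets the two chi-square
  sums of \<open>cb\<close> and \<open>ca\<close> control the cross sum \<open>H\<close>.\<close>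

lemma pair_stats_chi:
  assumes "i < j" "j < p" "n > 0"
  shows "pair_stats.U (S i i w) (S i j w) (S j j w) (r ^ (j - i)) = chi (cu i j) w"
    and "pair_stats.V (S i i w) (S i j w) (S j j w) (r ^ (j - i)) = chi (cv i j) w"
    and "pair_stats.H (S i i w) (S j j w) (r ^ (j - i)) = (chi (cb i j) w - chi (ca i j) w) / 2"
proof -
  define R where "R = r ^ (j - i)"
  have R: "0 \<le> R" "R < 1" using pow_range[OF assms(1)] by (auto simp: R_def)
  interpret pair_stats "S i i w" "S i j w" "S j j w" R "real n"
    using pair_statsI[OF assms(1,3)] by (simp add: R_def)
  have ip: "i < p" using assms by simp
  define x y where "x = 1 / sqrt (2 * (1 + R))" and "y = 1 / sqrt (2 * (1 - R))"
  have x2: "x\<^sup>2 = 1 / (2 * (1 + R))" and y2: "y\<^sup>2 = 1 / (2 * (1 - R))"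
    using R unfolding x_def y_def by (simp_all add: power_divide)
  have "chi (cu i j) w = x\<^sup>2 * S i i w + 2 * x * x * S i j w + x\<^sup>2 * S j j w"
    unfolding cu_def R_def[symmetric] x_def[symmetric] by (rule chi_form[OF ip assms(2)])
  also have "\<dots> = x\<^sup>2 * (S i i w + 2 * S i j w + S j j w)" by (simp add: power2_eq_square algebra_simps)
  finally show "pair_stats.U (S i i w) (S i j w) (S j j w) (r ^ (j - i)) = chi (cu i j) w"
    unfolding R_def[symmetric] U_def x2 by simp
  have "chi (cv i j) w = y\<^sup>2 * S i i w + 2 * y * (- y) * S i j w + (- y)\<^sup>2 * S j j w"
    unfolding cv_def R_def[symmetric] y_def[symmetric] by (rule chi_form[OF ip assms(2)])
  also have "\<dots> = y\<^sup>2 * (S i i w - 2 * S i j w + S j j w)" by (simp add: power2_eq_square algebra_simps)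
  finally show "pair_stats.V (S i i w) (S i j w) (S j j w) (r ^ (j - i)) = chi (cv i j) w"
    unfolding R_def[symmetric] V_def y2 by simp
  have s2: "(sqrt 2)\<^sup>2 = (2::real)" by simp
  have "chi (cb i j) w - chi (ca i j) w = 2 * (x * y * (S i i w - S j j w))"
    unfolding ca_def cb_def R_def[symmetric] x_def[symmetric] y_def[symmetric] chi_form[OF ip assms(2)] power_divide s2
    by (simp add: power2_eq_square field_simps)
  moreover have "x * y = 1 / (2 * sqrt (1 - R\<^sup>2))"
  proof -
    have "sqrt (2 * (1 + R)) * sqrt (2 * (1 - R)) = sqrt (2\<^sup>2 * (1 - R\<^sup>2))"
      unfolding real_sqrt_mult[symmetric] by (simp add: power2_eq_square algebra_simps)
    also have "\<dots> = 2 * sqrt (1 - R\<^sup>2)" unfolding real_sqrt_mult by simp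
    finally show ?thesis unfolding x_def y_def by simp
  qed
  ultimately show "pair_stats.H (S i i w) (S j j w) (r ^ (j - i)) = (chi (cb i j) w - chi (ca i j) w) / 2"
    unfolding R_def[symmetric] H_def by (simp add: diff_divide_distrib)
qed

lemma goodD:
  assumes "good \<epsilon> w" "i < j" "j < p"
  shows "\<bar>S i i w - real n\<bar> \<le> \<epsilon> * real n" "\<bar>S j j w - real n\<bar> \<le> \<epsilon> * real n"
    "\<bar>chi (cu i j) w - real n\<bar> \<le> \<epsilon> * real n" "\<bar>chi (cv i j) w - real n\<bar> \<le> \<epsilon> * real n"
    "\<bar>chi (ca i j) w - real n\<bar> \<le> \<epsilon> * real n" "\<bar>(chi (cb i j) w - chi (ca i j) w) / 2\<bar> \<le> \<epsilon> * real n"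
proof -
  have g: "\<bar>chi c w - real n\<bar> \<le> \<epsilon> * real n" if "c \<in> {form 1 i 0 j, form 0 i 1 j, cu i j, cv i j, ca i j, cb i j}" for c
    using assms that unfolding good_def by blast
  have ip: "i < p" using assms by simp
  show "\<bar>S i i w - real n\<bar> \<le> \<epsilon> * real n" "\<bar>S j j w - real n\<bar> \<le> \<epsilon> * real n"
    using g[of "form 1 i 0 j"] g[of "form 0 i 1 j"] by (simp_all add: chi_units[OF ip assms(3)])
  show a: "\<bar>chi (cu i j) w - real n\<bar> \<le> \<epsilon> * real n" "\<bar>chi (cv i j) w - real n\<bar> \<le> \<epsilon> * real n"
    "\<bar>chi (ca i j) w - real n\<bar> \<le> \<epsilon> * real n" by (auto intro: g)
  have "\<bar>chi (cb i j) w - real n\<bar> \<le> \<epsilon> * real n" by (auto intro: g)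
  then have "\<bar>chi (cb i j) w - chi (ca i j) w\<bar> \<le> 2 * (\<epsilon> * real n)" using a(3) by linarith
  then show "\<bar>(chi (cb i j) w - chi (ca i j) w) / 2\<bar> \<le> \<epsilon> * real n" by simp
qed

lemma pair_stats_near:
  assumes "good \<epsilon> w" "i < j" "j < p" "n > 0"
  shows "pair_stats.near (real n) \<epsilon> (pair_stats.U (S i i w) (S i j w) (S j j w) (r ^ (j - i)))"
    "pair_stats.near (real n) \<epsilon> (pair_stats.V (S i i w) (S i j w) (S j j w) (r ^ (j - i)))"
    "pair_stats.near (real n) \<epsilon> (S i i w)" "pair_stats.near (real n) \<epsilon> (S j j w)"
    "pair_stats.near (real n) \<epsilon> (chi (ca i j) w)"
    "\<bar>pair_stats.H (S i i w) (S j j w) (r ^ (j - i))\<bar> \<le> \<epsilon> * real n"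
  unfolding pair_stats.near_def[OF pair_statsI[OF assms(2,4)]] pair_stats_chi[OF assms(2,3,4)]
  using goodD[OF assms(1-3)] by auto

lemma Wst_eq_pair_W:
  assumes "Suc i < p" "n > 0"
  shows "Wst i w = pair_stats.W (S i i w) (S i (Suc i) w) (S (Suc i) (Suc i) w) r (real n)"
  unfolding Wst_def using pair_stats.W_UV[OF pair_statsI[of i "Suc i"]] pair_stats_chi(1,2)[of i "Suc i"] assms by simp

lemma Z_eq:
  assumes "Suc i < p" "n > 0"
  shows "Z i w = sqrt (real n) * Wst i w / sqrt (chi (ca i (Suc i)) w)"
proof -
  have "(\<Sum>k<n. lin (ca i (Suc i)) k w * lin (cb i (Suc i)) k w) = (\<Sum>k<n. ((lin (cu i (Suc i)) k w)\<^sup>2 - (lin (cv i (Suc i)) k w)\<^sup>2) / 2)"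
    using assms by (intro sum.cong) (auto simp: ca_cu_cv cb_cu_cv power2_eq_square algebra_simps)
  also have "\<dots> = sqrt (real n) * Wst i w"
    unfolding Wst_def chi_def using assms by (simp add: sum_subtractf sum_divide_distrib[symmetric])
  finally show ?thesis unfolding Z_def by simp
qed

lemma good_nonadjacent_corr_le:
  assumes "good \<epsilon> w" "Suc i < j" "j < p" "n > 0" "0 < \<epsilon>" "\<epsilon> \<le> 1/2" "2 * \<epsilon> \<le> r * (1 - r)"
  shows "sample_corr n (\<lambda>k. X k w) i j \<le> r"
proof -
  have ij: "i < j" using assms by simp
  have "r ^ (j - i) \<le> r ^ 2" using assms r_range by (intro power_decreasing) auto
  moreover have "r * \<epsilon> \<le> 1 * \<epsilon>" using r_range assms by (intro mult_right_mono) auto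
  ultimately have "r ^ (j - i) + \<epsilon> \<le> r * (1 - \<epsilon>)" using assms(7) by (simp add: power2_eq_square algebra_simps)
  then show ?thesis unfolding sample_corr_S
    using pair_stats.corr_le[OF pair_statsI[OF ij assms(4)] pair_stats_near(1-4)[OF assms(1) ij assms(3,4)]] assms by simp
qed

lemma good_corr_gt:
  assumes "good \<epsilon> w" "Suc i < p" "n > 0" "0 < \<epsilon>" "\<epsilon> \<le> 1/2" "0 \<le> y" "y * \<epsilon> \<le> \<eta>" "Wst i w > y + \<eta>"
  shows "sample_corr n (\<lambda>k. X k w) i (Suc i) > r + (1 - r\<^sup>2) * y / sqrt (real n)"
  unfolding sample_corr_S
  using pair_stats.corr_gt_if_W_gt[OF pair_statsI pair_stats_near(1-4)[OF assms(1), of i "Suc i"], of y \<eta> "r + (1 - r\<^sup>2) * y / sqrt (real n)"]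
    assms Wst_eq_pair_W[OF assms(2,3)] by simp

lemma good_W_gt:
  assumes "good \<epsilon> w" "Suc i < p" "n > 0" "0 < \<epsilon>" "\<epsilon> \<le> 1/2" "0 \<le> y" "y \<le> sqrt (real n)" "y * \<epsilon> + 4 * \<epsilon>\<^sup>2 * sqrt (real n) \<le> \<eta>"
    "sample_corr n (\<lambda>k. X k w) i (Suc i) > r + (1 - r\<^sup>2) * y / sqrt (real n)"
  shows "Wst i w > y - \<eta>"
  using pair_stats.W_gt_if_corr_gt[OF pair_statsI pair_stats_near(1-4)[OF assms(1), of i "Suc i"], of y \<eta> "r + (1 - r\<^sup>2) * y / sqrt (real n)"]
    assms(2-) pair_stats_near(6)[OF assms(1), of i "Suc i"] Wst_eq_pair_W[OF assms(2,3)] by (simp add: sample_corr_S)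

lemma good_W_gt_if_Z_gt:
  assumes "good \<epsilon> w" "Suc i < p" "n > 0" "0 < \<epsilon>" "\<epsilon> \<le> 1/2" "0 \<le> z" "(z + \<eta>) * \<epsilon> \<le> \<eta>" "0 \<le> \<eta>" "Z i w > z + \<eta>"
  shows "Wst i w > z"
  using pair_stats.W_gt_if_Z_gt[OF pair_statsI[of i "Suc i"] pair_stats_near(5)[OF assms(1), of i "Suc i"], where z=z and \<eta>=\<eta> and ?s11.0="S i i w" and ?s12.0="S i (Suc i) w" and ?s22.0="S (Suc i) (Suc i) w"]
    assms(2-) Wst_eq_pair_W[OF assms(2,3)] Z_eq[OF assms(2,3)] by simp

lemma good_Z_gt_if_W_gt:
  assumes "good \<epsilon> w" "Suc i < p" "n > 0" "0 < \<epsilon>" "\<epsilon> \<le> 1/2" "0 \<le> z" "z * \<epsilon> \<le> \<eta>" "Wst i w > z"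
  shows "Z i w > z - \<eta>"
  using pair_stats.Z_gt_if_W_gt[OF pair_statsI[of i "Suc i"] pair_stats_near(5)[OF assms(1), of i "Suc i"], where z=z and \<eta>=\<eta> and ?s11.0="S i i w" and ?s12.0="S i (Suc i) w" and ?s22.0="S (Suc i) (Suc i) w"]
    assms(2-) Wst_eq_pair_W[OF assms(2,3)] Z_eq[OF assms(2,3)] by simp

subsection \<open>Truncation and independence of blocks\<close>

text \<open>\<open>Xt s\<close> removes from column \<open>i\<close> its projection on column \<open>s\<close>. The last summand of \<open>Wt\<close> restores the mean that the
  truncation takes away: its size grows like \<open>\<surd>n\<close>, and \<open>n\<close> may grow arbitrarily fast compared with \<open>p\<close>.\<close>

definition Xt :: "nat \<Rightarrow> nat \<Rightarrow> 'a \<Rightarrow> nat \<Rightarrow> real" where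
  "Xt s k w i = X k w i - r ^ (i - s) * X k w s"

definition Wt :: "nat \<Rightarrow> nat \<Rightarrow> 'a \<Rightarrow> real" where
  "Wt s i w = (\<Sum>k<n. Xt s k w i * Xt s k w (Suc i) - r / 2 * ((Xt s k w i)\<^sup>2 + (Xt s k w (Suc i))\<^sup>2)) / ((1 - r\<^sup>2) * sqrt (real n))
     + sqrt (real n) * (r ^ (i - s))\<^sup>2 * r / 2"

lemma Wt_measurable [measurable]: "s < p \<Longrightarrow> Suc i < p \<Longrightarrow> Wt s i \<in> borel_measurable M"
  unfolding Wt_def Xt_def by measurable

text \<open>With \<open>b = r ^ (i - s)\<close>, the mean of the removed terms is n b (r b) - n b^2
  r / 2 = n b^2 r / 2. This is \<open>sqrt (real n)\<close> times the last summand of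
  \<open>Wt\<close>, so that only centered Gram entries remain, which are small on the good event
  even after multiplication by \<open>n\<close>-dependent scales.\<close>

lemma Wt_eq:
  assumes "s \<le> i" "Suc i < p" "n > 0"
  shows "sqrt (real n) * (Wst i w - Wt s i w) = r ^ (i - s) * (S s (Suc i) w - real n * r ^ (Suc i - s)) - (r ^ (i - s))\<^sup>2 * r / 2 * (S s s w - real n)"
proof -
  define b where "b = r ^ (i - s)"
  have b': "r ^ (Suc i - s) = r * b" using assms by (simp add: b_def Suc_diff_le)
  define q where "q = sqrt (real n)"
  have q: "q > 0" "q * q = real n" using assms by (auto simp: q_def)
  have r2: "1 - r\<^sup>2 > 0" using r_range by (simp add: abs_square_less_1)
  have pt: "Xt s k w i * Xt s k w (Suc i) - r / 2 * ((Xt s k w i)\<^sup>2 + (Xt s k w (Suc i))\<^sup>2)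
     = (X k w i * X k w (Suc i) - r / 2 * (X k w i * X k w i + X k w (Suc i) * X k w (Suc i)))
       - (1 - r\<^sup>2) * (b * (X k w s * X k w (Suc i)) - b\<^sup>2 * r / 2 * (X k w s * X k w s))" for k
    unfolding Xt_def b' b_def[symmetric] by (simp add: power2_eq_square field_simps)
  have sum: "(\<Sum>k<n. Xt s k w i * Xt s k w (Suc i) - r / 2 * ((Xt s k w i)\<^sup>2 + (Xt s k w (Suc i))\<^sup>2))
     = (S i (Suc i) w - r / 2 * (S i i w + S (Suc i) (Suc i) w)) - (1 - r\<^sup>2) * (b * S s (Suc i) w - b\<^sup>2 * r / 2 * S s s w)"
    unfolding pt S_def sum_subtractf sum.distrib sum_distrib_left[symmetric] ..
  have W: "Wst i w = (S i (Suc i) w - r / 2 * (S i i w + S (Suc i) (Suc i) w)) / ((1 - r\<^sup>2) * q)"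
    unfolding Wst_eq_pair_W[OF assms(2,3)] using pair_stats.W_def[OF pair_statsI[of i "Suc i"]] assms by (simp add: q_def)
  have "Wst i w - Wt s i w = (b * S s (Suc i) w - b\<^sup>2 * r / 2 * S s s w) / q - q * b\<^sup>2 * r / 2"
    unfolding Wt_def sum W q_def[symmetric] b_def[symmetric] using r2 by (simp add: diff_divide_distrib)
  moreover have "q * (D / q - q * e * r / 2) = D - q * q * e * r / 2" for D e
    using q(1) by (simp add: right_diff_distrib)
  ultimately have "q * (Wst i w - Wt s i w) = (b * S s (Suc i) w - b\<^sup>2 * r / 2 * S s s w) - q * q * b\<^sup>2 * r / 2"
    by (simp only:)
  then show ?thesis unfolding q_def[symmetric] b_def[symmetric] b' q(2) by (simp add: power2_eq_square field_simps)
qed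

lemma good_Wt_close:
  assumes "good \<epsilon> w" "s \<le> i" "Suc i < p" "n > 0" "0 < \<epsilon>"
  shows "\<bar>Wst i w - Wt s i w\<bar> \<le> 2 * r ^ (i - s) * \<epsilon> * sqrt (real n)"
proof -
  define b where "b = r ^ (i - s)"
  have b: "0 \<le> b" "b \<le> 1" using r_range by (auto simp: b_def power_le_one)
  define q where "q = sqrt (real n)"
  have q: "q > 0" "q * q = real n" using assms by (auto simp: q_def)
  have si: "s < Suc i" using assms by simp
  have a: "\<bar>S s (Suc i) w - real n * r ^ (Suc i - s)\<bar> \<le> \<epsilon> * real n"
    using pair_stats.s12_bounds(1)[OF pair_statsI[OF si assms(4)] pair_stats_near(1,2)[OF assms(1) si assms(3,4)]] .
  have c: "\<bar>S s s w - real n\<bar> \<le> \<epsilon> * real n" using goodD(1)[OF assms(1) si assms(3)] .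
  have "\<bar>b * (S s (Suc i) w - real n * r ^ (Suc i - s))\<bar> \<le> b * (\<epsilon> * real n)"
    unfolding abs_mult using a b by (simp add: mult_left_mono)
  moreover have "\<bar>b\<^sup>2 * r / 2 * (S s s w - real n)\<bar> \<le> b * (\<epsilon> * real n)"
  proof -
    have "b * b * r \<le> b * 1 * 1" using b r_range by (intro mult_mono) auto
    moreover have "\<bar>b\<^sup>2 * r / 2\<bar> = b * b * r / 2" using b r_range by (simp add: power2_eq_square)
    ultimately have "\<bar>b\<^sup>2 * r / 2\<bar> \<le> b" using b by linarith
    then show ?thesis unfolding abs_mult using c b by (intro mult_mono) auto
  qed
  ultimately have "\<bar>q * (Wst i w - Wt s i w)\<bar> \<le> 2 * (b * (\<epsilon> * real n))"
    using Wt_eq[OF assms(2-4), of w] unfolding q_def[symmetric] b_def[symmetric] by linarith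
  then have "q * \<bar>Wst i w - Wt s i w\<bar> \<le> q * (2 * b * \<epsilon> * q)" unfolding abs_mult q(2)[symmetric] using q(1) by (simp add: ac_simps)
  then show ?thesis using q(1) unfolding q_def[symmetric] b_def[symmetric] by (simp only: mult_le_cancel_left_pos)
qed

text \<open>Meaningful for \<open>j \<ge> 1\<close> only, because of the truncated subtraction.\<close>

definition innov :: "nat \<Rightarrow> nat \<Rightarrow> real" where
  "innov j = form (1 / sqrt (1 - r\<^sup>2)) j (- (r / sqrt (1 - r\<^sup>2))) (j - 1)"

text \<open>These are the normalized noise variables of the first-order autoregression with
  covariance \<open>ar_cov r\<close>; that the noise is orthogonal to all earlier columns is the
  Markov property of this covariance.\<close>

lemma innov_orthonormal:
  assumes "j \<in> {1..<p}" "l \<in> {1..<p}"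
  shows "bil (innov j) (innov l) = (if j = l then 1 else 0)"
proof -
  define q where "q = sqrt (1 - r\<^sup>2)"
  have r2: "1 - r\<^sup>2 > 0" using r_range by (simp add: abs_square_less_1)
  have q: "q > 0" "q * q = 1 - r\<^sup>2" using r2 by (auto simp: q_def)
  have lt: "bil (innov j) (innov l) = 0" if jl: "j < l" "1 \<le> j" "l < p" for j l
  proof -
    obtain d j' where d: "j = Suc j'" "l = Suc (Suc (j' + d))" using jl less_iff_Suc_add[of j l] by (cases j) auto
    have "bil (innov j) (innov l) = (r ^ Suc d - r * r ^ d - r * r ^ Suc (Suc d) + r * r * r ^ Suc d) / (q * q)"
      unfolding innov_def q_def[symmetric] using jl(3) unfolding d
      by (simp add: bil_form ar_cov_def Suc_diff_le diff_divide_distrib add_divide_distrib)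
    then show ?thesis by simp
  qed
  show ?thesis
  proof (cases j l rule: linorder_cases)
    case equal
    obtain j' where j': "j = Suc j'" using assms by (cases j) auto
    have "bil (innov j) (innov j) = (1 - r * r - r * r + r * r) / (q * q)"
      unfolding innov_def q_def[symmetric] using assms unfolding j'
      by (simp add: bil_form ar_cov_def diff_divide_distrib add_divide_distrib)
    then show ?thesis using equal q r2 by (simp add: power2_eq_square)
  next
    case less then show ?thesis using lt[of j l] assms by simp
  next
    case greater then show ?thesis using lt[of l j] assms by (simp add: bil_commute)
  qed
qed

text \<open>Unrolling the autoregression from column \<open>i\<close> down to \<open>s\<close>
  leaves exactly the multiple of column \<open>s\<close> that \<open>Xt\<close> subtracts, so only
  the noise after \<open>s\<close> survives.\<close>

lemma Xt_innov:
  assumes "s \<le> i" "i < p"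
  shows "Xt s k w i = sqrt (1 - r\<^sup>2) * (\<Sum>j\<in>{s<..i}. r ^ (i - j) * lin (innov j) k w)"
  using assms
proof (induction i rule: dec_induct)
  case base
  then show ?case by (simp add: Xt_def)
next
  case (step i)
  define q where "q = sqrt (1 - r\<^sup>2)"
  have q: "q > 0" using r_range by (auto simp: q_def abs_square_less_1)
  have "lin (innov (Suc i)) k w = (X k w (Suc i) - r * X k w i) / q"
    unfolding innov_def q_def[symmetric] using step by (simp add: lin_form diff_divide_distrib)
  then have "q * lin (innov (Suc i)) k w = X k w (Suc i) - r * X k w i" using q by simp
  then have "Xt s k w (Suc i) = r * Xt s k w i + q * lin (innov (Suc i)) k w"
    unfolding Xt_def using step by (simp add: Suc_diff_le algebra_simps)
  also have "\<dots> = q * ((\<Sum>j\<in>{s<..i}. r * (r ^ (i - j) * lin (innov j) k w)) + lin (innov (Suc i)) k w)"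
    using step by (simp add: q_def[symmetric] sum_distrib_left distrib_left mult.left_commute)
  also have "(\<Sum>j\<in>{s<..i}. r * (r ^ (i - j) * lin (innov j) k w)) = (\<Sum>j\<in>{s<..i}. r ^ (Suc i - j) * lin (innov j) k w)"
    by (intro sum.cong refl) (simp add: Suc_diff_le)
  also have "\<dots> + lin (innov (Suc i)) k w = (\<Sum>j\<in>{s<..Suc i}. r ^ (Suc i - j) * lin (innov j) k w)"
  proof -
    have "{s<..Suc i} = insert (Suc i) {s<..i}" using step by auto
    then show ?thesis by simp
  qed
  finally show ?case unfolding q_def .
qed

lemma block_independence:
  assumes KB: "K * B < p" and K: "K > 0"
  shows "prob {w \<in> space M. \<forall>l<K. \<forall>i\<in>{l * B + m..<l * B + B}. Wt (l * B) i w \<le> z}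
    = (\<Prod>l<K. prob {w \<in> space M. \<forall>i\<in>{l * B + m..<l * B + B}. Wt (l * B) i w \<le> z})"
proof -
  define C where "C = {1..<p}"
  define F where "F = (\<lambda>(k, c). lin (innov c) k)"
  \<comment> \<open>The left end is excluded because the projection on column \<open>l * B\<close>
    has been removed; the right end is included because \<open>Wt\<close> at the last position also
    involves column \<open>l * B + B\<close>. Consecutive blocks share that column but no
    innovation.\<close>
  define J where "J l = {..<n} \<times> {l * B<..l * B + B}" for l
  have lB: "l * B + B \<le> K * B" if "l < K" for l
  proof -
    have "Suc l * B \<le> K * B" using that by (intro mult_right_mono) auto
    then show ?thesis by simp
  qed
  have ind: "indep_vars (\<lambda>_. borel) F ({..<n} \<times> C)"
    unfolding F_def by (rule indep_orthonormal_lins) (auto simp: C_def innov_orthonormal)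
  have JI: "J l \<subseteq> {..<n} \<times> C" if "l < K" for l using lB[OF that] KB by (auto simp: J_def C_def)
  have dj: "disjoint_family_on J {..<K}"
  proof (unfold disjoint_family_on_def, intro ballI impI)
    fix l l' :: nat assume "l \<noteq> l'"
    then show "J l \<inter> J l' = {}"
    proof (rule_tac ccontr)
      assume "J l \<inter> J l' \<noteq> {}"
      then obtain j where j: "l * B < j" "j \<le> l * B + B" "l' * B < j" "j \<le> l' * B + B" by (auto simp: J_def)
      have "\<not> l < l'" 
      proof
        assume "l < l'" then have "Suc l * B \<le> l' * B" by (intro mult_right_mono) auto
        then show False using j by simp
      qed
      moreover have "\<not> l' < l"
      proof
        assume "l' < l" then have "Suc l' * B \<le> l * B" by (intro mult_right_mono) auto
        then show False using j by simp
      qed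
      ultimately show False using \<open>l \<noteq> l'\<close> by simp
    qed
  qed
  have R: "indep_vars (\<lambda>l. PiM (J l) (\<lambda>_. borel)) (\<lambda>l w. restrict (\<lambda>i. F i w) (J l)) {..<K}"
    using JI by (intro indep_vars_restrict[OF ind _ dj]) auto
  let ?P = "\<lambda>l. PiM (J l) (\<lambda>_. borel :: real measure)" and ?R = "\<lambda>l w. restrict (\<lambda>i. F i w) (J l)"
  \<comment> \<open>\<open>xt\<close> and \<open>wt\<close> are \<open>Xt\<close> and
    \<open>Wt\<close> rewritten as functions of the innovations of one block, so that independence
    of the restrictions to the sets \<open>J l\<close> applies to them.\<close>
  define xt where "xt l x k i = sqrt (1 - r\<^sup>2) * (\<Sum>j\<in>{l * B<..i}. r ^ (i - j) * x (k, j))" for l k i and x :: "nat \<times> nat \<Rightarrow> real"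
  define wt where "wt l x i = (\<Sum>k<n. xt l x k i * xt l x k (Suc i) - r / 2 * ((xt l x k i)\<^sup>2 + (xt l x k (Suc i))\<^sup>2)) / ((1 - r\<^sup>2) * sqrt (real n))
     + sqrt (real n) * (r ^ (i - l * B))\<^sup>2 * r / 2" for l i and x :: "nat \<times> nat \<Rightarrow> real"
  have xtm: "(\<lambda>x. xt l x k i) \<in> borel_measurable (?P l)" if "k < n" "i \<le> l * B + B" for l k i
    unfolding xt_def using that by (intro borel_measurable_times borel_measurable_sum measurable_const measurable_component_singleton) (auto simp: J_def)
  have wtm: "(\<lambda>x. wt l x i) \<in> borel_measurable (?P l)" if "i < l * B + B" for l i
  proof -
    have [measurable]: "(\<lambda>x. xt l x k i) \<in> borel_measurable (?P l)"
      "(\<lambda>x. xt l x k (Suc i)) \<in> borel_measurable (?P l)" if "k < n" for k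
      using xtm[of k i l] xtm[of k "Suc i" l] that \<open>i < l * B + B\<close> by auto
    show ?thesis unfolding wt_def by measurable
  qed
  define A where "A l = {x \<in> space (?P l). \<forall>i\<in>{l * B + m..<l * B + B}. wt l x i \<le> z}" for l
  have Am: "A l \<in> sets (?P l)" for l
  proof -
    have [measurable]: "{x \<in> space (?P l). wt l x i \<le> z} \<in> sets (?P l)"
      if "i \<in> {l * B + m..<l * B + B}" for i
      using wtm[of i l] that by (intro borel_measurable_le) auto
    have "A l = space (?P l) - (\<Union>i\<in>{l * B + m..<l * B + B}.
        space (?P l) - {x \<in> space (?P l). wt l x i \<le> z})"
      unfolding A_def by auto
    also have "\<dots> \<in> sets (?P l)"
      by (intro sets.Diff sets.top sets.finite_UN) auto
    finally show ?thesis .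
  qed
  have xtX: "xt l (?R l w) k i = Xt (l * B) k w i" if "l < K" "l * B \<le> i" "i \<le> l * B + B" "k < n" for l k i w
  proof -
    have "i < p" using that lB[of l] KB by linarith
    then show ?thesis unfolding Xt_innov[OF that(2) \<open>i < p\<close>] xt_def using that by (auto simp: J_def F_def intro!: sum.cong)
  qed
  have wtW: "wt l (?R l w) i = Wt (l * B) i w" if "l < K" "l * B \<le> i" "i < l * B + B" for l i w
  proof -
    have "(\<Sum>k<n. xt l (?R l w) k i * xt l (?R l w) k (Suc i)
        - r / 2 * ((xt l (?R l w) k i)\<^sup>2 + (xt l (?R l w) k (Suc i))\<^sup>2))
      = (\<Sum>k<n. Xt (l * B) k w i * Xt (l * B) k w (Suc i) - r / 2 * ((Xt (l * B) k w i)\<^sup>2 + (Xt (l * B) k w (Suc i))\<^sup>2))"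
      using that by (intro sum.cong refl) (simp add: xtX)
    then show ?thesis unfolding wt_def Wt_def by (simp only:)
  qed
  have pre: "?R l -` A l \<inter> space M = {w \<in> space M. \<forall>i\<in>{l * B + m..<l * B + B}. Wt (l * B) i w \<le> z}" if "l < K" for l
    using wtW[OF that] by (auto simp: A_def space_PiM)
  have "prob (\<Inter>l\<in>{..<K}. ?R l -` A l \<inter> space M) = (\<Prod>l<K. prob (?R l -` A l \<inter> space M))"
    using K Am by (intro indep_varsD_finite[OF R]) auto
  moreover have "(\<Inter>l\<in>{..<K}. ?R l -` A l \<inter> space M) = {w \<in> space M. \<forall>l<K. \<forall>i\<in>{l * B + m..<l * B + B}. Wt (l * B) i w \<le> z}"
    using K pre by auto
  ultimately show ?thesis using pre by simp
qed

end

subsection \<open>Gumbel asymptotics of the normal tail\<close>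

lemma normal_tail_eq_nn_integral:
  "ennreal (normal_tail z) = (\<integral>\<^sup>+x. ennreal (std_normal_density x) * indicator {z..} x \<partial>lborel)"
proof -
  interpret prob_space std_normal_distribution by (rule prob_space_normal_density) simp
  have "ennreal (normal_tail z) = emeasure std_normal_distribution {z<..}"
    unfolding normal_tail_def by (simp add: emeasure_eq_measure)
  also have "\<dots> = (\<integral>\<^sup>+x. ennreal (std_normal_density x) * indicator {z<..} x \<partial>lborel)"
    by (subst emeasure_density) auto
  also have "\<dots> = (\<integral>\<^sup>+x. ennreal (std_normal_density x) * indicator {z..} x \<partial>lborel)"
    by (intro nn_integral_cong_AE) (use AE_lborel_singleton[of z] in \<open>auto elim!: eventually_mono simp: indicator_def\<close>)
  finally show ?thesis .
qed

lemma std_normal_density_deriv: "(std_normal_density has_real_derivative - x * std_normal_density x) (at x)"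
proof -
  have "((\<lambda>x. K * exp (- x\<^sup>2 / 2)) has_real_derivative - x * (K * exp (- x\<^sup>2 / 2))) (at x)" for K
    by (auto intro!: derivative_eq_intros)
  then show ?thesis unfolding std_normal_density_def[abs_def] .
qed

lemma std_normal_density_tendsto_0: "(std_normal_density \<longlongrightarrow> 0) at_top"
  unfolding std_normal_density_def[abs_def] by real_asymp

lemma normal_tail_upper:
  assumes z: "z > 0"
  shows "normal_tail z \<le> std_normal_density z / z"
proof -
  have "ennreal z * ennreal (normal_tail z) = (\<integral>\<^sup>+x. ennreal z * (ennreal (std_normal_density x) * indicator {z..} x) \<partial>lborel)"
    unfolding normal_tail_eq_nn_integral by (rule nn_integral_cmult[symmetric]) simp
  also have "\<dots> \<le> (\<integral>\<^sup>+x. ennreal (x * std_normal_density x) * indicator {z..} x \<partial>lborel)"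
    using z by (intro nn_integral_mono) (auto simp: indicator_def ennreal_mult[symmetric] intro!: ennreal_leI mult_right_mono)
  also have "\<dots> = ennreal (0 - (- std_normal_density z))"
  proof (rule nn_integral_FTC_atLeast)
    show "DERIV (\<lambda>x. - std_normal_density x) x :> x * std_normal_density x" for x
      using std_normal_density_deriv[of x] by (auto intro!: derivative_eq_intros)
    show "((\<lambda>x. - std_normal_density x) \<longlongrightarrow> 0) at_top" using tendsto_minus[OF std_normal_density_tendsto_0] by simp
  qed (use z in auto)
  finally have "z * normal_tail z \<le> std_normal_density z" using z by (simp add: ennreal_mult[symmetric] normal_tail_def)
  then show ?thesis using z by (simp add: field_simps)
qed

text \<open>The quotient of the density by \<open>x\<close> is an antiderivative of
  \<open>- (1 + 1 / x\<^sup>2)\<close> times the density, and on \<open>{z..}\<close> this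
  coefficient is largest in size at \<open>z\<close>.\<close>

lemma normal_tail_lower:
  assumes z: "z > 0"
  shows "std_normal_density z / z \<le> (1 + 1 / z\<^sup>2) * normal_tail z"
proof -
  have "ennreal (0 - (- (std_normal_density z / z))) = (\<integral>\<^sup>+x. ennreal ((1 + 1 / x\<^sup>2) * std_normal_density x) * indicator {z..} x \<partial>lborel)"
  proof (rule nn_integral_FTC_atLeast[symmetric])
    fix x assume "z \<le> x"
    then have x: "x > 0" using z by simp
    have "DERIV (\<lambda>x. - (std_normal_density x / x)) x :> - ((- x * std_normal_density x * x - std_normal_density x * 1) / (x * x))"
      using x by (intro DERIV_minus DERIV_divide std_normal_density_deriv DERIV_ident) auto
    moreover have "- ((- x * std_normal_density x * x - std_normal_density x * 1) / (x * x)) = (1 + 1 / x\<^sup>2) * std_normal_density x"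
      using x by (simp add: field_simps power2_eq_square)
    ultimately show "DERIV (\<lambda>x. - (std_normal_density x / x)) x :> (1 + 1 / x\<^sup>2) * std_normal_density x" by simp
  next
    show "((\<lambda>x. - (std_normal_density x / x)) \<longlongrightarrow> 0) at_top"
      unfolding std_normal_density_def[abs_def] by real_asymp
  qed auto
  also have "\<dots> \<le> (\<integral>\<^sup>+x. ennreal (1 + 1 / z\<^sup>2) * (ennreal (std_normal_density x) * indicator {z..} x) \<partial>lborel)"
  proof (intro nn_integral_mono)
    fix x :: real
    show "ennreal ((1 + 1 / x\<^sup>2) * std_normal_density x) * indicator {z..} x \<le> ennreal (1 + 1 / z\<^sup>2) * (ennreal (std_normal_density x) * indicator {z..} x)"
    proof (cases "z \<le> x")
      case True
      then have "1 / x\<^sup>2 \<le> 1 / z\<^sup>2" using z by (intro divide_left_mono power_mono mult_pos_pos) auto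
      then have "(1 + 1 / x\<^sup>2) * std_normal_density x \<le> (1 + 1 / z\<^sup>2) * std_normal_density x" by (intro mult_right_mono) auto
      then show ?thesis using True by (subst mult.assoc[symmetric], subst ennreal_mult[symmetric]) (auto simp: ennreal_leI)
    qed simp
  qed
  also have "\<dots> = ennreal (1 + 1 / z\<^sup>2) * ennreal (normal_tail z)"
    unfolding normal_tail_eq_nn_integral by (rule nn_integral_cmult) simp
  also have "\<dots> = ennreal ((1 + 1 / z\<^sup>2) * normal_tail z)"
    by (rule ennreal_mult[symmetric]) (auto simp: normal_tail_def)
  finally show ?thesis using z by (subst (asm) ennreal_le_iff) (auto simp: normal_tail_def)
qed

text \<open>The threshold on the scale of \<open>W\<close>. By \<open>max_event_rescale\<close> the
  event of the theorem is an event about this level, and \<open>exp L\<close> times the normal tail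
  beyond it tends to \<open>exp (- x)\<close>.\<close>

definition gumbel_level :: "real \<Rightarrow> real \<Rightarrow> real" where
  "gumbel_level x L = (x + 2 * L - 1/2 * (ln L + ln (4 * pi))) / sqrt (2 * L)"

lemma gumbel_level_at_top: "filterlim (\<lambda>L. gumbel_level x L + c / L) at_top at_top"
  unfolding gumbel_level_def by real_asymp

lemma gumbel_level_asymp: "((\<lambda>L. (gumbel_level x L + c / L) / sqrt (2 * L)) \<longlongrightarrow> 1) at_top"
proof -
  have "((\<lambda>L. (x + 2 * L - 1/2 * (ln L + ln (4 * pi))) / (2 * L) + c / L / sqrt (2 * L)) \<longlongrightarrow> 1) at_top"
    by real_asymp
  moreover have "eventually (\<lambda>L. (x + 2 * L - 1/2 * (ln L + ln (4 * pi))) / (2 * L) + c / L / sqrt (2 * L) = (gumbel_level x L + c / L) / sqrt (2 * L)) at_top"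
    using eventually_gt_at_top[of 0] by eventually_elim (simp add: gumbel_level_def add_divide_distrib)
  ultimately show ?thesis by (rule Lim_transform_eventually)
qed

text \<open>With \<open>a = x - 1/2 * (ln L + ln (4 * pi))\<close> the level is
  \<open>(a + 2 * L) / sqrt (2 * L)\<close>, and half its square is
  \<open>L + a + a\<^sup>2 / (4 * L)\<close>. The last term vanishes, and so does the effect of the
  shift, since the level is only of order \<open>sqrt L\<close>.\<close>

lemma gumbel_level_square:
  "((\<lambda>L. L - (gumbel_level x L + c / L)\<^sup>2 / 2 + (x - 1/2 * (ln L + ln (4 * pi)))) \<longlongrightarrow> 0) at_top"
proof -
  have "((\<lambda>L. - ((x - 1/2 * (ln L + ln (4 * pi)))\<^sup>2 / (4 * L)) - gumbel_level x L * c / L - c\<^sup>2 / (2 * L\<^sup>2)) \<longlongrightarrow> - 0 - 0 - 0) at_top"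
  proof (intro tendsto_diff tendsto_minus)
    show "((\<lambda>L. (x - 1/2 * (ln L + ln (4 * pi)))\<^sup>2 / (4 * L)) \<longlongrightarrow> 0) at_top" by real_asymp
    show "((\<lambda>L. gumbel_level x L * c / L) \<longlongrightarrow> 0) at_top" unfolding gumbel_level_def by real_asymp
    show "((\<lambda>L. c\<^sup>2 / (2 * L\<^sup>2)) \<longlongrightarrow> 0) at_top" by real_asymp
  qed
  moreover have "eventually (\<lambda>L. - ((x - 1/2 * (ln L + ln (4 * pi)))\<^sup>2 / (4 * L)) - gumbel_level x L * c / L - c\<^sup>2 / (2 * L\<^sup>2)
     = L - (gumbel_level x L + c / L)\<^sup>2 / 2 + (x - 1/2 * (ln L + ln (4 * pi)))) at_top"
    using eventually_gt_at_top[of 0]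
  proof eventually_elim
    fix L :: real assume L: "L > 0"
    define a where "a = x - 1/2 * (ln L + ln (4 * pi))"
    define g where "g = gumbel_level x L"
    have g: "g = (a + 2 * L) / sqrt (2 * L)" unfolding g_def gumbel_level_def a_def by (simp add: algebra_simps)
    have "g\<^sup>2 = (a + 2 * L)\<^sup>2 / (2 * L)" unfolding g power_divide using L by simp
    then have "g\<^sup>2 / 2 = a\<^sup>2 / (4 * L) + a + L" using L by (simp add: field_simps power2_eq_square)
    moreover have "(g + c / L)\<^sup>2 / 2 = g\<^sup>2 / 2 + g * c / L + c\<^sup>2 / (2 * L\<^sup>2)" using L by (simp add: field_simps power2_eq_square)
    ultimately show "- ((x - 1/2 * (ln L + ln (4 * pi)))\<^sup>2 / (4 * L)) - gumbel_level x L * c / L - c\<^sup>2 / (2 * L\<^sup>2)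
      = L - (gumbel_level x L + c / L)\<^sup>2 / 2 + (x - 1/2 * (ln L + ln (4 * pi)))"
      unfolding a_def[symmetric] g_def[symmetric] by linarith
  qed
  ultimately show ?thesis by (auto elim: Lim_transform_eventually)
qed

text \<open>The logarithmic terms of the level produce \<open>sqrt (4 * pi * L)\<close>, which
  cancels the normalization of the density and the factor \<open>1 / z\<close> of the tail. The
  shift \<open>c\<close> does not affect the limit, which is what permits passing between the
  statistics.\<close>

lemma gumbel_tail_limit: "((\<lambda>L. exp L * normal_tail (gumbel_level x L + c / L)) \<longlongrightarrow> exp (- x)) at_top"
proof -
  define z where "z L = gumbel_level x L + c / L" for L
  define h where "h L = L - (z L)\<^sup>2 / 2 + (x - 1/2 * (ln L + ln (4 * pi)))" for L
  have h0: "(h \<longlongrightarrow> 0) at_top" unfolding h_def[abs_def] z_def by (rule gumbel_level_square)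
  have ztop: "filterlim z at_top at_top" unfolding z_def[abs_def] by (rule gumbel_level_at_top)
  have zr: "((\<lambda>L. z L / sqrt (2 * L)) \<longlongrightarrow> 1) at_top" unfolding z_def by (rule gumbel_level_asymp)
  have m: "((\<lambda>L. exp (h L) * exp (- x) * inverse (z L / sqrt (2 * L))) \<longlongrightarrow> exp 0 * exp (- x) * inverse 1) at_top"
    by (intro tendsto_intros h0 zr) auto
  have eq: "eventually (\<lambda>L. exp L * (std_normal_density (z L) / z L) = exp (h L) * exp (- x) * inverse (z L / sqrt (2 * L))) at_top"
    using eventually_gt_at_top[of 0]
  proof eventually_elim
    fix L :: real assume L: "L > 0"
    have "L - (z L)\<^sup>2 / 2 = h L - x + 1/2 * ln (4 * pi * L)" unfolding h_def using L by (simp add: ln_mult)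
    then have "exp L * exp (- (z L)\<^sup>2 / 2) = exp (h L - x + ln (sqrt (4 * pi * L)))"
      using L by (simp add: exp_add[symmetric] ln_sqrt)
    also have "\<dots> = exp (h L) * exp (- x) * sqrt (4 * pi * L)"
      unfolding exp_add exp_diff using L by (simp add: exp_minus field_simps)
    also have "sqrt (4 * pi * L) = sqrt (2 * pi) * sqrt (2 * L)" by (simp add: real_sqrt_mult[symmetric])
    finally show "exp L * (std_normal_density (z L) / z L) = exp (h L) * exp (- x) * inverse (z L / sqrt (2 * L))"
      unfolding std_normal_density_def by (simp add: field_simps)
  qed
  have up: "((\<lambda>L. exp L * (std_normal_density (z L) / z L)) \<longlongrightarrow> exp (- x)) at_top"
  proof (rule Lim_transform_eventually)
    show "((\<lambda>L. exp (h L) * exp (- x) * inverse (z L / sqrt (2 * L))) \<longlongrightarrow> exp (- x)) at_top" using m by simp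
    show "eventually (\<lambda>L. exp (h L) * exp (- x) * inverse (z L / sqrt (2 * L)) = exp L * (std_normal_density (z L) / z L)) at_top"
      using eq by eventually_elim (rule sym)
  qed
  have zi: "((\<lambda>L. 1 + 1 / (z L)\<^sup>2) \<longlongrightarrow> 1 + 0) at_top"
    by (intro tendsto_intros tendsto_divide_0[OF tendsto_const] filterlim_at_top_imp_at_infinity filterlim_pow_at_top ztop) auto
  have lo: "((\<lambda>L. exp L * (std_normal_density (z L) / z L) / (1 + 1 / (z L)\<^sup>2)) \<longlongrightarrow> exp (- x) / (1 + 0)) at_top"
    by (intro tendsto_divide up zi) auto
  have zp: "eventually (\<lambda>L. z L > 0) at_top" using ztop by (rule filterlim_at_top_dense[THEN iffD1, rule_format])
  show ?thesis unfolding z_def[symmetric]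
  proof (rule tendsto_sandwich[OF _ _ _ up])
    show "((\<lambda>L. exp L * (std_normal_density (z L) / z L) / (1 + 1 / (z L)\<^sup>2)) \<longlongrightarrow> exp (- x)) at_top" using lo by simp
    show "eventually (\<lambda>L. exp L * normal_tail (z L) \<le> exp L * (std_normal_density (z L) / z L)) at_top"
      using zp by eventually_elim (intro mult_left_mono normal_tail_upper, auto)
    show "eventually (\<lambda>L. exp L * (std_normal_density (z L) / z L) / (1 + 1 / (z L)\<^sup>2) \<le> exp L * normal_tail (z L)) at_top"
      using zp
    proof eventually_elim
      fix L assume z: "z L > 0"
      have p: "1 + 1 / (z L)\<^sup>2 > 0" by (intro add_pos_nonneg) auto
      have "exp L * (std_normal_density (z L) / z L) \<le> exp L * ((1 + 1 / (z L)\<^sup>2) * normal_tail (z L))"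
        by (intro mult_left_mono normal_tail_lower z) auto
      then have "exp L * (std_normal_density (z L) / z L) \<le> exp L * normal_tail (z L) * (1 + 1 / (z L)\<^sup>2)" by (simp only: ac_simps)
      then show "exp L * (std_normal_density (z L) / z L) / (1 + 1 / (z L)\<^sup>2) \<le> exp L * normal_tail (z L)"
        using p by (simp only: pos_divide_le_eq)
    qed
  qed
qed

subsection \<open>Sandwich by independent blocks\<close>

lemma (in prob_space) bonferroni_lower:
  assumes "finite I" "\<And>i. i \<in> I \<Longrightarrow> A i \<in> events" "0 \<le> c"
    "\<And>i j. i \<in> I \<Longrightarrow> j \<in> I \<Longrightarrow> i \<noteq> j \<Longrightarrow> prob (A i \<inter> A j) \<le> c"
  shows "prob (\<Union>i\<in>I. A i) \<ge> (\<Sum>i\<in>I. prob (A i)) - (real (card I))\<^sup>2 * c"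
  using assms
proof (induction I rule: finite_induct)
  case (insert a I)
  have m: "A a \<in> events" "(\<Union>i\<in>I. A i) \<in> events" using insert by auto
  have "prob (A a \<inter> (\<Union>i\<in>I. A i)) = prob (\<Union>i\<in>I. A a \<inter> A i)" by (rule arg_cong[where f=prob]) auto
  also have "\<dots> \<le> real (card I) * c" using insert by (intro prob_finite_UN_le) auto
  finally have 1: "prob (A a \<inter> (\<Union>i\<in>I. A i)) \<le> real (card I) * c" .
  have "prob (\<Union>i\<in>insert a I. A i) = prob (A a \<union> (\<Union>i\<in>I. A i))" by simp
  also have "\<dots> = prob (A a) + prob (\<Union>i\<in>I. A i) - prob (A a \<inter> (\<Union>i\<in>I. A i))"
    using finite_measure_Union'[OF m] finite_measure_Diff'[OF m(2,1)] by (simp add: Int_commute)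
  finally have 2: "prob (\<Union>i\<in>insert a I. A i) = prob (A a) + prob (\<Union>i\<in>I. A i) - prob (A a \<inter> (\<Union>i\<in>I. A i))" .
  have 3: "prob (\<Union>i\<in>I. A i) \<ge> (\<Sum>i\<in>I. prob (A i)) - (real (card I))\<^sup>2 * c" using insert by auto
  have "(real (card I))\<^sup>2 * c + real (card I) * c \<le> (real (card (insert a I)))\<^sup>2 * c"
  proof -
    have "(real (card I))\<^sup>2 + real (card I) \<le> (real (card (insert a I)))\<^sup>2"
      using insert by (simp add: power2_eq_square algebra_simps)
    from mult_right_mono[OF this \<open>0 \<le> c\<close>] show ?thesis by (simp add: distrib_right)
  qed
  then show ?case using 1 2 3 insert by simp
qed simp

lemma max_corr_le_iff:
  assumes "p \<ge> 2"
  shows "max_corr n p x \<le> t \<longleftrightarrow> (\<forall>i j. i < j \<and> j < p \<longrightarrow> sample_corr n x i j \<le> t)"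
proof -
  have sub: "{(i, j). i < j \<and> j < p} \<subseteq> {..<p} \<times> {..<p}" by auto
  have "finite {(i, j). i < j \<and> j < p}" by (rule finite_subset[OF sub]) simp
  moreover have "(0, 1) \<in> {(i, j). i < j \<and> j < p}" using assms by auto
  ultimately show ?thesis unfolding max_corr_def by (subst Max_le_iff) auto
qed

text \<open>\<open>\<eta>\<close> is the shift of the level \<open>y\<close> paid for each comparison; there are \<open>K\<close> blocks of length \<open>B\<close>, whose first \<open>m\<close>
  positions are discarded.\<close>

locale ar_blocks = ar_sample +
  fixes \<epsilon> \<eta> y :: real and m B K :: nat
  assumes n_pos: "n > 0" and p2: "p \<ge> 2" and eps: "0 < \<epsilon>" "\<epsilon> \<le> 1/2" "2 * \<epsilon> \<le> r * (1 - r)"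
    and eta: "0 < \<eta>" and y_ge: "4 * \<eta> \<le> y" and y_le: "y \<le> sqrt (real n)"
    and eps1: "(y + 5 * \<eta>) * \<epsilon> \<le> \<eta>" and eps2: "y * \<epsilon> + 4 * \<epsilon>\<^sup>2 * sqrt (real n) \<le> \<eta>"
    and gap: "2 * r ^ m * \<epsilon> * sqrt (real n) \<le> \<eta>"
    and KB: "K * B < p" "p \<le> K * B + B" and K: "K > 0" and mB: "m \<le> B"
begin

abbreviation "Bad \<equiv> {w \<in> space M. \<not> good \<epsilon> w}"
definition "bad = prob Bad"
definition "level = r + (1 - r\<^sup>2) * y / sqrt (real n)"
definition "I l = {l * B + m..<l * B + B}"
abbreviation "quiet l z \<equiv> {w \<in> space M. \<forall>i\<in>I l. Wt (l * B) i w \<le> z}"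
abbreviation "hit l z \<equiv> {w \<in> space M. \<exists>i\<in>I l. Wt (l * B) i w > z}"
abbreviation "all_quiet z \<equiv> {w \<in> space M. \<forall>l<K. \<forall>i\<in>I l. Wt (l * B) i w \<le> z}"
abbreviation "exceed i z \<equiv> {w \<in> space M. Z i w > z}"
abbreviation "both i j \<equiv> {w \<in> space M. Wst i w > y + 3 * \<eta> \<and> Wst j w > y + 3 * \<eta>}"
abbreviation "max_event \<equiv> {w \<in> space M. max_corr n p (\<lambda>k. X k w) \<le> level}"

lemma bad_nonneg: "bad \<ge> 0" unfolding bad_def by simp

lemma y_nonneg: "0 \<le> y" using eta y_ge by linarith

lemma eps_mult: "z \<le> y + 5 * \<eta> \<Longrightarrow> z * \<epsilon> \<le> \<eta>"
  using eps1 mult_right_mono[of z "y + 5 * \<eta>" \<epsilon>] eps by linarith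

lemma block_index: assumes "l < K" "i \<in> I l" shows "l * B \<le> i" "Suc i < p" "l * B < p" "m \<le> i - l * B"
proof -
  have "Suc l * B \<le> K * B" using assms by (intro mult_right_mono) auto
  then show "l * B \<le> i" "Suc i < p" "l * B < p" "m \<le> i - l * B" using assms KB by (auto simp: I_def)
qed

lemma level_ge: "r \<le> level"
proof -
  have "r\<^sup>2 \<le> 1" using r_range by (simp add: abs_square_le_1)
  then show ?thesis unfolding level_def using y_nonneg by simp
qed

lemma max_event_measurable [measurable]: "{w \<in> space M. max_corr n p (\<lambda>k. X k w) \<le> t} \<in> events"
proof -
  have [measurable]: "Measurable.pred M (\<lambda>w. \<forall>i<p. \<forall>j<p. i < j \<longrightarrow> S i j w / sqrt (S i i w * S j j w) \<le> t)"
    by measurable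
  have "{w \<in> space M. max_corr n p (\<lambda>k. X k w) \<le> t} = {w \<in> space M. \<forall>i<p. \<forall>j<p. i < j \<longrightarrow> S i j w / sqrt (S i i w * S j j w) \<le> t}"
    unfolding max_corr_le_iff[OF p2] sample_corr_S by (meson order_less_trans)
  then show ?thesis by simp
qed

lemma Wt_close:
  assumes "good \<epsilon> w" "l < K" "i \<in> I l" shows "\<bar>Wst i w - Wt (l * B) i w\<bar> \<le> \<eta>"
proof -
  have "\<bar>Wst i w - Wt (l * B) i w\<bar> \<le> 2 * r ^ (i - l * B) * \<epsilon> * sqrt (real n)"
    using block_index[OF assms(2,3)] by (intro good_Wt_close[OF assms(1)] n_pos eps) auto
  also have "\<dots> \<le> 2 * r ^ m * \<epsilon> * sqrt (real n)"
    using block_index(4)[OF assms(2,3)] eps r_range by (intro mult_right_mono mult_left_mono power_decreasing) auto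
  finally show ?thesis using gap by linarith
qed

lemma Wt_event_measurable [measurable]:
  assumes "l < K"
  shows "quiet l z \<in> events" "hit l z \<in> events"
proof -
  have [measurable]: "Wt (l * B) i \<in> borel_measurable M" if "i \<in> I l" for i using block_index[OF assms that] by auto
  have f: "finite (I l)" by (simp add: I_def)
  show 1: "hit l z \<in> events"
  proof -
    have "hit l z = (\<Union>i\<in>I l. {w \<in> space M. Wt (l * B) i w > z})" by auto
    then show ?thesis using f by (auto intro!: sets.finite_UN)
  qed
  have "quiet l z = space M - hit l z" by (auto simp: not_less)
  then show "quiet l z \<in> events" using 1 by auto
qed

lemma block_complement:
  assumes "l < K"
  shows "prob (quiet l z) = 1 - prob (hit l z)"
proof -
  have "quiet l z = space M - hit l z" by (auto simp: not_less)
  then show ?thesis using prob_compl[OF Wt_event_measurable(2)[OF assms]] by simp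
qed

lemma all_blocks_measurable: "all_quiet z \<in> events"
proof -
  have "all_quiet z = (\<Inter>l\<in>{..<K}. quiet l z)"
    using K by auto
  then show ?thesis using K by (auto intro!: sets.finite_INT)
qed

text \<open>Every comparison costs \<open>\<eta>\<close>: \<open>Z\<close> above
  \<open>y + 4 * \<eta>\<close> gives \<open>Wst\<close> above \<open>y + 3 * \<eta>\<close>, hence
  \<open>Wt\<close> above \<open>y + 2 * \<eta>\<close>. \<open>Z\<close> supplies the exact
  probability of one exceedance, \<open>Wst\<close> the bound for two, and \<open>Wt\<close> the
  independence of blocks.\<close>

lemma block_hit_lower:
  assumes l: "l < K" and pi2: "\<And>i j. i < j \<Longrightarrow> Suc j < p \<Longrightarrow> prob (both i j) \<le> \<pi>" and pi0: "0 \<le> \<pi>"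
  shows "prob (hit l (y + 2 * \<eta>)) \<ge> (real B - real m) * normal_tail (y + 4 * \<eta>) - (real B)\<^sup>2 * (\<pi> + bad) - bad"
proof -
  define A where "A i = exceed i (y + 4 * \<eta>)" for i
  have gW: "Wst i w > y + 3 * \<eta>" if "good \<epsilon> w" "i \<in> I l" "Z i w > y + 4 * \<eta>" for i w
    using that eps eta y_nonneg eps_mult[of "y + 4 * \<eta>"] block_index(2)[OF l]
    by (intro good_W_gt_if_Z_gt[of \<epsilon> w i "y + 3 * \<eta>" \<eta>] n_pos) (auto simp: algebra_simps)
  have pij: "prob (A i \<inter> A j) \<le> \<pi> + bad" if "i \<in> I l" "j \<in> I l" "i \<noteq> j" for i j
  proof -
    have "prob (A i \<inter> A j) \<le> prob (both i j \<union> Bad)"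
      using gW that by (intro finite_measure_mono) (auto simp: A_def)
    also have "\<dots> \<le> prob (both i j) + bad"
      unfolding bad_def by (intro measure_Un_le) auto
    also have "prob (both i j) \<le> \<pi>"
      using pi2[of i j] pi2[of j i] that block_index(2)[OF l] by (cases "i < j") (auto simp: conj_commute)
    finally show ?thesis by simp
  qed
  have cI: "real (card (I l)) = real B - real m" using mB by (simp add: I_def)
  have "(\<Sum>i\<in>I l. prob (A i)) - (real (card (I l)))\<^sup>2 * (\<pi> + bad) \<le> prob (\<Union>i\<in>I l. A i)"
    using pij pi0 bad_nonneg by (intro bonferroni_lower) (auto simp: A_def I_def)
  also have "\<dots> \<le> prob (hit l (y + 2 * \<eta>) \<union> Bad)"
  proof (intro finite_measure_mono subsetI)
    fix w assume "w \<in> (\<Union>i\<in>I l. A i)"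
    then obtain i where i: "i \<in> I l" "w \<in> space M" "Z i w > y + 4 * \<eta>" by (auto simp: A_def)
    show "w \<in> hit l (y + 2 * \<eta>) \<union> Bad"
    proof (cases "good \<epsilon> w")
      case True
      have "Wt (l * B) i w > y + 2 * \<eta>" using gW[OF True i(1,3)] Wt_close[OF True l i(1)] by linarith
      then show ?thesis using i by auto
    qed (use i in auto)
  qed (use Wt_event_measurable[OF l] in auto)
  also have "\<dots> \<le> prob (hit l (y + 2 * \<eta>)) + bad"
    unfolding bad_def using Wt_event_measurable[OF l] by (intro measure_Un_le) auto
  also have "(\<Sum>i\<in>I l. prob (A i)) = (real B - real m) * normal_tail (y + 4 * \<eta>)"
    unfolding cI[symmetric] A_def using block_index(2)[OF l] n_pos by (simp add: prob_Z_gt)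
  finally have "(real B - real m) * normal_tail (y + 4 * \<eta>) - (real (card (I l)))\<^sup>2 * (\<pi> + bad) - bad \<le> prob (hit l (y + 2 * \<eta>))"
    by linarith
  moreover have "(real (card (I l)))\<^sup>2 * (\<pi> + bad) \<le> (real B)\<^sup>2 * (\<pi> + bad)"
    using mB pi0 bad_nonneg unfolding cI by (intro mult_right_mono power_mono) auto
  ultimately show ?thesis by linarith
qed

text \<open>Only adjacent pairs inside the blocks are tested, since dropping conditions enlarges the
  event. On the good event, \<open>Wst\<close> above \<open>y + \<eta>\<close> would already push
  the sample correlation beyond \<open>level\<close>.\<close>

lemma prob_max_upper:
  assumes pi2: "\<And>i j. i < j \<Longrightarrow> Suc j < p \<Longrightarrow> prob (both i j) \<le> \<pi>" and pi0: "0 \<le> \<pi>"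
  shows "prob max_event
    \<le> bad + exp (- (real K * ((real B - real m) * normal_tail (y + 4 * \<eta>) - (real B)\<^sup>2 * (\<pi> + bad) - bad)))"
proof -
  define h where "h = (real B - real m) * normal_tail (y + 4 * \<eta>) - (real B)\<^sup>2 * (\<pi> + bad) - bad"
  have "prob max_event
    \<le> prob (Bad \<union> all_quiet (y + 2 * \<eta>))"
  proof (intro finite_measure_mono subsetI)
    fix w assume "w \<in> max_event"
    then have ws: "w \<in> space M" and le: "\<And>i j. i < j \<Longrightarrow> j < p \<Longrightarrow> sample_corr n (\<lambda>k. X k w) i j \<le> level"
      by (auto simp: max_corr_le_iff[OF p2])
    have "Wt (l * B) i w \<le> y + 2 * \<eta>" if g: "good \<epsilon> w" and li: "l < K" "i \<in> I l" for l i
    proof -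
      have "\<not> Wst i w > y + \<eta>"
        using good_corr_gt[OF g block_index(2)[OF li] n_pos eps(1,2) y_nonneg, of \<eta>] eps_mult[of y] eta
          le[of i "Suc i"] block_index(2)[OF li] by (auto simp: level_def)
      then show ?thesis using Wt_close[OF g li] by linarith
    qed
    then show "w \<in> Bad \<union> all_quiet (y + 2 * \<eta>)"
      using ws by auto
  qed (use all_blocks_measurable in auto)
  also have "\<dots> \<le> bad + prob (all_quiet (y + 2 * \<eta>))"
    unfolding bad_def using all_blocks_measurable by (intro measure_Un_le) auto
  also have "prob (all_quiet (y + 2 * \<eta>)) = (\<Prod>l<K. prob (quiet l (y + 2 * \<eta>)))"
    unfolding I_def by (rule block_independence[OF KB(1) K])
  also have "\<dots> \<le> (\<Prod>l<K. exp (- h))"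
  proof (intro prod_mono conjI)
    fix l assume "l \<in> {..<K}"
    then have l: "l < K" by simp
    have "prob (quiet l (y + 2 * \<eta>)) \<le> 1 - h"
      using block_hit_lower[OF l pi2 pi0] unfolding block_complement[OF l] h_def by linarith
    \<comment> \<open>This holds for every real \<open>h\<close>, also where the error terms make
      \<open>h\<close> negative.\<close>
    also have "\<dots> \<le> exp (- h)" using exp_ge_add_one_self[of "- h"] by simp
    finally show "prob (quiet l (y + 2 * \<eta>)) \<le> exp (- h)" .
  qed simp
  also have "\<dots> = exp (- (real K * h))" by (simp add: exp_of_nat_mult[symmetric])
  finally show ?thesis by (simp add: h_def)
qed

lemma block_hit_upper:
  assumes l: "l < K"
  shows "prob (hit l (y - 2 * \<eta>)) \<le> real B * normal_tail (y - 4 * \<eta>) + bad"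
proof -
  have "prob (hit l (y - 2 * \<eta>)) \<le> prob ((\<Union>i\<in>I l. exceed i (y - 4 * \<eta>)) \<union> Bad)"
  proof (intro finite_measure_mono subsetI)
    fix w assume "w \<in> hit l (y - 2 * \<eta>)"
    then obtain i where i: "i \<in> I l" "w \<in> space M" "Wt (l * B) i w > y - 2 * \<eta>" by auto
    have "Z i w > y - 4 * \<eta>" if g: "good \<epsilon> w"
    proof -
      have "Wst i w > y - 3 * \<eta>" using Wt_close[OF g l i(1)] i by linarith
      then show ?thesis using good_Z_gt_if_W_gt[OF g block_index(2)[OF l i(1)] n_pos eps(1,2), of "y - 3 * \<eta>" \<eta>] y_ge eta eps_mult[of "y - 3 * \<eta>"] by simp
    qed
    then show "w \<in> (\<Union>i\<in>I l. exceed i (y - 4 * \<eta>)) \<union> Bad" using i by auto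
  qed (auto simp: I_def)
  also have "\<dots> \<le> prob (\<Union>i\<in>I l. exceed i (y - 4 * \<eta>)) + bad"
    unfolding bad_def by (intro measure_Un_le) (auto simp: I_def)
  also have "prob (\<Union>i\<in>I l. exceed i (y - 4 * \<eta>)) \<le> real (card (I l)) * normal_tail (y - 4 * \<eta>)"
    using block_index(2)[OF l] n_pos by (intro prob_finite_UN_le) (auto simp: prob_Z_gt, simp add: I_def)
  also have "\<dots> \<le> real B * normal_tail (y - 4 * \<eta>)" by (intro mult_right_mono) (auto simp: I_def normal_tail_def)
  finally show ?thesis by simp
qed

text \<open>Here no pair may be ignored. Nonadjacent ones stay below \<open>r\<close> on the good
  event; an adjacent exceedance inside a block shows up as \<open>Wt\<close> above
  \<open>y - 2 * \<eta>\<close>, and one outside the blocks is paid for by a union bound over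
  \<open>Z\<close>.\<close>

lemma prob_max_lower:
  assumes h1: "real B * normal_tail (y - 4 * \<eta>) + bad \<le> 1"
  shows "prob max_event
    \<ge> (1 - (real B * normal_tail (y - 4 * \<eta>) + bad)) ^ K - bad - (real K * real m + real B) * normal_tail (y - 2 * \<eta>)"
proof -
  define h where "h = real B * normal_tail (y - 4 * \<eta>) + bad"
  \<comment> \<open>The positions in no block: the first \<open>m\<close> of every block and the
    incomplete stretch from \<open>K * B\<close> on.\<close>
  define G where "G = {i. Suc i < p \<and> (\<forall>l<K. i \<notin> I l)}"
  have Bp: "B > 0" using KB by (cases B) auto
  have Gsub: "G \<subseteq> (\<Union>l<K. {l * B..<l * B + m}) \<union> {K * B..<K * B + B}"
  proof
    fix i assume i: "i \<in> G"
    show "i \<in> (\<Union>l<K. {l * B..<l * B + m}) \<union> {K * B..<K * B + B}"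
    proof (cases "i < K * B")
      case True
      define l where "l = i div B"
      have l: "l < K" using True Bp unfolding l_def by (simp add: div_less_iff_less_mult)
      have "i = l * B + i mod B" "i mod B < B" using Bp by (auto simp: l_def)
      then have "l * B \<le> i" "i < l * B + B" by linarith+
      then have "i < l * B + m" using i l unfolding G_def I_def by force
      then show ?thesis using l \<open>l * B \<le> i\<close> by auto
    next
      case False
      then show ?thesis using i KB by (auto simp: G_def)
    qed
  qed
  have finG: "finite G" by (rule finite_subset[OF Gsub]) auto
  have "card G \<le> card ((\<Union>l<K. {l * B..<l * B + m}) \<union> {K * B..<K * B + B})" by (rule card_mono[OF _ Gsub]) auto
  also have "\<dots> \<le> card (\<Union>l<K. {l * B..<l * B + m}) + card {K * B..<K * B + B}" by (rule card_Un_le)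
  also have "card (\<Union>l<K. {l * B..<l * B + m}) \<le> (\<Sum>l<K. card {l * B..<l * B + m})" by (rule card_UN_le) simp
  finally have "card G \<le> K * m + B" by simp
  then have cG: "real (card G) \<le> real K * real m + real B"
    by (metis of_nat_add of_nat_le_iff of_nat_mult)
  have "prob (all_quiet (y - 2 * \<eta>))
    \<le> prob (max_event \<union> (Bad \<union> (\<Union>i\<in>G. exceed i (y - 2 * \<eta>))))"
  proof (intro finite_measure_mono subsetI)
    fix w assume "w \<in> all_quiet (y - 2 * \<eta>)"
    then have ws: "w \<in> space M" and le: "\<And>l i. l < K \<Longrightarrow> i \<in> I l \<Longrightarrow> Wt (l * B) i w \<le> y - 2 * \<eta>" by auto
    have "\<exists>i\<in>G. Z i w > y - 2 * \<eta>" if g: "good \<epsilon> w" and mx: "\<not> max_corr n p (\<lambda>k. X k w) \<le> level"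
    proof -
      obtain i j where ij: "i < j" "j < p" "sample_corr n (\<lambda>k. X k w) i j > level"
        using mx unfolding max_corr_le_iff[OF p2] by (auto simp: not_le)
      have j: "j = Suc i"
      proof (rule ccontr)
        assume "j \<noteq> Suc i"
        then have "sample_corr n (\<lambda>k. X k w) i j \<le> r" using ij by (intro good_nonadjacent_corr_le[OF g] n_pos eps) auto
        then show False using ij level_ge by linarith
      qed
      have ip: "Suc i < p" using ij j by simp
      have W: "Wst i w > y - \<eta>"
        using good_W_gt[OF g ip n_pos eps(1,2) y_nonneg y_le eps2] ij j by (simp add: level_def)
      have Z: "Z i w > y - 2 * \<eta>"
        using good_Z_gt_if_W_gt[OF g ip n_pos eps(1,2), of "y - \<eta>" \<eta>] W y_ge eta eps_mult[of "y - \<eta>"] by simp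
      have "i \<notin> I l" if "l < K" for l
        using le[OF that, of i] Wt_close[OF g that, of i] W by linarith
      then have "i \<in> G" using ip by (simp add: G_def)
      then show ?thesis using Z by blast
    qed
    then show "w \<in> max_event \<union> (Bad \<union> (\<Union>i\<in>G. exceed i (y - 2 * \<eta>)))"
      using ws by auto
  qed (use finG in \<open>auto intro!: sets.Un sets.finite_UN\<close>)
  also have "\<dots> \<le> prob max_event + prob (Bad \<union> (\<Union>i\<in>G. exceed i (y - 2 * \<eta>)))"
    using finG by (intro measure_Un_le) (auto intro!: sets.Un sets.finite_UN)
  also have "prob (Bad \<union> (\<Union>i\<in>G. exceed i (y - 2 * \<eta>))) \<le> bad + prob (\<Union>i\<in>G. exceed i (y - 2 * \<eta>))"
    unfolding bad_def using finG by (intro measure_Un_le) (auto intro!: sets.finite_UN)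
  also have "prob (\<Union>i\<in>G. exceed i (y - 2 * \<eta>)) \<le> real (card G) * normal_tail (y - 2 * \<eta>)"
    using finG n_pos by (intro prob_finite_UN_le) (auto simp: G_def prob_Z_gt)
  also have "\<dots> \<le> (real K * real m + real B) * normal_tail (y - 2 * \<eta>)"
    using cG by (intro mult_right_mono) (auto simp: normal_tail_def)
  finally have 1: "prob (all_quiet (y - 2 * \<eta>))
    \<le> prob max_event + (bad + (real K * real m + real B) * normal_tail (y - 2 * \<eta>))" by simp
  have "(1 - h) ^ K = (\<Prod>l<K. 1 - h)" by simp
  also have "\<dots> \<le> (\<Prod>l<K. prob (quiet l (y - 2 * \<eta>)))"
  proof (intro prod_mono conjI)
    fix l assume "l \<in> {..<K}"
    then have l: "l < K" by simp
    show "1 - h \<le> prob (quiet l (y - 2 * \<eta>))"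
      using block_hit_upper[OF l] unfolding block_complement[OF l] h_def by linarith
    show "0 \<le> 1 - h" using h1 unfolding h_def by linarith
  qed
  also have "\<dots> = prob (all_quiet (y - 2 * \<eta>))"
    unfolding I_def by (rule block_independence[OF KB(1) K, symmetric])
  finally show ?thesis using 1 unfolding h_def[symmetric] by linarith
qed

end

section \<open>Choice of the parameters in terms of \<open>ln p\<close>\<close>

context ar_sample begin

text \<open>The shift is 1 / L, the largest order used above. The assumptions \<open>big\<close> and
  \<open>bigC\<close> make the chi-square errors smaller than it, and \<open>gapr\<close> with
  \<open>ex\<close> does the same for the truncation error; \<open>blk\<close> guarantees at least
  one block.\<close>

lemma corr_blocks:
  fixes C y :: real
  defines "L \<equiv> ln (real p)"
  defines "l \<equiv> nat \<lceil>L\<rceil>"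
  assumes L1: "L \<ge> 1" and big: "2000000 * L\<^sup>2 \<le> sqrt (real n)" and bigC: "32 * L\<^sup>2 \<le> C * sqrt (real n)"
    and gapr: "C / L \<le> 1 - r" and C: "C > 0" and r_half: "1/2 \<le> r" and ylo: "4 / L \<le> y" and yhi: "y + 5 / L \<le> 2 * sqrt L"
    and ex: "16 * exp (- C * L) * sqrt L * L \<le> 1" and blk: "(L + 1) ^ 3 \<le> exp L - 1"
  shows "ar_blocks M n p r X (8 * sqrt L / sqrt (real n)) (1 / L) y (l\<^sup>2) (l ^ 3) ((p - 1) div l ^ 3)"
proof -
  define s q where "s = sqrt (real n)" and "q = sqrt L"
  have q: "q \<ge> 1" "q * q = L" using L1 by (auto simp: q_def)
  have qL: "q \<le> L" using q mult_left_mono[of 1 q q] by simp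
  have LL: "L \<le> L\<^sup>2" using L1 by (simp add: power2_eq_square)
  have s_big: "2000000 * L\<^sup>2 \<le> s" "32 * L\<^sup>2 \<le> C * s" using big bigC by (auto simp: s_def)
  have sp: "s > 0" using s_big(1) LL L1 by linarith
  have np: "n > 0" using sp by (simp add: s_def)
  have ss: "s * s = real n" by (simp add: s_def)
  have p2: "p \<ge> 2"
  proof (rule ccontr)
    assume "\<not> p \<ge> 2" then have "p = 0 \<or> p = 1" by auto
    then have "L = 0" unfolding L_def by auto
    then show False using L1 by simp
  qed
  have pL: "real p = exp L" using p2 unfolding L_def by simp
  have lL: "L \<le> real l" "real l < L + 1" "l \<ge> 1" using L1 unfolding l_def by linarith+
  have l3: "real (l ^ 3) \<le> (L + 1) ^ 3" using lL L1 by (simp add: power_mono)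
  have "real (l ^ 3) + 1 \<le> real p" using l3 blk pL by linarith
  then have Bp: "l ^ 3 \<le> p - 1" using p2 by linarith
  have B0: "l ^ 3 > 0" using lL by simp
  have e_pos: "0 < 8 * q / s" using q sp by simp
  \<comment> \<open>Applied below with \<open>c = 16\<close> and \<open>c = 272\<close>. The size of
    2000000 is due to the cubic Chernoff term in \<open>pair_bound_simplified\<close>, where
    \<open>8 * 221184 = 1769472\<close>.\<close>
  have dl: "c * L / s \<le> 1 / L" if "c \<le> 2000000" for c
  proof -
    have "c * L\<^sup>2 \<le> 2000000 * L\<^sup>2" using that by (intro mult_right_mono) auto
    also note s_big(1)
    finally have "c * L\<^sup>2 / (s * L) \<le> s / (s * L)" using sp L1 by (intro divide_right_mono) auto
    then show ?thesis using sp L1 by (simp add: power2_eq_square)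
  qed
  have eL: "a * (8 * q / s) \<le> 1 / L" if "a \<le> 2 * q" "0 \<le> a" for a
  proof -
    have "a * (8 * q / s) \<le> 2 * q * (8 * q / s)" using that e_pos by (intro mult_right_mono) auto
    also have "\<dots> = 16 * L / s" using q by simp
    also have "\<dots> \<le> 1 / L" by (rule dl) simp
    finally show ?thesis .
  qed
  have iL: "1 / L > 0" using L1 by simp
  have y0: "0 \<le> y" using ylo iL by (simp add: order_trans[rotated])
  have "5 / L \<ge> 0" using L1 by simp
  then have "y \<le> 2 * sqrt L" using yhi by linarith
  then have y2q: "y \<le> 2 * q" "y + 5 * (1 / L) \<le> 2 * q" using yhi by (simp_all add: q_def)
  show ?thesis
  proof (unfold_locales, unfold s_def[symmetric] q_def[symmetric])
    show "0 < n" "2 \<le> p" "0 < 8 * q / s" "0 < 1 / L" by fact+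
    have "16 * q \<le> 16 * L\<^sup>2" using qL LL by simp
    then show "8 * q / s \<le> 1 / 2" using s_big(1) sp by (simp add: field_simps)
    have "2 * (8 * q / s) \<le> C / L * (1/2)"
    proof -
      have "q * L \<le> L * L" using qL L1 by (intro mult_right_mono) auto
      then have "32 * (q * L) \<le> C * s" using s_big(2) by (simp add: power2_eq_square)
      then show ?thesis using sp L1 by (simp add: field_simps)
    qed
    also have "\<dots> \<le> (1 - r) * r" using gapr r_half r_range C L1 by (intro mult_mono) auto
    finally show "2 * (8 * q / s) \<le> r * (1 - r)" by (simp add: mult.commute)
    show "4 * (1 / L) \<le> y" using ylo by simp
    have "2 * q \<le> 2000000 * L\<^sup>2" using qL LL zero_le_power2[of L] by linarith
    then show "y \<le> s" using y2q(1) s_big(1) by linarith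
    show "(y + 5 * (1 / L)) * (8 * q / s) \<le> 1 / L" using y0 iL y2q(2) by (intro eL) auto
    have "4 * (8 * q / s)\<^sup>2 * s = 256 * L / s"
      using sp q(2) by (simp add: power2_eq_square)
    moreover have "y * (8 * q / s) \<le> 2 * q * (8 * q / s)" using y2q(1) e_pos by (intro mult_right_mono) auto
    moreover have "2 * q * (8 * q / s) = 16 * L / s" using q by simp
    moreover have "16 * L / s + 256 * L / s = 272 * L / s" by (simp add: add_divide_distrib[symmetric])
    moreover have "272 * L / s \<le> 1 / L" by (rule dl) simp
    ultimately show "y * (8 * q / s) + 4 * (8 * q / s)\<^sup>2 * s \<le> 1 / L" by linarith
    \<comment> \<open>Both assumptions on \<open>l\<close> and \<open>r\<close> combine here:
      \<open>l\<^sup>2 * (1 - r)\<close> is at least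
      \<open>L\<^sup>2 * (C / L) = C * L\<close>.\<close>
    have "r ^ l\<^sup>2 \<le> exp (- C * L)"
    proof -
      have "r \<le> exp (- (1 - r))" using exp_ge_add_one_self[of "- (1 - r)"] by simp
      then have "r ^ l\<^sup>2 \<le> exp (- (1 - r)) ^ l\<^sup>2" using r_range by (intro power_mono) auto
      also have "\<dots> = exp (- ((real l)\<^sup>2 * (1 - r)))" by (simp add: exp_of_nat_mult[symmetric] algebra_simps)
      also have "\<dots> \<le> exp (- (L\<^sup>2 * (C / L)))"
      proof -
        have "L\<^sup>2 * (C / L) \<le> (real l)\<^sup>2 * (1 - r)" using lL L1 gapr C by (intro mult_mono power_mono) auto
        then show ?thesis by simp
      qed
      also have "L\<^sup>2 * (C / L) = C * L" using L1 by (simp add: power2_eq_square)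
      finally show ?thesis by simp
    qed
    then have "16 * r ^ l\<^sup>2 * q \<le> 16 * exp (- C * L) * q" using q by (intro mult_right_mono) auto
    moreover have "16 * exp (- C * L) * q \<le> 1 / L" using ex L1 unfolding q_def by (simp add: field_simps)
    moreover have "2 * r ^ l\<^sup>2 * (8 * q / s) * s = 16 * r ^ l\<^sup>2 * q" using sp by simp
    ultimately show "2 * r ^ l\<^sup>2 * (8 * q / s) * s \<le> 1 / L" by linarith
    \<comment> \<open>\<open>p - 1\<close> instead of \<open>p\<close>, because the last block
      reaches up to column \<open>K * B\<close>, which must be a valid index.\<close>
    have "(p - 1) div l ^ 3 * l ^ 3 \<le> p - 1" by simp
    then show "(p - 1) div l ^ 3 * l ^ 3 < p" using p2 by linarith
    have "p - 1 = (p - 1) div l ^ 3 * l ^ 3 + (p - 1) mod l ^ 3" by (rule div_mult_mod_eq[symmetric])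
    moreover have "(p - 1) mod l ^ 3 < l ^ 3" using B0 by simp
    ultimately show "p \<le> (p - 1) div l ^ 3 * l ^ 3 + l ^ 3" using p2 by linarith
    show "0 < (p - 1) div l ^ 3" using Bp B0 by (simp add: div_greater_zero_iff)
    show "l\<^sup>2 \<le> l ^ 3" using lL by (intro power_increasing) auto
  qed
qed

text \<open>The choice \<open>\<theta> = 8 z / 13\<close> minimizes the quadratic part of the Chernoff exponent.\<close>

lemma pair_bound_simplified:
  fixes z :: real
  defines "L \<equiv> ln (real p)"
  assumes ij: "i < j" "Suc j < p" and L1: "L \<ge> 1" and big: "2000000 * L\<^sup>2 \<le> sqrt (real n)"
    and zlo: "19/10 * L \<le> z\<^sup>2" and z: "0 \<le> z" "z \<le> 2 * sqrt L"
  shows "prob {w \<in> space M. Wst i w > z \<and> Wst j w > z} \<le> exp (1 - 29/25 * L)"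
proof -
  define s q where "s = sqrt (real n)" and "q = sqrt L"
  have q: "q \<ge> 1" "q * q = L" using L1 by (auto simp: q_def)
  have qL: "q \<le> L" using q mult_left_mono[of 1 q q] by simp
  have LL: "L \<le> L\<^sup>2" using L1 by (simp add: power2_eq_square)
  have s_big: "2000000 * L\<^sup>2 \<le> s" using big by (auto simp: s_def)
  have sp: "s > 0" using s_big LL L1 by linarith
  have np: "n > 0" using sp by (simp add: s_def)
  define \<theta> where "\<theta> = 8/13 * z"
  have t: "0 \<le> \<theta>" "\<theta> \<le> 2 * q" using z q unfolding \<theta>_def q_def by auto
  have "2 * q \<le> s / 16" using s_big qL LL L1 by simp
  then have t16: "\<theta> \<le> s / 16" using t by linarith
  have "prob {w \<in> space M. Wst i w > z \<and> Wst j w > z} \<le> exp (- 2 * \<theta> * z + 13/8 * \<theta>\<^sup>2 + 221184 * \<theta> ^ 3 / s)"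
    unfolding s_def by (rule pair_exceedance_bound[OF ij np t(1)]) (use t16 in \<open>simp add: s_def\<close>)
  also have "\<dots> \<le> exp (1 - 29/25 * L)"
  proof -
    have "- 2 * \<theta> * z + 13/8 * \<theta>\<^sup>2 = - (8/13) * z\<^sup>2" unfolding \<theta>_def by (simp add: power2_eq_square)
    moreover have "\<theta> ^ 3 \<le> (2 * q) ^ 3" using t by (intro power_mono) auto
    moreover have "(2 * q) ^ 3 \<le> 8 * L\<^sup>2"
    proof -
      have "(2 * q) ^ 3 = 8 * (q * (q * q))" by (simp add: power3_eq_cube)
      also have "\<dots> = 8 * (q * L)" by (simp only: q(2))
      also have "\<dots> \<le> 8 * (L * L)" using qL L1 by (intro mult_left_mono mult_right_mono) auto
      finally show ?thesis by (simp add: power2_eq_square)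
    qed
    ultimately have "- 2 * \<theta> * z + 13/8 * \<theta>\<^sup>2 = - (8/13) * z\<^sup>2" "221184 * \<theta> ^ 3 \<le> 1769472 * L\<^sup>2" by linarith+
    moreover have "1769472 * L\<^sup>2 \<le> s" using s_big zero_le_power2[of L] by linarith
    ultimately have "221184 * \<theta> ^ 3 / s \<le> 1" "- 2 * \<theta> * z + 13/8 * \<theta>\<^sup>2 = - (8/13) * z\<^sup>2" using sp by (auto simp: divide_le_eq)
    \<comment> \<open>\<open>8/13 * 19/10 = 76/65\<close> is larger than 29/25, and 29/25 exceeds 1,
      so a joint exceedance is rarer than \<open>1 / p\<close> by a power of
      \<open>p\<close>.\<close>
    then have "- 2 * \<theta> * z + 13/8 * \<theta>\<^sup>2 + 221184 * \<theta> ^ 3 / s \<le> 1 - 29/25 * L" using zlo L1 by linarith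
    then show ?thesis by simp
  qed
  finally show ?thesis .
qed

text \<open>The factor 8 in the tolerance makes the chi-square exponent \<open>4 * L\<close>. The
  union bound over pairs takes back \<open>2 * L\<close>; what is left still tends to 0 after
  multiplication by the number of blocks, which is needed because the bad event is charged once per
  block.\<close>

lemma bad_le:
  fixes L :: real defines "L \<equiv> ln (real p)"
  assumes "p > 0" and np: "n > 0" and L0: "L > 0" and eb: "8 * sqrt L / sqrt (real n) \<le> 1/2"
  shows "prob {w \<in> space M. \<not> good (8 * sqrt L / sqrt (real n)) w} \<le> 12 * exp (- 2 * L)"
proof -
  have pL: "real p = exp L" using assms unfolding L_def by simp
  have "prob {w \<in> space M. \<not> good (8 * sqrt L / sqrt (real n)) w} \<le> 12 * (real p)\<^sup>2 * exp (- (real n * (8 * sqrt L / sqrt (real n))\<^sup>2 / 16))"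
  proof (rule prob_not_good)
    show "0 < 8 * sqrt L / sqrt (real n)" using np L0 by simp
    show "8 * sqrt L / sqrt (real n) \<le> 2" using eb by linarith
  qed
  also have "real n * (8 * sqrt L / sqrt (real n))\<^sup>2 / 16 = 4 * L" using assms by (simp add: power_divide power_mult_distrib)
  also have "12 * (real p)\<^sup>2 * exp (- (4 * L)) = 12 * exp (- 2 * L)"
    unfolding pL by (simp add: power2_eq_square exp_add[symmetric])
  finally show ?thesis .
qed

end

section \<open>Rescaling of the level and passage to the limit\<close>

lemma max_event_rescale:
  fixes L N r mx x :: real
  assumes "L > 0" "N > 0" "r\<^sup>2 < 1"
  shows "sqrt (2 * N * L) / (1 - r\<^sup>2) * mx - (r * sqrt (2 * N * L) / (1 - r\<^sup>2) + 2 * L - 1/2 * (ln L + ln (4 * pi))) \<le> x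
    \<longleftrightarrow> mx \<le> r + (1 - r\<^sup>2) * gumbel_level x L / sqrt N"
proof -
  define d where "d = 1 - r\<^sup>2"
  define a where "a = x + 2 * L - 1/2 * (ln L + ln (4 * pi))"
  define u v where "u = sqrt (2 * L)" and "v = sqrt N"
  have pos: "d > 0" "u > 0" "v > 0" using assms by (auto simp: d_def u_def v_def)
  have uv: "sqrt (2 * N * L) = u * v" unfolding u_def v_def by (simp add: real_sqrt_mult[symmetric] mult.commute mult.left_commute)
  have "u * v / d * mx - (r * (u * v) / d + 2 * L - 1/2 * (ln L + ln (4 * pi))) \<le> x \<longleftrightarrow> u * v / d * mx \<le> u * v / d * r + a"
    unfolding a_def by (auto simp: algebra_simps)
  also have "\<dots> \<longleftrightarrow> mx \<le> r + d * (a / u) / v" using pos by (simp add: field_simps)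
  finally show ?thesis unfolding uv gumbel_level_def a_def[symmetric] u_def[symmetric] v_def[symmetric] d_def[symmetric] .
qed

text \<open>Squaring turns the rate into n^(2/7), and 2/7 is below 1/2.\<close>

lemma eventually_square_le_sqrt:
  fixes L :: "nat \<Rightarrow> real"
  assumes o: "L \<in> o[sequentially](\<lambda>n. real n powr (1/7))" and A: "A > 0"
  shows "eventually (\<lambda>n. A * (L n)\<^sup>2 \<le> sqrt (real n)) sequentially"
proof -
  have "eventually (\<lambda>n. norm (L n) \<le> 1 / sqrt A * norm (real n powr (1/7))) sequentially"
    using A by (intro landau_o.smallD[OF o]) auto
  then show ?thesis using eventually_ge_at_top[of 1]
  proof eventually_elim
    fix n :: nat assume le: "norm (L n) \<le> 1 / sqrt A * norm (real n powr (1/7))" and n: "1 \<le> n"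
    have "(L n)\<^sup>2 = \<bar>L n\<bar>\<^sup>2" by simp
    also have "\<dots> \<le> (1 / sqrt A * real n powr (1/7))\<^sup>2" using le by (intro power_mono) auto
    also have "\<dots> = 1 / A * real n powr (2/7)"
      using A by (simp add: power_mult_distrib power_divide) (simp add: power2_eq_square powr_add[symmetric])
    finally have "A * (L n)\<^sup>2 \<le> A * (1 / A * real n powr (2/7))" using A by (intro mult_left_mono) auto
    also have "\<dots> = real n powr (2/7)" using A by simp
    also have "\<dots> \<le> real n powr (1/2)" using n by (intro powr_mono) auto
    finally show "A * (L n)\<^sup>2 \<le> sqrt (real n)" using n by (simp add: powr_half_sqrt)
  qed
qed

text \<open>The exponent is grouped into \<open>real K * h\<close> and \<open>h\<close> because the
  limits of these two quantities are what is available later.\<close>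

lemma power_one_minus_ge_exp:
  assumes "0 \<le> h" "h \<le> 1/2"
  shows "exp (- (real K * h + 2 * (real K * h) * h)) \<le> (1 - h) ^ K"
proof -
  have "- h - 2 * h\<^sup>2 \<le> ln (1 - h)" using ln_one_minus_pos_lower_bound[OF assms] .
  then have "exp (- h - 2 * h\<^sup>2) \<le> 1 - h" using assms by (simp add: ln_ge_iff)
  then have "exp (- h - 2 * h\<^sup>2) ^ K \<le> (1 - h) ^ K" by (intro power_mono) auto
  moreover have "exp (- h - 2 * h\<^sup>2) ^ K = exp (- (real K * h + 2 * (real K * h) * h))"
    unfolding exp_of_nat_mult[symmetric] by (simp add: algebra_simps power2_eq_square)
  ultimately show ?thesis by simp
qed

theorem theorem3:
  fixes M :: "nat \<Rightarrow> 'a measure"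
    and X :: "nat \<Rightarrow> nat \<Rightarrow> 'a \<Rightarrow> nat \<Rightarrow> real"
    and p :: "nat \<Rightarrow> nat" and r :: "nat \<Rightarrow> real"
  assumes prob: "\<And>n. prob_space (M n)"
    and gauss: "\<And>n k. k < n \<Longrightarrow> centered_gaussian_vec (M n) (p n) (ar_cov (r n)) (X n k)"
    and indep: "\<And>n. prob_space.indep_vars (M n) (\<lambda>_. PiM {..<p n} (\<lambda>_. borel))
                  (\<lambda>k \<omega>. restrict (X n k \<omega>) {..<p n}) {..<n}"
    and r_range: "\<And>n. 0 \<le> r n \<and> r n < 1"
    and p_lim: "filterlim (\<lambda>n. real (p n)) at_top sequentially"
    and log_p: "(\<lambda>n. ln (real (p n))) \<in> o[sequentially](\<lambda>n. real n powr (1/7))"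
    and r_lim: "r \<longlonglongrightarrow> 1"
    and r_gap: "\<exists>C>0. eventually (\<lambda>n. 1 - r n \<ge> C / ln (real (p n))) sequentially"
  shows "\<forall>x::real.
     (\<lambda>n. measure (M n)
        {\<omega> \<in> space (M n).
           (sqrt (2 * real n * ln (real (p n))) / (1 - (r n)\<^sup>2))
             * max_corr n (p n) (\<lambda>k. X n k \<omega>)
           - (r n * sqrt (2 * real n * ln (real (p n))) / (1 - (r n)\<^sup>2)
              + 2 * ln (real (p n))
              - (1/2) * (ln (ln (real (p n))) + ln (4 * pi)))
           \<le> x})
     \<longlonglongrightarrow> exp (- exp (- x))"
proof
  fix x :: real
  let ?E = "\<lambda>n. measure (M n) {\<omega> \<in> space (M n). (sqrt (2 * real n * ln (real (p n))) / (1 - (r n)\<^sup>2)) * max_corr n (p n) (\<lambda>k. X n k \<omega>)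
           - (r n * sqrt (2 * real n * ln (real (p n))) / (1 - (r n)\<^sup>2) + 2 * ln (real (p n)) - (1/2) * (ln (ln (real (p n))) + ln (4 * pi))) \<le> x}"
  define L where "L n = ln (real (p n))" for n
  define l where "l n = nat \<lceil>L n\<rceil>" for n
  define m B where "m n = (l n)\<^sup>2" and "B n = l n ^ 3" for n
  define K where "K n = (p n - 1) div B n" for n
  define y where "y n = gumbel_level x (L n)" for n
  define \<epsilon> where "\<epsilon> n = 8 * sqrt (L n) / sqrt (real n)" for n
  define \<delta> where "\<delta> n = measure (M n) {\<omega> \<in> space (M n). \<not> ar_sample.good n (p n) (r n) (X n) (\<epsilon> n) \<omega>}" for n
  define P where "P n = measure (M n) {\<omega> \<in> space (M n). max_corr n (p n) (\<lambda>k. X n k \<omega>) \<le> r n + (1 - (r n)\<^sup>2) * y n / sqrt (real n)}" for n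
  define t where "t c n = normal_tail (y n + c / L n)" for c n
  let ?pp = "\<lambda>n. (real (B n))\<^sup>2 * (exp (1 - 29/25 * L n) + \<delta> n)"
  have sample: "ar_sample (M n) n (p n) (r n) (X n)" for n
    using prob gauss indep r_range unfolding ar_sample_def ar_sample_axioms_def by blast
  obtain C where C: "C > 0" "eventually (\<lambda>n. 1 - r n \<ge> C / L n) sequentially" using r_gap by (auto simp: L_def)
  have L_top: "filterlim L at_top sequentially"
    unfolding L_def by (rule filterlim_compose[OF ln_at_top p_lim])
  have evL: "eventually (\<lambda>n. Q (L n)) sequentially" if "eventually Q at_top" for Q
    using filterlim_iff[THEN iffD1, OF L_top] that by blast
  have limL: "(\<lambda>n. f (L n)) \<longlonglongrightarrow> a" if "(f \<longlongrightarrow> a) at_top" for f :: "real \<Rightarrow> real" and a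
    using filterlim_compose[OF that L_top] .
  have Lsmall: "L \<in> o[sequentially](\<lambda>n. real n powr (1/7))" using log_p by (simp add: L_def[abs_def])
  have lev: "eventually (\<lambda>L. a * sqrt (2 * L) \<le> gumbel_level x L + c / L \<and> gumbel_level x L + c / L \<le> b * sqrt (2 * L)) at_top"
    if "a < 1" "1 < b" for a b c
    using order_tendstoD(1)[OF gumbel_level_asymp that(1), of x c] order_tendstoD(2)[OF gumbel_level_asymp that(2), of x c] eventually_gt_at_top[of 0]
    by eventually_elim (simp add: field_simps)
  have "eventually (\<lambda>n. L n \<ge> 1 \<and> 2000000 * (L n)\<^sup>2 \<le> sqrt (real n) \<and> 32 * (L n)\<^sup>2 \<le> C * sqrt (real n) \<and> C / L n \<le> 1 - r n \<and> 1/2 \<le> r n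
     \<and> 4 / L n \<le> y n \<and> y n + 5 / L n \<le> 2 * sqrt (L n) \<and> 16 * exp (- C * L n) * sqrt (L n) * L n \<le> 1
     \<and> (L n + 1) ^ 3 \<le> exp (L n) - 1 \<and> 19/10 * L n \<le> (y n + 3 / L n)\<^sup>2 \<and> 0 \<le> y n + 3 / L n) sequentially"
  proof -
    have 1: "eventually (\<lambda>n. 32 / C * (L n)\<^sup>2 \<le> sqrt (real n)) sequentially"
      using C by (intro eventually_square_le_sqrt[OF Lsmall]) auto
    have 2: "eventually (\<lambda>n. 2000000 * (L n)\<^sup>2 \<le> sqrt (real n)) sequentially"
      by (intro eventually_square_le_sqrt[OF Lsmall]) auto
    have 3: "eventually (\<lambda>n. 1/2 \<le> r n) sequentially"
      using order_tendstoD(1)[OF r_lim, of "1/2"] by (auto elim: eventually_mono)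
    have 4: "eventually (\<lambda>n. L n \<ge> 1) sequentially" by (rule evL) (rule eventually_ge_at_top)
    have 5: "eventually (\<lambda>n. 4 / L n \<le> y n) sequentially"
    proof -
      have "eventually (\<lambda>L. gumbel_level x L + (-4) / L \<ge> 0) at_top"
        using gumbel_level_at_top[of x "-4"] unfolding filterlim_at_top by blast
      from evL[OF this] show ?thesis by (simp add: y_def)
    qed
    have 6: "eventually (\<lambda>n. y n + 5 / L n \<le> 2 * sqrt (L n)) sequentially"
    proof -
      have "sqrt 2 > (1::real)" by simp
      from evL[OF lev[OF _ this, of 0 5]] show ?thesis by (auto elim!: eventually_mono simp: y_def real_sqrt_mult mult.assoc[symmetric])
    qed
    have 7: "eventually (\<lambda>n. 16 * exp (- C * L n) * sqrt (L n) * L n \<le> 1) sequentially"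
    proof -
      have "((\<lambda>L. 16 * exp (- C * L) * sqrt L * L) \<longlongrightarrow> 0) at_top" using C(1) by real_asymp
      from order_tendstoD(2)[OF this, of 1] have "eventually (\<lambda>L. 16 * exp (- C * L) * sqrt L * L \<le> 1) at_top" by (auto elim: eventually_mono)
      from evL[OF this] show ?thesis .
    qed
    have 8: "eventually (\<lambda>n. (L n + 1) ^ 3 \<le> exp (L n) - 1) sequentially" by (rule evL) real_asymp
    \<comment> \<open>\<open>(39/40)\<^sup>2 * 2 = 1521/800\<close> lies just above the 19/10
      demanded by \<open>pair_bound_simplified\<close>.\<close>
    have 9: "eventually (\<lambda>n. 39/40 * sqrt (2 * L n) \<le> y n + 3 / L n) sequentially"
      using evL[OF lev[of "39/40" 2 3]] by (auto elim!: eventually_mono simp: y_def)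
    show ?thesis using 1 2 3 4 5 6 7 8 9 C(2)
    proof eventually_elim
      case (elim n)
      have "(39/40 * sqrt (2 * L n))\<^sup>2 \<le> (y n + 3 / L n)\<^sup>2" using elim by (intro power_mono) auto
      moreover have "(39/40 * sqrt (2 * L n))\<^sup>2 = 1521/800 * L n"
        unfolding power_mult_distrib using elim by (simp add: power2_eq_square[of "39/40"])
      ultimately have "19/10 * L n \<le> (y n + 3 / L n)\<^sup>2" using elim by linarith
      moreover have "0 \<le> 39/40 * sqrt (2 * L n)" using elim by simp
      then have "0 \<le> y n + 3 / L n" using elim by linarith
      moreover have "32 * (L n)\<^sup>2 \<le> C * sqrt (real n)" using elim(1) C(1) by (simp add: field_simps)
      ultimately show ?case using elim by blast
    qed
  qed
  \<comment> \<open>This collects all that probability theory contributes; from here on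
    \<open>P n\<close> is squeezed between explicit real sequences.\<close>
  then have bounds: "eventually (\<lambda>n. L n \<ge> 1 \<and> real (p n) = exp (L n) \<and> 0 \<le> \<delta> n \<and> \<delta> n \<le> 12 * exp (- 2 * L n) \<and> L n \<le> real (l n) \<and> real (l n) \<le> L n + 1
      \<and> real (K n) * real (B n) \<le> exp (L n) \<and> exp (L n) \<le> real (K n) * real (B n) + real (B n)
      \<and> P n \<le> \<delta> n + exp (- (real (K n) * ((real (B n) - real (m n)) * t 4 n - ?pp n - \<delta> n)))
      \<and> (real (B n) * t (-4) n + \<delta> n \<le> 1 \<longrightarrow> (1 - (real (B n) * t (-4) n + \<delta> n)) ^ K n - \<delta> n - (real (K n) * real (m n) + real (B n)) * t (-2) n \<le> P n)
      \<and> ?E n = P n) sequentially"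
  proof eventually_elim
    case (elim n)
    interpret S: ar_sample "M n" n "p n" "r n" "X n" by (rule sample)
    interpret ar_blocks "M n" n "p n" "r n" "X n" "\<epsilon> n" "1 / L n" "y n" "m n" "B n" "K n"
      unfolding \<epsilon>_def m_def B_def K_def l_def L_def
      by (rule S.corr_blocks[where C=C]) (use elim C(1) in \<open>auto simp: L_def\<close>)
    have d: "\<delta> n = bad" unfolding \<delta>_def bad_def ..
    have pL: "real (p n) = exp (L n)" using p2 unfolding L_def by simp
    have dle: "\<delta> n \<le> 12 * exp (- 2 * L n)"
      unfolding \<delta>_def \<epsilon>_def L_def by (rule S.bad_le) (use p2 n_pos eps elim in \<open>auto simp: L_def \<epsilon>_def\<close>)
    have ll: "L n \<le> real (l n)" "real (l n) \<le> L n + 1" using elim unfolding l_def by linarith+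
    have kb: "real (K n) * real (B n) \<le> exp (L n)" "exp (L n) \<le> real (K n) * real (B n) + real (B n)"
      unfolding pL[symmetric] using KB by (simp_all add: of_nat_mult[symmetric] of_nat_add[symmetric] del: of_nat_mult of_nat_add)
    have Pl: "P n = measure (M n) {\<omega> \<in> space (M n). max_corr n (p n) (\<lambda>k. X n k \<omega>) \<le> level}" unfolding P_def level_def ..
    have z2: "y n + 3 / L n \<le> 2 * sqrt (L n)"
    proof -
      have "3 / L n \<le> 5 / L n" using elim by (intro divide_right_mono) auto
      then show ?thesis using elim by linarith
    qed
    have pair: "measure (M n) {\<omega> \<in> space (M n). S.Wst i \<omega> > y n + 3 * (1 / L n) \<and> S.Wst j \<omega> > y n + 3 * (1 / L n)} \<le> exp (1 - 29/25 * L n)" if "i < j" "Suc j < p n" for i j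
      unfolding L_def using S.pair_bound_simplified[OF that, of "y n + 3 / L n"] elim z2 by (simp add: L_def)
    have up: "P n \<le> \<delta> n + exp (- (real (K n) * ((real (B n) - real (m n)) * t 4 n - ?pp n - \<delta> n)))"
      using prob_max_upper[OF pair] unfolding Pl d t_def by simp
    have lo: "(1 - (real (B n) * t (-4) n + \<delta> n)) ^ K n - \<delta> n - (real (K n) * real (m n) + real (B n)) * t (-2) n \<le> P n" if "real (B n) * t (-4) n + \<delta> n \<le> 1"
      using prob_max_lower that unfolding Pl d t_def by simp
    have "?E n = P n"
    proof -
      have r2: "(r n)\<^sup>2 < 1" using r_range[of n] by (simp add: abs_square_less_1)
      have "L n > 0" using elim by simp
      from max_event_rescale[OF this, of "real n" "r n" _ x] n_pos r2 show ?thesis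
        unfolding P_def y_def L_def by simp
    qed
    then show ?case using elim pL dle ll kb up lo bad_nonneg d by simp
  qed
  have tl: "(\<lambda>n. exp (L n) * t c n) \<longlonglongrightarrow> exp (- x)" for c
    unfolding t_def y_def using limL[OF gumbel_tail_limit[of x c]] by simp
  have t0: "0 \<le> t c n" for c n unfolding t_def normal_tail_def by simp
  \<comment> \<open>The share of a single block among the \<open>p\<close> columns; it also bounds
    the part missed by all blocks.\<close>
  define b where "b n = real (B n) / exp (L n)" for n
  have Ble: "eventually (\<lambda>n. real (B n) \<le> (L n + 1) ^ 3) sequentially"
    using bounds by eventually_elim (simp add: B_def power_mono)
  have b0: "b \<longlonglongrightarrow> 0"
  proof (rule tendsto_sandwich[OF _ _ tendsto_const])
    show "(\<lambda>n. (L n + 1) ^ 3 / exp (L n)) \<longlonglongrightarrow> 0" by (rule limL) real_asymp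
    show "eventually (\<lambda>n. b n \<le> (L n + 1) ^ 3 / exp (L n)) sequentially"
      using Ble by eventually_elim (auto simp: b_def intro: divide_right_mono)
  qed (auto simp: b_def)
  define k where "k n = real (K n) * real (B n) / exp (L n)" for n
  have k1: "k \<longlonglongrightarrow> 1"
  proof (rule tendsto_sandwich[OF _ _ _ tendsto_const])
    show "(\<lambda>n. 1 - b n) \<longlonglongrightarrow> 1" using tendsto_diff[OF tendsto_const b0, of 1] by simp
    show "eventually (\<lambda>n. 1 - b n \<le> k n) sequentially" using bounds
    proof eventually_elim
      case (elim n)
      then have "exp (L n) / exp (L n) \<le> (real (K n) * real (B n) + real (B n)) / exp (L n)" by (intro divide_right_mono) auto
      then show ?case by (simp add: b_def k_def add_divide_distrib)
    qed
    show "eventually (\<lambda>n. k n \<le> 1) sequentially" using bounds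
      by eventually_elim (simp add: k_def)
  qed
  have il: "(\<lambda>n. 1 / real (l n)) \<longlonglongrightarrow> 0"
  proof (rule tendsto_sandwich[OF _ _ tendsto_const])
    show "(\<lambda>n. 1 / L n) \<longlonglongrightarrow> 0" by (rule limL) real_asymp
    show "eventually (\<lambda>n. 1 / real (l n) \<le> 1 / L n) sequentially" using bounds
      by eventually_elim (auto intro!: divide_left_mono)
  qed auto
  have d0: "\<delta> \<longlonglongrightarrow> 0"
  proof (rule tendsto_sandwich[OF _ _ tendsto_const])
    show "(\<lambda>n. 12 * exp (- 2 * L n)) \<longlonglongrightarrow> 0" by (rule limL) real_asymp
  qed (use bounds in \<open>auto elim: eventually_mono\<close>)
  \<comment> \<open>There are at most \<open>p\<close> blocks, and each is charged an error of order
    p^(-2).\<close>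
  have Kd0: "(\<lambda>n. real (K n) * \<delta> n) \<longlonglongrightarrow> 0"
  proof (rule tendsto_sandwich[OF _ _ tendsto_const])
    show "(\<lambda>n. exp (L n) * (12 * exp (- 2 * L n))) \<longlonglongrightarrow> 0" by (rule limL) real_asymp
    show "eventually (\<lambda>n. real (K n) * \<delta> n \<le> exp (L n) * (12 * exp (- 2 * L n))) sequentially" using bounds
    proof eventually_elim
      case (elim n)
      have "1 \<le> real (B n)" using elim unfolding B_def by (simp add: one_le_power)
      then have "real (K n) * 1 \<le> real (K n) * real (B n)" by (intro mult_left_mono) auto
      then show ?case using elim by (intro mult_mono) auto
    qed
    show "eventually (\<lambda>n. 0 \<le> real (K n) * \<delta> n) sequentially" using bounds by eventually_elim auto
  qed
  \<comment> \<open>\<open>real (K n) * real (B n)\<close> is at most \<open>p\<close>, so one block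
    length remains as a logarithmic factor against p^(1 - 29/25) = p^(-4/25).\<close>
  have pair0: "(\<lambda>n. real (K n) * ?pp n) \<longlonglongrightarrow> 0"
  proof (rule tendsto_sandwich[OF _ _ tendsto_const])
    show "(\<lambda>n. exp (L n) * ((L n + 1) ^ 3 * (exp (1 - 29/25 * L n) + 12 * exp (- 2 * L n)))) \<longlonglongrightarrow> 0" by (rule limL) real_asymp
    show "eventually (\<lambda>n. real (K n) * ?pp n \<le> exp (L n) * ((L n + 1) ^ 3 * (exp (1 - 29/25 * L n) + 12 * exp (- 2 * L n)))) sequentially"
      using bounds Ble
    proof eventually_elim
      case (elim n)
      have "real (K n) * ?pp n = (real (K n) * real (B n)) * (real (B n) * (exp (1 - 29/25 * L n) + \<delta> n))"
        by (simp add: power2_eq_square)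
      also have "\<dots> \<le> exp (L n) * ((L n + 1) ^ 3 * (exp (1 - 29/25 * L n) + 12 * exp (- 2 * L n)))"
        using elim by (intro mult_mono) auto
      finally show ?case .
    qed
    show "eventually (\<lambda>n. 0 \<le> real (K n) * ?pp n) sequentially" using bounds by eventually_elim auto
  qed
  have KBt: "(\<lambda>n. real (K n) * (real (B n) * t c n)) \<longlonglongrightarrow> exp (- x)" for c
  proof -
    have "(\<lambda>n. k n * (exp (L n) * t c n)) \<longlonglongrightarrow> 1 * exp (- x)" by (intro tendsto_mult k1 tl)
    then show ?thesis by (simp add: k_def mult.assoc)
  qed
  \<comment> \<open>The discarded fraction \<open>m n / B n\<close> equals \<open>1 / l n\<close>,
    so the positions skipped at the block starts are negligible.\<close>
  have Kmt: "(\<lambda>n. real (K n) * real (m n) * t c n) \<longlonglongrightarrow> 0" for c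
  proof -
    have "(\<lambda>n. 1 / real (l n) * (real (K n) * (real (B n) * t c n))) \<longlonglongrightarrow> 0 * exp (- x)" by (intro tendsto_mult il KBt)
    moreover have "eventually (\<lambda>n. 1 / real (l n) * (real (K n) * (real (B n) * t c n)) = real (K n) * real (m n) * t c n) sequentially"
      using bounds
    proof eventually_elim
      case (elim n)
      then have "real (l n) > 0" by linarith
      then show ?case by (simp add: B_def m_def power3_eq_cube power2_eq_square)
    qed
    ultimately show ?thesis by (auto elim: Lim_transform_eventually)
  qed
  have Bt: "(\<lambda>n. real (B n) * t c n) \<longlonglongrightarrow> 0" for c
  proof -
    have "(\<lambda>n. b n * (exp (L n) * t c n)) \<longlonglongrightarrow> 0 * exp (- x)" by (intro tendsto_mult b0 tl)
    then show ?thesis by (simp add: b_def)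
  qed
  define U where "U n = \<delta> n + exp (- (real (K n) * (real (B n) * t 4 n) - real (K n) * real (m n) * t 4 n - real (K n) * ?pp n - real (K n) * \<delta> n))" for n
  have U: "U \<longlonglongrightarrow> exp (- exp (- x))"
  proof -
    have "U \<longlonglongrightarrow> 0 + exp (- (exp (- x) - 0 - 0 - 0))"
      unfolding U_def[abs_def] by (intro tendsto_add d0 tendsto_exp tendsto_minus tendsto_diff KBt Kmt pair0 Kd0)
    then show ?thesis by simp
  qed
  define h where "h n = real (B n) * t (-4) n + \<delta> n" for n
  have h0: "h \<longlonglongrightarrow> 0" unfolding h_def[abs_def] using tendsto_add[OF Bt d0, of "-4"] by simp
  have Kh: "(\<lambda>n. real (K n) * h n) \<longlonglongrightarrow> exp (- x)"
    unfolding h_def distrib_left using tendsto_add[OF KBt Kd0, of "-4"] by simp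
  define Lw where "Lw n = exp (- (real (K n) * h n + 2 * (real (K n) * h n) * h n)) - \<delta> n - (real (K n) * real (m n) * t (-2) n + real (B n) * t (-2) n)" for n
  have Lw: "Lw \<longlonglongrightarrow> exp (- exp (- x))"
  proof -
    have "Lw \<longlonglongrightarrow> exp (- (exp (- x) + 2 * exp (- x) * 0)) - 0 - (0 + 0)"
      unfolding Lw_def[abs_def] by (intro tendsto_diff tendsto_add tendsto_exp tendsto_minus tendsto_mult tendsto_const Kh h0 d0 Kmt Bt)
    then show ?thesis by simp
  qed
  have hs: "eventually (\<lambda>n. h n < 1/2) sequentially" using order_tendstoD(2)[OF h0, of "1/2"] by simp
  have "P \<longlonglongrightarrow> exp (- exp (- x))"
  proof (rule tendsto_sandwich[OF _ _ Lw U])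
    show "eventually (\<lambda>n. P n \<le> U n) sequentially" using bounds
    proof eventually_elim
      case (elim n)
      have "U n = \<delta> n + exp (- (real (K n) * ((real (B n) - real (m n)) * t 4 n - ?pp n - \<delta> n)))"
        unfolding U_def by (simp add: algebra_simps)
      then show ?case using elim by simp
    qed
    show "eventually (\<lambda>n. Lw n \<le> P n) sequentially" using bounds hs
    proof eventually_elim
      case (elim n)
      have hn: "0 \<le> h n" using elim t0 unfolding h_def by simp
      have "exp (- (real (K n) * h n + 2 * (real (K n) * h n) * h n)) \<le> (1 - h n) ^ K n"
        using hn elim by (intro power_one_minus_ge_exp) auto
      moreover have "(1 - h n) ^ K n - \<delta> n - (real (K n) * real (m n) + real (B n)) * t (-2) n \<le> P n"
        using elim unfolding h_def by auto
      ultimately show ?case unfolding Lw_def by (simp add: distrib_right)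
    qed
  qed
  moreover have "eventually (\<lambda>n. P n = ?E n) sequentially"
    using bounds by eventually_elim (elim conjE, rule sym)
  ultimately show "(\<lambda>n. ?E n) \<longlonglongrightarrow> exp (- exp (- x))"
    by (rule Lim_transform_eventually)
qed

end
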